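(* Consider a $d$-dimensional diagonal Gaussian mixture model with parameters $\{(\omega_i,\mu_i,\Sigma_i):i\in[r]\}$ and $r\le\frac d2-1$, with mean $M_1$ and third order moment tensor $M_3$. Let $n=d-1$, let $\xi$ be the vector chosen in the learning algorithm described in the context, let $p_i:=\sqrt[3]{\omega_i}\,\mu_i$ and $\mathcal{F}=\sum_{i=1}^r\omega_i\mu_i^{\otimes3}=\sum_{i=1}^rp_i^{\otimes3}$, and assume: (i) the leading (first) entry of each $p_i$ is nonzero; (ii) the subvectors $(p_1)_{2:r+1},\ldots,(p_r)_{2:r+1}$ are linearly independent; (iii) for each $j\in[r+1,n]$, the subvectors $(p_1)_{[r+2:j,\,j+2:d]},\ldots,(p_r)_{[r+2:j,\,j+2:d]}$ are linearly independent; (iv) the eigenvalues of the matrix $N(\xi)$ (defined from the generating matrix of $\mathcal{F}$ in the context) are distinct from each other. Let $\{(\omega_i^*,\mu_i^*,\Sigma_i^* ):i\in[r]\}$ be produced by the learning algorithm described in the context, with sample averages $\widehat M_1,\widehat M_3$. If $\epsilon:=\max(\|M_3-\widehat M_3\|,\|M_1-\widehat M_1\|)$ is small enough, then, up to a permutation of the components, $$\|\mu_i-\mu_i^*\|=O(\epsilon),\qquad \|\omega_i-\omega_i^*\|=O(\epsilon),\qquad \|\Sigma_i-\Sigma_i^*\|=O(\epsilon),\qquad i=1,\ldots,r,$$ where the constants inside $O(\cdot)$ depend only on the parameters $\{(\omega_i,\mu_i,\Sigma_i):i\in[r]\}$ and on the choice of $\xi$.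
   Context: Model. A $d$-dimensional diagonal Gaussian mixture model with $r$ components has weights $\omega_i>0$, $\sum_{i=1}^r\omega_i=1$, means $\mu_i\in\mathbb{R}^d$ and diagonal covariance matrices $\Sigma_i=\mathrm{diag}(\sigma_{i1}^2,\ldots,\sigma_{id}^2)$; the random vector $y\in\mathbb{R}^d$ is drawn from $\mathcal{N}(\mu_i,\Sigma_i)$ with probability $\omega_i$. $M_1=\mathbb{E}[y]=\sum_i\omega_i\mu_i$ and $M_3=\mathbb{E}[y\otimes y\otimes y]$. Notation. $[r]=\{1,\ldots,r\}$, $[r+1,n]=\{r+1,\ldots,n\}$, $n=d-1$. Vectors in $\mathbb{C}^d$ are labelled $1,\ldots,d$; $(p)_{a:b}=(p_a,\ldots,p_b)$, and $(p)_{[r+2:j,\,j+2:d]}$ is the subvector with entries indexed by $\{r+2,\ldots,j\}\cup\{j+2,\ldots,d\}$. Except where indicated in Step 5 below, third order tensors are labelled by $0,\ldots,n$, so $(p^{\otimes3})_{i_1i_2i_3}=p_{i_1+1}p_{i_2+1}p_{i_3+1}$. $\Omega$ is the set of labels $(i_1,i_2,i_3)$ with pairwise distinct entries. $\mathcal{T}_J$ is the subtensor of entries labelled by $J$. Norms of vectors, matrices and (sub)tensors are the square root of the sum of squared moduli of entries. $\sqrt[3]{\cdot}$ is the principal cube root, $^H$ the conjugate transpose. Matrices. For a symmetric subtensor $\mathcal{T}_\Omega$ and $i\in[r]$, $j\in[r+1,n]$, $A_{ij}[\mathcal{T}]\in\mathbb{C}^{(n-r-1)\times r}$ and $b_{ij}[\mathcal{T}]\in\mathbb{C}^{n-r-1}$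 have rows labelled by $l\in[r+1,n]\setminus\{j\}$, with $A_{ij}[\mathcal{T}]_{l,k}=\mathcal{T}_{0kl}$ ($k\in[r]$) and $b_{ij}[\mathcal{T}]_l=\mathcal{T}_{ijl}$. Let $e_i$ be the $i$th standard unit vector and $\mathscr{B}_1=\{e_i+e_j:i\in[r],j\in[r+1,n]\}$. For a matrix $G$ with entries $G(k,\alpha)$, $k\in[r]$, $\alpha\in\mathscr{B}_1$, and $l\in[r+1,n]$, $N_l(G)\in\mathbb{C}^{r\times r}$ is the matrix whose $(i,k)$ entry is $G(k,e_i+e_l)$. The generating matrix $G$ of $\mathcal{F}$ is the matrix (unique under (i)-(ii)) with $\sum_{k=1}^rG(k,e_i+e_j)\mathcal{F}_{0kt}=\mathcal{F}_{ijt}$ for all $i\in[r]$, $j\in[r+1,n]$, $t=0,\ldots,n$, and for $\xi=(\xi_{r+1},\ldots,\xi_n)$, $N(\xi)=\sum_{l=r+1}^n\xi_lN_l(G)$. Tensor approximation algorithm (input: symmetric subtensor $\widehat{\mathcal{F}}_\Omega$ and $r\le\frac d2-1$). (a) For each $i\in[r]$, $j\in[r+1,n]$, let $\widehat G(:,e_i+e_j)$ be an optimizer of $\min_{g\in\mathbb{C}^r}\|A_{ij}[\widehat{\mathcal{F}}]g-b_{ij}[\widehat{\mathcal{F}}]\|^2$; these form $\widehat G$. (b) With a chosen (generic) vector $\xi$, let $\widehat N(\xi)=\sum_{l=r+1}^n\xi_lN_l(\widehat G)$, let $\hat v_1,\ldots,\hat v_r$ be unit length eigenvectors of $\widehat N(\xi)$,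 and $\hat w_k=(\hat v_k^HN_{r+1}(\widehat G)\hat v_k,\ldots,\hat v_k^HN_n(\widehat G)\hat v_k)$. (c) Let $J_1=\{(0,i_1,i_2):i_1\in[r],i_2\in[r+1,n]\}$, $J_2=\{(i_1,i_2,i_3):i_1\ne i_2,\ i_1,i_2\in[r],\ i_3\in[r+1,n]\}$. Let $\hat\beta$ be an optimizer of $\min_\beta\|\widehat{\mathcal{F}}_{J_1}-\sum_{k}\beta_k\hat v_k\otimes\hat w_k\|^2$ and $\hat\theta$ an optimizer of $\min_\theta\|\widehat{\mathcal{F}}_{J_2}-\sum_k\theta_k(\hat v_k\otimes\hat v_k\otimes\hat w_k)_{J_2}\|^2$ (entries of $\hat v_k$ labelled $1,\ldots,r$, of $\hat w_k$ labelled $r+1,\ldots,n$). Set $\hat\lambda_k=\hat\beta_k^2/\hat\theta_k$, $\hat\gamma_k=\hat\theta_k/\hat\beta_k$. (d) Set $\hat p_k=\sqrt[3]{\hat\lambda_k}(1,\hat\gamma_k\hat v_k,\hat w_k)$. (e) Using $\hat p_1,\ldots,\hat p_r$ as starting points, solve $\min_{(q_1,\ldots,q_r)}\|(\sum_kq_k^{\otimes3}-\widehat{\mathcal{F}})_\Omega\|^2$ for a minimizer $(p_1^*,\ldots,p_r^* )$, which is the output. Learning algorithm (input: samples $y_1,\ldots,y_N\in\mathbb{R}^d$ from the mixture model, and $r$). Step 1. Compute $\widehat M_1=\frac1N\sum_{i=1}^Ny_i$ and $\widehat M_3=\frac1N\sum_{i=1}^Ny_i^{\otimes3}$. Step 2.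 Apply the tensor approximation algorithm to $\widehat{\mathcal{F}}_\Omega:=(\widehat M_3)_\Omega$ to get $p_1^*,\ldots,p_r^*$. Let $\hat q_i=\mathrm{Re}(\tau_ip_i^* )$, where $\tau_i$ is the cube root of $1$ minimizing $\|\mathrm{Im}(\tau_ip_i^* )\|$. Step 3. Let $(\beta_1^*,\ldots,\beta_r^* )$ be an optimizer of $\min_{\beta\in\mathbb{R}^r_+}\|\widehat M_1-\sum_{i=1}^r\beta_i\hat q_i\|^2$ (with $\mathbb{R}_+^r$ the nonnegative orthant); set $\hat\omega_i=(\beta_i^* )^{3/2}$ and $\hat\mu_i=\hat q_i/\sqrt[3]{\hat\omega_i}$. Step 4. Using $\hat\mu_i$ and $(\sum_j\hat\omega_j)^{-1}\hat\omega_i$ as starting points, solve $$\min_{(\omega_1,\ldots,\omega_r,\mu_1,\ldots,\mu_r)}\Big\|\sum_{i=1}^r\omega_i\mu_i-\widehat M_1\Big\|^2+\Big\|\sum_{i=1}^r\omega_i(\mu_i^{\otimes3})_\Omega-(\widehat M_3)_\Omega\Big\|^2\ \text{ s.t. }\ \sum_{i=1}^r\omega_i=1,\ \omega_i\ge0$$ (over real $\omega_i$ and $\mu_i\in\mathbb{R}^d$) for an optimizer $(\omega_1^*,\ldots,\omega_r^*,\mu_1^*,\ldots,\mu_r^* )$. Step 5. Let $\widehat{\mathcal{A}}=\widehat M_3-\sum_{i=1}^r\hat q_i^{\otimes3}$, with labels here taken in $1,\ldots,d$. Define $\hat a_j\in\mathbb{R}^d$, $j=1,\ldots,d$, by $(\hat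 a_j)_j=\frac13\widehat{\mathcal{A}}_{jjj}$ and $(\hat a_j)_i=\widehat{\mathcal{A}}_{jij}$ for $i\ne j$. For each $j$ let $(\beta_{1j}^*,\ldots,\beta_{rj}^* )$ be an optimizer of $\min\|\hat a_j-\sum_{i=1}^r\omega_i^*\mu_i^*\beta_{ij}\|^2$ subject to $\beta_{1j}\ge0,\ldots,\beta_{rj}\ge0$. Set $\Sigma_i^*=\mathrm{diag}(\beta_{i1}^*,\ldots,\beta_{id}^* )$. Output: $(\mu_i^*,\Sigma_i^*,\omega_i^* )$, $i=1,\ldots,r$. Meaning of the conclusion: there are $\epsilon_0>0$ and $C>0$ depending only on the parameters and $\xi$ such that for $\epsilon\le\epsilon_0$ the estimates hold with $C\epsilon$ in place of $O(\epsilon)$, after relabelling the components $(\omega_i,\mu_i,\Sigma_i)$. *)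

theory Defs
  imports "HOL-Probability.Probability" "Jordan_Normal_Form.Char_Poly" "Jordan_Normal_Form.Spectral_Radius"
begin

text \<open>
  Vectors in dimension \<open>d\<close> are functions on \<open>nat\<close> read at the labels \<open>1..d\<close>; third order tensors
  are functions on triples read at the labels \<open>0..n\<close> with \<open>n = d - 1\<close>, so tensor label \<open>i\<close>
  corresponds to vector label \<open>i + 1\<close>. Mixture components are numbered \<open>1..r\<close>. Values at other
  labels are never used.
\<close>

type_synonym 'a tensor3 = "nat \<times> nat \<times> nat \<Rightarrow> 'a"

definition cube :: "(nat \<Rightarrow> 'a::comm_ring_1) \<Rightarrow> 'a tensor3" where
  "cube p = (\<lambda>(i, j, k). p (i + 1) * p (j + 1) * p (k + 1))"

definition norm_on :: "'i set \<Rightarrow> ('i \<Rightarrow> 'a::real_normed_vector) \<Rightarrow> real" where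
  "norm_on J x = L2_set (\<lambda>t. norm (x t)) J"

definition all_labels :: "nat \<Rightarrow> (nat \<times> nat \<times> nat) set" where
  "all_labels d = {0..d-1} \<times> {0..d-1} \<times> {0..d-1}"

definition Omega :: "nat \<Rightarrow> (nat \<times> nat \<times> nat) set" where
  "Omega d = {(i, j, k) \<in> all_labels d. i \<noteq> j \<and> i \<noteq> k \<and> j \<noteq> k}"

definition diag_matrix :: "(nat \<Rightarrow> real) \<Rightarrow> nat \<times> nat \<Rightarrow> real" where
  "diag_matrix s = (\<lambda>(i, j). if i = j then s i else 0)"

text \<open>Linear independence of the family \<open>x 1, \<dots>, x r\<close> of vectors with entries labelled by \<open>S\<close>.\<close>

definition lin_indep_on :: "nat \<Rightarrow> nat set \<Rightarrow> (nat \<Rightarrow> nat \<Rightarrow> 'a::field) \<Rightarrow> bool" where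
  "lin_indep_on r S x \<longleftrightarrow>
     (\<forall>c. (\<forall>t\<in>S. (\<Sum>k=1..r. c k * x k t) = 0) \<longrightarrow> (\<forall>k\<in>{1..r}. c k = 0))"


section \<open>Diagonal Gaussian mixtures and their moments\<close>

text \<open>The law of \<open>m + s Z\<close> with \<open>Z\<close> standard normal, that is, N(m, s^2); a point mass if \<open>s = 0\<close>.\<close>

definition normal_law :: "real \<Rightarrow> real \<Rightarrow> real measure" where
  "normal_law m s = distr (density lborel std_normal_density) borel (\<lambda>z. m + s * z)"

definition diag_gaussian :: "nat \<Rightarrow> (nat \<Rightarrow> real) \<Rightarrow> (nat \<Rightarrow> real) \<Rightarrow> (nat \<Rightarrow> real) measure" where
  "diag_gaussian d m s = (\<Pi>\<^sub>M j\<in>{1..d}. normal_law (m j) (s j))"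

definition gaussian_mixture ::
  "nat \<Rightarrow> nat \<Rightarrow> (nat \<Rightarrow> real) \<Rightarrow> (nat \<Rightarrow> nat \<Rightarrow> real) \<Rightarrow> (nat \<Rightarrow> nat \<Rightarrow> real) \<Rightarrow> (nat \<Rightarrow> real) measure"
  where
  "gaussian_mixture d r \<omega> \<mu> \<sigma> =
     point_measure {1..r} (\<lambda>i. ennreal (\<omega> i)) \<bind> (\<lambda>i. diag_gaussian d (\<mu> i) (\<sigma> i))"

definition moment1 :: "(nat \<Rightarrow> real) measure \<Rightarrow> nat \<Rightarrow> real" where
  "moment1 D j = (\<integral>y. y j \<partial>D)"

definition moment3 :: "(nat \<Rightarrow> real) measure \<Rightarrow> real tensor3" where
  "moment3 D t = (\<integral>y. cube y t \<partial>D)"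

definition sample_moment1 :: "nat \<Rightarrow> (nat \<Rightarrow> nat \<Rightarrow> real) \<Rightarrow> nat \<Rightarrow> real" where
  "sample_moment1 N y j = (\<Sum>s=1..N. y s j) / real N"

definition sample_moment3 :: "nat \<Rightarrow> (nat \<Rightarrow> nat \<Rightarrow> real) \<Rightarrow> real tensor3" where
  "sample_moment3 N y t = (\<Sum>s=1..N. cube (y s) t) / real N"


section \<open>Generating matrices\<close>

text \<open>
  A matrix \<open>G\<close> with rows \<open>1..r\<close> and columns in \<open>\<B>\<^sub>1\<close> is a function whose value \<open>G k (i, j)\<close>
  is the entry in row \<open>k\<close> and column \<open>e\<^sub>i + e\<^sub>j\<close>, for \<open>i \<in> {1..r}\<close>, \<open>j \<in> {r+1..n}\<close>.
\<close>

type_synonym gmatrix = "nat \<Rightarrow> nat \<times> nat \<Rightarrow> complex"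

definition generating_matrix :: "nat \<Rightarrow> nat \<Rightarrow> complex tensor3 \<Rightarrow> gmatrix \<Rightarrow> bool" where
  "generating_matrix d r T G \<longleftrightarrow>
     (\<forall>i\<in>{1..r}. \<forall>j\<in>{r+1..d-1}. \<forall>t\<in>{0..d-1}.
        (\<Sum>k=1..r. G k (i, j) * T (0, k, t)) = T (i, j, t))"

text \<open>Library matrices and vectors are indexed from \<open>0\<close>, hence the shifts of \<open>i\<close> and \<open>k\<close>.\<close>

definition N_mat :: "nat \<Rightarrow> gmatrix \<Rightarrow> nat \<Rightarrow> complex Matrix.mat" where
  "N_mat r G l = Matrix.mat r r (\<lambda>(i, k). G (k + 1) (i + 1, l))"

definition N_xi :: "nat \<Rightarrow> nat \<Rightarrow> (nat \<Rightarrow> complex) \<Rightarrow> gmatrix \<Rightarrow> complex Matrix.mat" where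
  "N_xi d r \<xi> G = Matrix.mat r r (\<lambda>(i, k). \<Sum>l=r+1..d-1. \<xi> l * N_mat r G l $$ (i, k))"

definition to_vec :: "nat \<Rightarrow> (nat \<Rightarrow> complex) \<Rightarrow> complex Matrix.vec" where
  "to_vec r v = Matrix.vec r (\<lambda>i. v (i + 1))"

definition A_mat :: "complex tensor3 \<Rightarrow> nat \<Rightarrow> nat \<Rightarrow> complex" where
  "A_mat T l k = T (0, k, l)"

definition b_vec :: "nat \<Rightarrow> nat \<Rightarrow> complex tensor3 \<Rightarrow> nat \<Rightarrow> complex" where
  "b_vec i j T l = T (i, j, l)"


section \<open>The tensor approximation algorithm\<close>

text \<open>
  The algorithms involve choices (of optimizers and of eigenvectors), so they are relations between
  input and possible output. Every optimizer is a global one.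
\<close>

definition step_a :: "nat \<Rightarrow> nat \<Rightarrow> complex tensor3 \<Rightarrow> gmatrix \<Rightarrow> bool" where
  "step_a d r T G \<longleftrightarrow>
     (\<forall>i\<in>{1..r}. \<forall>j\<in>{r+1..d-1}.
        is_arg_min
          (\<lambda>g. (norm_on ({r+1..d-1} - {j}) (\<lambda>l. (\<Sum>k=1..r. A_mat T l k * g k) - b_vec i j T l))\<^sup>2)
          (\<lambda>_. True) (\<lambda>k. G k (i, j)))"

text \<open>
  The \<open>r\<close> eigenvectors are an eigenbasis; the entries of \<open>v k\<close> are labelled \<open>1..r\<close> and those of
  \<open>w k\<close> are labelled \<open>r+1..n\<close>.
\<close>

definition step_b ::
  "nat \<Rightarrow> nat \<Rightarrow> (nat \<Rightarrow> complex) \<Rightarrow> gmatrix \<Rightarrow> (nat \<Rightarrow> nat \<Rightarrow> complex) \<Rightarrow> (nat \<Rightarrow> nat \<Rightarrow> complex) \<Rightarrow> bool"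
  where
  "step_b d r \<xi> G v w \<longleftrightarrow>
     (\<forall>k\<in>{1..r}. norm_on {1..r} (v k) = 1 \<and> (\<exists>c. eigenvector (N_xi d r \<xi> G) (to_vec r (v k)) c)) \<and>
     lin_indep_on r {1..r} v \<and>
     (\<forall>k\<in>{1..r}. \<forall>l\<in>{r+1..d-1}.
        w k l = (N_mat r G l *\<^sub>v to_vec r (v k)) \<bullet>c to_vec r (v k))"

definition J1 :: "nat \<Rightarrow> nat \<Rightarrow> (nat \<times> nat \<times> nat) set" where
  "J1 d r = {(0, i1, i2) | i1 i2. i1 \<in> {1..r} \<and> i2 \<in> {r+1..d-1}}"

definition J2 :: "nat \<Rightarrow> nat \<Rightarrow> (nat \<times> nat \<times> nat) set" where
  "J2 d r = {(i1, i2, i3). i1 \<noteq> i2 \<and> i1 \<in> {1..r} \<and> i2 \<in> {1..r} \<and> i3 \<in> {r+1..d-1}}"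

definition step_c ::
  "nat \<Rightarrow> nat \<Rightarrow> complex tensor3 \<Rightarrow> (nat \<Rightarrow> nat \<Rightarrow> complex) \<Rightarrow> (nat \<Rightarrow> nat \<Rightarrow> complex) \<Rightarrow>
   (nat \<Rightarrow> complex) \<Rightarrow> (nat \<Rightarrow> complex) \<Rightarrow> bool"
  where
  "step_c d r T v w \<beta> \<theta> \<longleftrightarrow>
     is_arg_min
       (\<lambda>b. (norm_on (J1 d r) (\<lambda>(i0, i1, i2). T (i0, i1, i2) - (\<Sum>k=1..r. b k * (v k i1 * w k i2))))\<^sup>2)
       (\<lambda>_. True) \<beta> \<and>
     is_arg_min
       (\<lambda>b. (norm_on (J2 d r)
          (\<lambda>(i1, i2, i3). T (i1, i2, i3) - (\<Sum>k=1..r. b k * (v k i1 * v k i2 * w k i3))))\<^sup>2)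
       (\<lambda>_. True) \<theta>"

text \<open>The vector \<open>\<lambda>\<^bsup>1/3\<^esup> (1, \<gamma> v, w)\<close>; complex \<open>powr\<close> is the principal branch, and \<open>0 powr (1/3) = 0\<close>.\<close>

definition step_d ::
  "nat \<Rightarrow> complex \<Rightarrow> complex \<Rightarrow> (nat \<Rightarrow> complex) \<Rightarrow> (nat \<Rightarrow> complex) \<Rightarrow> nat \<Rightarrow> complex" where
  "step_d r lam \<gamma> v w m =
     lam powr (1/3) * (if m = 1 then 1 else if m \<le> r + 1 then \<gamma> * v (m - 1) else w (m - 1))"

text \<open>
  Division by zero yields zero here; where \<open>\<beta> k\<close> or \<open>\<theta> k\<close> vanishes the starting point is
  degenerate, which does not exclude the run.
\<close>

definition tensor_start ::
  "nat \<Rightarrow> nat \<Rightarrow> (nat \<Rightarrow> complex) \<Rightarrow> complex tensor3 \<Rightarrow> (nat \<Rightarrow> nat \<Rightarrow> complex) \<Rightarrow> bool" where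
  "tensor_start d r \<xi> T phat \<longleftrightarrow>
     (\<exists>G v w \<beta> \<theta>. step_a d r T G \<and> step_b d r \<xi> G v w \<and> step_c d r T v w \<beta> \<theta> \<and>
        phat = (\<lambda>k. step_d r ((\<beta> k)\<^sup>2 / \<theta> k) (\<theta> k / \<beta> k) (v k) (w k)))"

text \<open>The starting point only serves to find the global minimizer; it does not restrict it.\<close>

definition tensor_approx ::
  "nat \<Rightarrow> nat \<Rightarrow> (nat \<Rightarrow> complex) \<Rightarrow> complex tensor3 \<Rightarrow> (nat \<Rightarrow> nat \<Rightarrow> complex) \<Rightarrow> bool" where
  "tensor_approx d r \<xi> T pstar \<longleftrightarrow>
     (\<exists>phat. tensor_start d r \<xi> T phat) \<and>
     is_arg_min (\<lambda>q. (norm_on (Omega d) (\<lambda>t. (\<Sum>k=1..r. cube (q k) t) - T t))\<^sup>2) (\<lambda>_. True) pstar"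


section \<open>The learning algorithm\<close>

definition step_2 ::
  "nat \<Rightarrow> nat \<Rightarrow> (nat \<Rightarrow> complex) \<Rightarrow> real tensor3 \<Rightarrow> (nat \<Rightarrow> nat \<Rightarrow> real) \<Rightarrow> bool" where
  "step_2 d r \<xi> M3 qhat \<longleftrightarrow>
     (\<exists>pstar \<tau>. tensor_approx d r \<xi> (\<lambda>t. of_real (M3 t)) pstar \<and>
        (\<forall>i\<in>{1..r}.
           is_arg_min (\<lambda>z. norm_on {1..d} (\<lambda>m. Im (z * pstar i m))) (\<lambda>z. z ^ 3 = 1) (\<tau> i) \<and>
           (\<forall>m\<in>{1..d}. qhat i m = Re (\<tau> i * pstar i m))))"

definition step_3 ::
  "nat \<Rightarrow> nat \<Rightarrow> (nat \<Rightarrow> real) \<Rightarrow> (nat \<Rightarrow> nat \<Rightarrow> real) \<Rightarrow> (nat \<Rightarrow> real) \<Rightarrow> (nat \<Rightarrow> nat \<Rightarrow> real) \<Rightarrow> bool" where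
  "step_3 d r M1 qhat \<omega>hat \<mu>hat \<longleftrightarrow>
     (\<exists>\<beta>. is_arg_min (\<lambda>b. (norm_on {1..d} (\<lambda>m. M1 m - (\<Sum>i=1..r. b i * qhat i m)))\<^sup>2)
            (\<lambda>b. \<forall>i\<in>{1..r}. 0 \<le> b i) \<beta> \<and>
        (\<forall>i\<in>{1..r}. \<omega>hat i = \<beta> i powr (3/2) \<and>
           (\<forall>m\<in>{1..d}. \<mu>hat i m = qhat i m / root 3 (\<omega>hat i))))"

definition step_4 ::
  "nat \<Rightarrow> nat \<Rightarrow> (nat \<Rightarrow> real) \<Rightarrow> real tensor3 \<Rightarrow> (nat \<Rightarrow> real) \<Rightarrow> (nat \<Rightarrow> nat \<Rightarrow> real) \<Rightarrow> bool" where
  "step_4 d r M1 M3 \<omega>s \<mu>s \<longleftrightarrow>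
     is_arg_min
       (\<lambda>(\<omega>, \<mu>). (norm_on {1..d} (\<lambda>m. (\<Sum>i=1..r. \<omega> i * \<mu> i m) - M1 m))\<^sup>2 +
                 (norm_on (Omega d) (\<lambda>t. (\<Sum>i=1..r. \<omega> i * cube (\<mu> i) t) - M3 t))\<^sup>2)
       (\<lambda>(\<omega>, \<mu>). (\<Sum>i=1..r. \<omega> i) = 1 \<and> (\<forall>i\<in>{1..r}. 0 \<le> \<omega> i))
       (\<omega>s, \<mu>s)"

text \<open>Here \<open>j\<close> and \<open>i\<close> are labels in \<open>1..d\<close>, while \<open>A\<close> is labelled from \<open>0\<close>.\<close>

definition a_hat :: "real tensor3 \<Rightarrow> nat \<Rightarrow> nat \<Rightarrow> real" where
  "a_hat A j i = (if i = j then A (j - 1, j - 1, j - 1) / 3 else A (j - 1, i - 1, j - 1))"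

definition step_5 ::
  "nat \<Rightarrow> nat \<Rightarrow> real tensor3 \<Rightarrow> (nat \<Rightarrow> nat \<Rightarrow> real) \<Rightarrow> (nat \<Rightarrow> real) \<Rightarrow> (nat \<Rightarrow> nat \<Rightarrow> real) \<Rightarrow>
   (nat \<Rightarrow> nat \<times> nat \<Rightarrow> real) \<Rightarrow> bool" where
  "step_5 d r M3 qhat \<omega>s \<mu>s \<Sigma>s \<longleftrightarrow>
     (\<exists>B. (\<forall>j\<in>{1..d}.
            is_arg_min
              (\<lambda>b. (norm_on {1..d} (\<lambda>m. a_hat (\<lambda>t. M3 t - (\<Sum>i=1..r. cube (qhat i) t)) j m -
                                         (\<Sum>i=1..r. \<omega>s i * \<mu>s i m * b i)))\<^sup>2)
              (\<lambda>b. \<forall>i\<in>{1..r}. 0 \<le> b i) (\<lambda>i. B i j)) \<and>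
          (\<forall>i\<in>{1..r}. \<Sigma>s i = diag_matrix (B i)))"

text \<open>
  The means \<open>\<mu>hat\<close> and the weights \<open>\<omega>hat\<close>, divided by their sum, are the starting points of
  Step 4, which again do not restrict the global minimizer. The samples \<open>y 1, \<dots>, y N\<close> are
  arbitrary points: a realization of the random sample.
\<close>

definition learning_output ::
  "nat \<Rightarrow> nat \<Rightarrow> (nat \<Rightarrow> complex) \<Rightarrow> nat \<Rightarrow> (nat \<Rightarrow> nat \<Rightarrow> real) \<Rightarrow>
   (nat \<Rightarrow> real) \<Rightarrow> (nat \<Rightarrow> nat \<Rightarrow> real) \<Rightarrow> (nat \<Rightarrow> nat \<times> nat \<Rightarrow> real) \<Rightarrow> bool" where
  "learning_output d r \<xi> N y \<omega>s \<mu>s \<Sigma>s \<longleftrightarrow>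
     (let M1 = sample_moment1 N y; M3 = sample_moment3 N y in
      \<exists>qhat \<omega>hat \<mu>hat.
        step_2 d r \<xi> M3 qhat \<and> step_3 d r M1 qhat \<omega>hat \<mu>hat \<and>
        step_4 d r M1 M3 \<omega>s \<mu>s \<and> step_5 d r M3 qhat \<omega>s \<mu>s \<Sigma>s)"

end

theory Submission
  imports Defs
begin

text \<open>
  Every optimizer the algorithm returns is global, so its residual is at most that of the true
  parameters, which is \<open>O(\<epsilon>)\<close>. Everything therefore reduces to stability of the incomplete
  decomposition: if \<open>\<Sum> q\<^sub>s\<^sup>\<otimes>\<^sup>3\<close> agrees with \<open>\<Sum> p\<^sub>s\<^sup>\<otimes>\<^sup>3\<close> up to \<open>O(\<epsilon>)\<close> on the labels with distinct entries, then
  the \<open>q\<^sub>s\<close> agree with the \<open>p\<^sub>s\<close> up to \<open>O(\<epsilon>)\<close>, a permutation and cube roots of unity, with no a priori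
  bound on the \<open>q\<^sub>s\<close>. The exact generating matrix of \<open>\<Sum> q\<^sub>s\<^sup>\<otimes>\<^sup>3\<close> is \<open>O(\<epsilon>)\<close>-close to \<open>G\<close>, and its matrices
  \<open>N\<^sub>l\<close> have the subvectors of the \<open>q\<^sub>s\<close> as joint eigenvectors. In the eigenbasis of \<open>N(\<xi>)\<close> this is a
  perturbed diagonal matrix with distinct entries, which gives the directions and the ratios of the
  entries of the \<open>q\<^sub>s\<close>; the remaining scales solve linear systems close to the identity.
  The same stability result, applied to \<open>\<omega>\<^sup>1\<^sup>/\<^sup>3 \<mu>\<close>, settles Step 4, where the equation for the mean
  separates weights from means. Step 5 is again a linear system close to the identity.

  Errors are measured along a filter of runs of the algorithm on which \<open>\<epsilon> \<rightarrow> 0\<close>.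
\<close>


text \<open>The obstacle is that closeness is known only at labels with distinct entries and that
  nothing bounds the vectors \<open>Q x s\<close>, so compactness is of no help. Two devices replace
  a bound. For \<open>k\<close> in \<open>I\<close> and \<open>l\<close> in \<open>J - {j}\<close>
  the numbers \<open>T x 0 k l\<close> form a matrix close to one with an explicit left inverse
  \<open>L\<close>. This matrix factors through \<open>X\<close>, so \<open>X\<close> is invertible,
  and the correction \<open>g\<close> of the generating matrix solves a near-identity system whose
  right-hand side involves only entries at distinct labels. Next, each vector is divided by its
  coordinate of largest modulus in the basis \<open>P\<close>, which leaves bounded data and an
  unknown scale. The scale is found from \<open>R x t 0 ^ 3\<close>, which determines
  \<open>R x t 0\<close> up to a cube root of unity, and from
  \<open>(R x t 0)\<^sup>2 * \<gamma> x t\<close>, which then fixes \<open>\<gamma>\<close> as well.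
  The filter makes constants uniform: a bound \<open>C * e x\<close> that holds eventually has one
  \<open>C\<close> for all runs with small enough error, whatever the sample size.\<close>

declare One_nat_def [simp del]

section \<open>Linear algebra\<close>

lemma sum_kron:
  fixes f :: "'i \<Rightarrow> 'a::comm_ring_1"
  assumes "finite S" "t \<in> S"
  shows "(\<Sum>s\<in>S. f s * (if s = t then 1 else 0)) = f t" "(\<Sum>s\<in>S. f s * (if t = s then 1 else 0)) = f t"
    "(\<Sum>s\<in>S. (if s = t then 1 else 0) * f s) = f t" "(\<Sum>s\<in>S. (if t = s then 1 else 0) * f s) = f t"
  using assms by (simp_all add: if_distrib[of "\<lambda>a. _ * a"] if_distrib[of "\<lambda>a. a * _"] cong: if_cong)

lemma sum_swap_mult:
  fixes f :: "'i \<Rightarrow> 'a::comm_ring_1"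
  shows "(\<Sum>k\<in>A. f k * (\<Sum>s\<in>B. a s * p s k)) = (\<Sum>s\<in>B. a s * (\<Sum>k\<in>A. f k * p s k))"
  unfolding sum_distrib_left by (subst sum.swap) (simp only: mult_ac)

lemma lin_indep_onD:
  assumes "lin_indep_on r S x" "\<And>t. t \<in> S \<Longrightarrow> (\<Sum>k=1..r. c k * x k t) = 0" "k \<in> {1..r}"
  shows "c k = 0"
  using mp[OF spec[OF assms(1)[unfolded lin_indep_on_def], of c]] assms(2,3) by blast

lemma lin_indep_on_nonzero:
  assumes "lin_indep_on r S c" "s \<in> {1..r}"
  shows "\<exists>t\<in>S. c s t \<noteq> 0"
proof (rule ccontr)
  assume "\<not> ?thesis"
  then have "\<forall>t\<in>S. (\<Sum>k=1..r. (if k = s then 1 else 0) * c k t) = 0"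
    using assms(2) by (simp add: sum_kron)
  then have "\<forall>k\<in>{1..r}. (if k = s then 1 else 0) = (0 :: 'a)"
    using assms(1) unfolding lin_indep_on_def by (elim allE impE)
  then have "(if s = s then 1 else 0) = (0 :: 'a)" using assms(2) by (rule bspec)
  then show False by simp
qed

text \<open>Induction on \<open>r\<close>. The part \<open>y\<close> of the new vector left after
  removing its components along the old ones is nonzero by independence. Evaluation at a label where
  \<open>y\<close> does not vanish gives the new functional. \<open>S\<close> may have more than
  \<open>r\<close> elements, so the result is a left inverse of a tall matrix of full column
  rank.\<close>

lemma dual_family_exists:
  fixes x :: "nat \<Rightarrow> nat \<Rightarrow> 'a::field"
  assumes "lin_indep_on r S x" and fin: "finite S"
  obtains \<rho> where "\<And>s t. s \<in> {1..r} \<Longrightarrow> t \<in> {1..r} \<Longrightarrow>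
    (\<Sum>k\<in>S. \<rho> t k * x s k) = (if s = t then 1 else 0)"
proof -
  have "\<exists>\<rho>. \<forall>s\<in>{1..r}. \<forall>t\<in>{1..r}. (\<Sum>k\<in>S. \<rho> t k * x s k) = (if s = t then 1 else 0)"
    using assms(1)
  proof (induction r)
    case 0
    then show ?case by simp
  next
    case (Suc r)
    have "lin_indep_on r S x"
      unfolding lin_indep_on_def
    proof (intro allI impI ballI)
      fix c k assume c: "\<forall>t\<in>S. (\<Sum>k=1..r. c k * x k t) = 0" and k: "k \<in> {1..r}"
      define c' where "c' = c(Suc r := 0)"
      have "(\<Sum>k=1..Suc r. c' k * x k t) = (\<Sum>k=1..r. c k * x k t)" for t
        by (simp add: c'_def)
      with c Suc.prems have "\<forall>k\<in>{1..Suc r}. c' k = 0"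
        unfolding lin_indep_on_def by metis
      with k show "c k = 0" by (auto simp: c'_def dest!: bspec[of _ _ k])
    qed
    then obtain \<rho> where \<rho>: "\<And>s t. s \<in> {1..r} \<Longrightarrow> t \<in> {1..r} \<Longrightarrow>
        (\<Sum>k\<in>S. \<rho> t k * x s k) = (if s = t then 1 else 0)"
      using Suc.IH by blast
    define a where "a s = (\<Sum>k\<in>S. \<rho> s k * x (Suc r) k)" for s
    define y where "y k = x (Suc r) k - (\<Sum>s=1..r. a s * x s k)" for k
    have "\<exists>k0\<in>S. y k0 \<noteq> 0"
    proof (rule ccontr)
      assume *: "\<not> ?thesis"
      define c where "c k = (if k = Suc r then 1 else - a k)" for k
      have "(\<Sum>k=1..Suc r. c k * x k t) = y t" for t
        by (simp add: c_def y_def sum_negf)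
      with * have "\<forall>t\<in>S. (\<Sum>k=1..Suc r. c k * x k t) = 0" by simp
      with Suc.prems have "\<forall>k\<in>{1..Suc r}. c k = 0" unfolding lin_indep_on_def by blast
      then have "c (Suc r) = 0" by simp
      then show False by (simp add: c_def)
    qed
    then obtain k0 where k0: "k0 \<in> S" "y k0 \<noteq> 0" by blast
    \<comment> \<open>Evaluation at \<open>k0\<close> after projecting away
      \<open>x 1, ..., x r\<close>, normalized by \<open>y k0\<close>. It kills the old vectors and
      takes the value 1 on the new one.\<close>
    define \<eta> where "\<eta> k = ((if k = k0 then 1 else 0) - (\<Sum>s=1..r. x s k0 * \<rho> s k)) / y k0" for k
    have \<eta>: "(\<Sum>k\<in>S. \<eta> k * z k) = (z k0 - (\<Sum>s=1..r. x s k0 * (\<Sum>k\<in>S. \<rho> s k * z k))) / y k0" for z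
    proof -
      have "\<eta> k * z k = (if k = k0 then z k0 / y k0 else 0) - (\<Sum>s=1..r. x s k0 * (\<rho> s k * z k)) / y k0" for k
      proof -
        have "(\<Sum>s=1..r. x s k0 * (\<rho> s k * z k)) = (\<Sum>s=1..r. x s k0 * \<rho> s k) * z k"
          by (simp add: sum_distrib_right mult.assoc)
        then show ?thesis unfolding \<eta>_def by (auto simp: diff_divide_distrib left_diff_distrib)
      qed
      then have "(\<Sum>k\<in>S. \<eta> k * z k) = (\<Sum>k\<in>S. (if k = k0 then z k0 / y k0 else 0)) - (\<Sum>k\<in>S. \<Sum>s=1..r. x s k0 * (\<rho> s k * z k)) / y k0"
        by (simp only: sum_subtractf sum_divide_distrib)
      also have "\<dots> = z k0 / y k0 - (\<Sum>s=1..r. x s k0 * (\<Sum>k\<in>S. \<rho> s k * z k)) / y k0"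
        by (subst sum.swap) (use k0 fin in \<open>simp add: sum_distrib_left\<close>)
      finally show ?thesis by (simp add: diff_divide_distrib)
    qed
    have \<eta>1: "(\<Sum>k\<in>S. \<eta> k * x t k) = 0" if "t \<in> {1..r}" for t
    proof -
      have "(\<Sum>s=1..r. x s k0 * (\<Sum>k\<in>S. \<rho> s k * x t k)) = (\<Sum>s=1..r. if s = t then x t k0 else 0)"
        using that by (intro sum.cong refl) (auto simp: \<rho>)
      also have "\<dots> = x t k0" using that by simp
      finally show ?thesis by (simp add: \<eta>)
    qed
    have \<eta>2: "(\<Sum>k\<in>S. \<eta> k * x (Suc r) k) = 1"
    proof -
      have "(\<Sum>k\<in>S. \<eta> k * x (Suc r) k) = (x (Suc r) k0 - (\<Sum>s=1..r. a s * x s k0)) / y k0"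
        unfolding \<eta> by (simp add: a_def mult.commute)
      then show ?thesis using k0 by (simp add: y_def)
    qed
    \<comment> \<open>The old functionals take the values \<open>a t\<close> on the new vector;
      subtracting \<open>a t * \<eta>\<close> corrects this and changes nothing on the old
      vectors.\<close>
    define \<rho>' where "\<rho>' t k = (if t = Suc r then \<eta> k else \<rho> t k - a t * \<eta> k)" for t k
    have "(\<Sum>k\<in>S. \<rho>' t k * x s k) = (if s = t then 1 else 0)"
      if st: "s \<in> {1..Suc r}" "t \<in> {1..Suc r}" for s t
    proof -
      have split: "(\<Sum>k\<in>S. \<rho>' t k * x s k) = (\<Sum>k\<in>S. \<rho> t k * x s k) - a t * (\<Sum>k\<in>S. \<eta> k * x s k)"
        if "t \<noteq> Suc r"
        using that by (simp add: \<rho>'_def left_diff_distrib sum_subtractf sum_distrib_left mult.assoc)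
      consider "s = Suc r" "t = Suc r" | "s = Suc r" "t \<in> {1..r}" | "s \<in> {1..r}" "t = Suc r"
        | "s \<in> {1..r}" "t \<in> {1..r}"
        using st by (auto simp: le_Suc_eq)
      then show ?thesis
      proof cases
        case 1 then show ?thesis using \<eta>2 by (simp add: \<rho>'_def)
      next
        case 2 then show ?thesis using split \<eta>2 by (auto simp: a_def)
      next
        case 3 then show ?thesis using \<eta>1 by (auto simp: \<rho>'_def)
      next
        case 4 then show ?thesis using split \<eta>1 \<rho> by (auto)
      qed
    qed
    then show ?case by blast
  qed
  then show ?thesis using that by blast
qed

text \<open>For square matrices a left inverse is a right inverse. The detour through library
  matrices shifts all indices by one.\<close>

lemma dual_family_transpose:
  fixes A B :: "nat \<Rightarrow> nat \<Rightarrow> 'a::field"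
  assumes "\<And>s t. s \<in> {1..r} \<Longrightarrow> t \<in> {1..r} \<Longrightarrow> (\<Sum>k=1..r. B t k * A s k) = (if s = t then 1 else 0)"
    and "i \<in> {1..r}" "k \<in> {1..r}"
  shows "(\<Sum>t=1..r. B t i * A t k) = (if i = k then 1 else 0)"
proof -
  define MB where "MB = Matrix.mat r r (\<lambda>(t, k). B (Suc t) (Suc k))"
  define MA where "MA = Matrix.mat r r (\<lambda>(k, s). A (Suc s) (Suc k))"
  have c: "MB \<in> carrier_mat r r" "MA \<in> carrier_mat r r" by (auto simp: MA_def MB_def)
  have "MB * MA = 1\<^sub>m r"
  proof (rule eq_matI)
    fix t s assume "t < dim_row (1\<^sub>m r :: 'a mat)" "s < dim_col (1\<^sub>m r :: 'a mat)"
    then have ts: "t < r" "s < r" by auto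
    then have "(MB * MA) $$ (t, s) = (\<Sum>k<r. B (Suc t) (Suc k) * A (Suc s) (Suc k))"
      by (simp add: MA_def MB_def scalar_prod_def atLeast0LessThan)
    also have "\<dots> = (if s = t then 1 else 0)"
      using assms(1)[of "Suc s" "Suc t"] ts by (simp add: One_nat_def sum.atLeast1_atMost_eq)
    finally show "(MB * MA) $$ (t, s) = 1\<^sub>m r $$ (t, s)" using ts by auto
  qed (use c in auto)
  then have "MA * MB = 1\<^sub>m r" using mat_mult_left_right_inverse[OF c] by blast
  then have "(MA * MB) $$ (k - 1, i - 1) = 1\<^sub>m r $$ (k - 1, i - 1)" by simp
  moreover have "(MA * MB) $$ (k - 1, i - 1) = (\<Sum>t<r. B (Suc t) i * A (Suc t) k)"
    using assms(2,3) by (subst index_mult_mat)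
      (auto simp: MA_def MB_def scalar_prod_def atLeast0LessThan mult.commute)
  ultimately have "(\<Sum>t<r. B (Suc t) i * A (Suc t) k) = 1\<^sub>m r $$ (k - 1, i - 1)" by simp
  also have "\<dots> = (if i = k then 1 else 0)"
    using assms(2,3) by (auto simp: one_mat_def)
  finally show ?thesis by (simp add: One_nat_def sum.atLeast1_atMost_eq)
qed

text \<open>Injectivity makes the columns of \<open>X\<close> independent; their dual family is a
  left inverse of \<open>X\<close>, and its transposed relation is the right inverse that yields the
  solution.\<close>

lemma square_system_solvable:
  fixes X :: "nat \<Rightarrow> nat \<Rightarrow> 'a::field"
  assumes "\<forall>g. (\<forall>s\<in>{1..r}. (\<Sum>k=1..r. X s k * g k) = 0) \<longrightarrow> (\<forall>k\<in>{1..r}. g k = 0)"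
  shows "\<exists>g. \<forall>s\<in>{1..r}. (\<Sum>k=1..r. X s k * g k) = b s"
proof -
  have "lin_indep_on r {1..r} (\<lambda>k s. X s k)"
    unfolding lin_indep_on_def
  proof (intro allI impI)
    fix c assume "\<forall>t\<in>{1..r}. (\<Sum>k=1..r. c k * X t k) = 0"
    then show "\<forall>k\<in>{1..r}. c k = 0" 
      by (intro assms[rule_format, of c] ballI) (auto simp: mult.commute)
  qed
  then obtain \<rho> where \<rho>: "\<And>s t. s \<in> {1..r} \<Longrightarrow> t \<in> {1..r} \<Longrightarrow>
      (\<Sum>k=1..r. \<rho> t k * X k s) = (if s = t then 1 else 0)"
    by (rule dual_family_exists) auto
  have T: "(\<Sum>t=1..r. \<rho> t i * X k t) = (if i = k then 1 else 0)" if "i \<in> {1..r}" "k \<in> {1..r}" for i k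
    by (rule dual_family_transpose[where A="\<lambda>s k. X k s", OF \<rho> that])
  have "(\<Sum>k=1..r. X s k * (\<Sum>i=1..r. \<rho> k i * b i)) = b s" if s: "s \<in> {1..r}" for s
  proof -
    have "(\<Sum>k=1..r. X s k * (\<Sum>i=1..r. \<rho> k i * b i)) = (\<Sum>i=1..r. b i * (\<Sum>k=1..r. \<rho> k i * X s k))"
      unfolding sum_distrib_left by (subst sum.swap) (simp only: mult_ac)
    also have "\<dots> = (\<Sum>i=1..r. if i = s then b s else 0)"
      using s by (intro sum.cong refl) (auto simp: T)
    also have "\<dots> = b s" using s by simp
    finally show ?thesis .
  qed
  then show ?thesis by (intro exI ballI)
qed

text \<open>The term with \<open>h\<close> is at most half of the left-hand sum and is absorbed
  there, whence the factor 2. No prior bound on \<open>y\<close> enters.\<close>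

lemma near_identity_bound:
  fixes y f :: "'i \<Rightarrow> 'a::real_normed_field"
  assumes "\<And>t. t \<in> S \<Longrightarrow> y t + (\<Sum>s\<in>S. h t s * y s) = f t"
    and "(\<Sum>t\<in>S. \<Sum>s\<in>S. norm (h t s)) \<le> 1/2" and fin: "finite S"
  shows "(\<Sum>t\<in>S. norm (y t)) \<le> 2 * (\<Sum>t\<in>S. norm (f t))"
proof -
  let ?Y = "\<Sum>t\<in>S. norm (y t)"
  have "norm (y t) \<le> norm (f t) + (\<Sum>s\<in>S. norm (h t s)) * ?Y" if t: "t \<in> S" for t
  proof -
    have "y t = f t - (\<Sum>s\<in>S. h t s * y s)" using assms(1)[OF t] by (simp add: algebra_simps)
    then have "norm (y t) \<le> norm (f t) + norm (\<Sum>s\<in>S. h t s * y s)" by (simp add: norm_triangle_ineq4)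
    also have "norm (\<Sum>s\<in>S. h t s * y s) \<le> (\<Sum>s\<in>S. norm (h t s) * norm (y s))"
      by (rule order_trans[OF norm_sum]) (simp add: norm_mult)
    also have "\<dots> \<le> (\<Sum>s\<in>S. norm (h t s) * ?Y)"
      by (intro sum_mono mult_left_mono) (auto intro!: member_le_sum fin)
    finally show ?thesis by (simp add: sum_distrib_right)
  qed
  then have "?Y \<le> (\<Sum>t\<in>S. norm (f t) + (\<Sum>s\<in>S. norm (h t s)) * ?Y)" by (rule sum_mono)
  also have "\<dots> = (\<Sum>t\<in>S. norm (f t)) + (\<Sum>t\<in>S. \<Sum>s\<in>S. norm (h t s)) * ?Y"
    by (simp add: sum.distrib sum_distrib_right)
  also have "\<dots> \<le> (\<Sum>t\<in>S. norm (f t)) + 1/2 * ?Y"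
    by (intro add_left_mono mult_right_mono assms(2) sum_nonneg) auto
  finally show ?thesis by simp
qed

text \<open>The vectors are real, so real and imaginary parts of the coefficients satisfy the
  relation separately.\<close>

lemma lin_indep_on_of_real:
  assumes "lin_indep_on r S x"
  shows "lin_indep_on r S (\<lambda>i m. complex_of_real (x i m))"
  unfolding lin_indep_on_def
proof (intro allI impI ballI)
  fix c k assume c: "\<forall>t\<in>S. (\<Sum>k=1..r. c k * complex_of_real (x k t)) = 0" and k: "k \<in> {1..r}"
  have re: "\<forall>t\<in>S. (\<Sum>k=1..r. Re (c k) * x k t) = 0"
  proof
    fix t assume "t \<in> S"
    then have "Re (\<Sum>k=1..r. c k * complex_of_real (x k t)) = 0" using c by simp
    then show "(\<Sum>k=1..r. Re (c k) * x k t) = 0" by simp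
  qed
  have im: "\<forall>t\<in>S. (\<Sum>k=1..r. Im (c k) * x k t) = 0"
  proof
    fix t assume "t \<in> S"
    then have "Im (\<Sum>k=1..r. c k * complex_of_real (x k t)) = 0" using c by simp
    then show "(\<Sum>k=1..r. Im (c k) * x k t) = 0" by simp
  qed
  have "Re (c k) = 0"
    using lin_indep_onD[OF assms, of "\<lambda>k. Re (c k)"] re k by blast
  moreover have "Im (c k) = 0"
    using lin_indep_onD[OF assms, of "\<lambda>k. Im (c k)"] im k by blast
  ultimately show "c k = 0" by (simp add: complex_eq_iff)
qed

lemma lin_indep_on_shift:
  "lin_indep_on r S (\<lambda>i m. x i (m + 1)) \<longleftrightarrow> lin_indep_on r ((\<lambda>m. m + 1) ` S) x"
  by (simp add: lin_indep_on_def)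

section \<open>Quantities of order \<open>\<epsilon>\<close> along a filter\<close>

lemma norm_on_nonneg: "0 \<le> norm_on S f"
  by (simp add: norm_on_def)

lemma norm_le_norm_on: "finite S \<Longrightarrow> t \<in> S \<Longrightarrow> norm (f t) \<le> norm_on S f"
  unfolding norm_on_def by (rule member_le_L2_set)

lemma norm_on_le_sum: "norm_on S f \<le> (\<Sum>t\<in>S. norm (f t))"
  unfolding norm_on_def by (rule L2_set_le_sum) simp

lemma is_arg_min_le:
  fixes f :: "'a \<Rightarrow> real"
  assumes "is_arg_min f Q z" "Q y"
  shows "f z \<le> f y"
  using assms by (auto simp: is_arg_min_def not_less)

lemma is_arg_min_norm_on:
  assumes "is_arg_min (\<lambda>z. (norm_on S (\<phi> z))\<^sup>2) Q z" "Q z'"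
  shows "norm_on S (\<phi> z) \<le> norm_on S (\<phi> z')"
proof -
  from is_arg_min_le[OF assms] show ?thesis by (rule power2_le_imp_le) (rule norm_on_nonneg)
qed

text \<open>The other two roots have imaginary part of modulus \<open>sqrt 3 / 2\<close>, which
  exceeds 1/2.\<close>

lemma cube_root_unity_real:
  fixes z :: complex
  assumes "z ^ 3 = 1" "\<bar>Im z\<bar> < 1/2"
  shows "z = 1"
proof (rule ccontr)
  assume "z \<noteq> 1"
  have "(z - 1) * (z\<^sup>2 + z + 1) = z ^ 3 - 1"
    by (simp add: algebra_simps power2_eq_square power3_eq_cube)
  with assms(1) \<open>z \<noteq> 1\<close> have q: "z\<^sup>2 + z + 1 = 0" by simp
  have "(Re z)\<^sup>2 - (Im z)\<^sup>2 + Re z + 1 = Re (z\<^sup>2 + z + 1)" by (simp add: power2_eq_square)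
  then have re: "(Re z)\<^sup>2 - (Im z)\<^sup>2 + Re z + 1 = 0" by (simp only: q zero_complex.sel)
  have "Im z * (2 * Re z + 1) = Im (z\<^sup>2 + z + 1)" by (simp add: power2_eq_square algebra_simps)
  then have im: "Im z * (2 * Re z + 1) = 0" by (simp only: q zero_complex.sel)
  show False
  proof (cases "Im z = 0")
    case True
    have "(Re z)\<^sup>2 + Re z + 1 = (Re z + 1/2)\<^sup>2 + 3/4" by (simp add: power2_eq_square algebra_simps)
    moreover have "0 \<le> (Re z + 1/2)\<^sup>2" by simp
    moreover have "(Re z)\<^sup>2 + Re z + 1 = 0" using re True by simp
    ultimately show False by linarith
  next
    case False
    with im have "Re z = - (1/2)" by simp
    with re have "(Im z)\<^sup>2 = 3/4" by (simp add: power2_eq_square)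
    moreover have "(Im z)\<^sup>2 < (1/2)\<^sup>2"
      using assms(2) by (intro power2_strict_mono) simp
    ultimately show False by (simp add: power2_eq_square)
  qed
qed

locale error_filter =
  fixes FF :: "'x filter" and e :: "'x \<Rightarrow> real"
  assumes e_nonneg: "\<forall>\<^sub>F x in FF. 0 \<le> e x" and e_lim: "(e \<longlongrightarrow> 0) FF"
begin

text \<open>This is \<open>f = O(e)\<close> along the filter. The constant is chosen before the
  filter quantifier, so it is common to all points near the limit.\<close>

definition small :: "('x \<Rightarrow> 'a::real_normed_field) \<Rightarrow> bool" where
  "small f \<longleftrightarrow> (\<exists>C. \<forall>\<^sub>F x in FF. norm (f x) \<le> C * e x)"

definition bdd :: "('x \<Rightarrow> 'a::real_normed_field) \<Rightarrow> bool" where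
  "bdd f \<longleftrightarrow> (\<exists>C. \<forall>\<^sub>F x in FF. norm (f x) \<le> C)"

lemma smallI: "\<forall>\<^sub>F x in FF. norm (f x) \<le> C * e x \<Longrightarrow> small f"
  unfolding small_def by blast

lemma bddI: "\<forall>\<^sub>F x in FF. norm (f x) \<le> C \<Longrightarrow> bdd f"
  unfolding bdd_def by blast

lemma smallE:
  assumes "small f"
  obtains C where "C > 0" "\<forall>\<^sub>F x in FF. norm (f x) \<le> C * e x"
proof -
  obtain C where C: "\<forall>\<^sub>F x in FF. norm (f x) \<le> C * e x" using assms by (auto simp: small_def)
  have "\<forall>\<^sub>F x in FF. norm (f x) \<le> (\<bar>C\<bar> + 1) * e x"
    using C e_nonneg by eventually_elim (smt (verit) mult_right_mono)
  then show ?thesis by (intro that[of "\<bar>C\<bar> + 1"]) auto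
qed

lemma bddE:
  assumes "bdd f"
  obtains C where "C > 0" "\<forall>\<^sub>F x in FF. norm (f x) \<le> C"
proof -
  obtain C where C: "\<forall>\<^sub>F x in FF. norm (f x) \<le> C" using assms by (auto simp: bdd_def)
  have "\<forall>\<^sub>F x in FF. norm (f x) \<le> \<bar>C\<bar> + 1"
    using C by eventually_elim auto
  then show ?thesis by (intro that[of "\<bar>C\<bar> + 1"]) auto
qed

lemma small_dominated:
  assumes "small f" "\<forall>\<^sub>F x in FF. norm (g x) \<le> K * norm (f x)" "0 \<le> K"
  shows "small g"
proof -
  obtain C where C: "\<forall>\<^sub>F x in FF. norm (f x) \<le> C * e x" using assms by (auto simp: small_def)
  have "\<forall>\<^sub>F x in FF. norm (g x) \<le> (K * C) * e x"
    using C assms(2)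
  proof eventually_elim
    case (elim x)
    have "K * norm (f x) \<le> K * (C * e x)" using elim assms(3) by (intro mult_left_mono)
    then show ?case using elim by simp
  qed
  then show ?thesis by (rule smallI)
qed

lemma small_cong: "small f \<Longrightarrow> \<forall>\<^sub>F x in FF. f x = g x \<Longrightarrow> small g"
  by (erule small_dominated[where K=1]) (auto elim: eventually_mono)

lemma small_zero: "small (\<lambda>x. 0)"
  by (rule smallI[of _ 0]) simp

lemma small_add:
  assumes "small f" "small g" shows "small (\<lambda>x. f x + g x)"
proof -
  obtain C where C: "\<forall>\<^sub>F x in FF. norm (f x) \<le> C * e x" using assms by (auto simp: small_def)
  obtain D where D: "\<forall>\<^sub>F x in FF. norm (g x) \<le> D * e x" using assms by (auto simp: small_def)
  have "\<forall>\<^sub>F x in FF. norm (f x + g x) \<le> (C + D) * e x"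
    using C D
  proof eventually_elim
    case (elim x)
    then show ?case using norm_triangle_ineq[of "f x" "g x"] by (simp add: distrib_right)
  qed
  then show ?thesis by (rule smallI)
qed

lemma small_minus: "small f \<Longrightarrow> small (\<lambda>x. - f x)"
  by (simp add: small_def)

lemma small_diff: "small f \<Longrightarrow> small g \<Longrightarrow> small (\<lambda>x. f x - g x)"
  using small_add[of f "\<lambda>x. - g x"] by (simp add: small_minus)

lemma small_sum: "(\<And>i. i \<in> S \<Longrightarrow> small (\<lambda>x. f x i)) \<Longrightarrow> small (\<lambda>x. \<Sum>i\<in>S. f x i)"
  by (induction S rule: infinite_finite_induct) (auto intro: small_add small_zero)

lemma small_mult_bdd:
  assumes "bdd f" "small g" shows "small (\<lambda>x. f x * g x)"
proof -
  obtain C where C: "C > 0" "\<forall>\<^sub>F x in FF. norm (f x) \<le> C" using bddE assms by blast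
  have "\<forall>\<^sub>F x in FF. norm (f x * g x) \<le> C * norm (g x)"
    using C(2) by eventually_elim (auto simp: norm_mult intro: mult_right_mono)
  then show ?thesis using C(1) by (intro small_dominated[OF assms(2), of _ C]) auto
qed

lemma small_bdd_mult: "small g \<Longrightarrow> bdd f \<Longrightarrow> small (\<lambda>x. g x * f x)"
  using small_mult_bdd[of f g] by (simp add: mult.commute)

lemma bdd_const: "bdd (\<lambda>x. c)"
  by (rule bddI[of _ "norm c"]) simp

lemma small_tendsto: assumes "small f" shows "(f \<longlongrightarrow> 0) FF"
proof -
  obtain C where C: "\<forall>\<^sub>F x in FF. norm (f x) \<le> C * e x" using assms by (auto simp: small_def)
  have "((\<lambda>x. C * e x) \<longlongrightarrow> C * 0) FF" by (intro tendsto_intros e_lim)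
  then show ?thesis by (intro Lim_null_comparison[OF C]) simp
qed

lemma bdd_small: assumes "small f" shows "bdd f"
proof -
  have "\<forall>\<^sub>F x in FF. norm (f x) < 1"
    using small_tendsto[OF assms] by (auto simp: tendsto_iff dist_norm)
  then show ?thesis by (intro bddI[of _ 1]) (auto elim: eventually_mono)
qed

lemma bdd_add:
  assumes "bdd f" "bdd g" shows "bdd (\<lambda>x. f x + g x)"
proof -
  obtain C where C: "\<forall>\<^sub>F x in FF. norm (f x) \<le> C" using assms by (auto simp: bdd_def)
  obtain D where D: "\<forall>\<^sub>F x in FF. norm (g x) \<le> D" using assms by (auto simp: bdd_def)
  have "\<forall>\<^sub>F x in FF. norm (f x + g x) \<le> C + D"
    using C D by eventually_elim (rule norm_triangle_mono)
  then show ?thesis by (rule bddI)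
qed

lemma bdd_mult:
  assumes "bdd f" "bdd g" shows "bdd (\<lambda>x. f x * g x)"
proof -
  obtain C where C: "C > 0" "\<forall>\<^sub>F x in FF. norm (f x) \<le> C" using bddE assms by blast
  obtain D where D: "D > 0" "\<forall>\<^sub>F x in FF. norm (g x) \<le> D" using bddE assms by blast
  have "\<forall>\<^sub>F x in FF. norm (f x * g x) \<le> C * D"
    using C(2) D(2) by eventually_elim (use C D in \<open>auto simp: norm_mult intro!: mult_mono\<close>)
  then show ?thesis by (rule bddI)
qed

lemma bdd_near: "small (\<lambda>x. f x - a) \<Longrightarrow> bdd f"
  using bdd_add[OF bdd_small bdd_const[of a], of "\<lambda>x. f x - a"] by simp

lemma small_mult_const: "small f \<Longrightarrow> small (\<lambda>x. c * f x)"
  by (intro small_mult_bdd bdd_const)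

lemma near_mult:
  assumes "small (\<lambda>x. f x - a)" "small (\<lambda>x. g x - b)"
  shows "small (\<lambda>x. f x * g x - a * b)"
proof -
  have "small (\<lambda>x. f x * (g x - b) + (f x - a) * b)"
    by (rule small_add[OF small_mult_bdd[OF bdd_near[OF assms(1)] assms(2)] small_bdd_mult[OF assms(1) bdd_const]])
  then show ?thesis by (simp add: algebra_simps)
qed

lemma near_sum:
  "(\<And>i. i \<in> S \<Longrightarrow> small (\<lambda>x. f x i - a i)) \<Longrightarrow> small (\<lambda>x. (\<Sum>i\<in>S. f x i) - (\<Sum>i\<in>S. a i))"
  unfolding sum_subtractf[symmetric] by (rule small_sum)

lemma near_const: "small (\<lambda>x. a - a)"
  by (simp add: small_zero)

lemma near_tendsto: "small (\<lambda>x. f x - a) \<Longrightarrow> (f \<longlongrightarrow> a) FF"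
  using small_tendsto[of "\<lambda>x. f x - a"] by (simp add: LIM_zero_iff)

lemma near_nonzero:
  assumes "small (\<lambda>x. f x - a)" "a \<noteq> 0"
  shows "\<forall>\<^sub>F x in FF. f x \<noteq> 0"
  using tendsto_imp_eventually_ne[OF near_tendsto[OF assms(1)] assms(2)] .

lemma bdd_inverse:
  assumes "small (\<lambda>x. f x - a)" "a \<noteq> 0"
  shows "bdd (\<lambda>x. inverse (f x))"
proof -
  have "((\<lambda>x. inverse (f x)) \<longlongrightarrow> inverse a) FF"
    by (intro tendsto_inverse near_tendsto assms)
  then have "\<forall>\<^sub>F x in FF. norm (inverse (f x) - inverse a) < 1"
    by (auto simp: tendsto_iff dist_norm)
  then have "\<forall>\<^sub>F x in FF. norm (inverse (f x)) \<le> 1 + norm (inverse a)"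
  proof eventually_elim
    case (elim x)
    then show ?case using norm_triangle_sub[of "inverse (f x)" "inverse a"] by simp
  qed
  then show ?thesis by (rule bddI)
qed

lemma near_divide_cancel:
  assumes "small (\<lambda>x. g x * f x)" "small (\<lambda>x. g x - a)" "a \<noteq> 0"
  shows "small f"
proof (rule small_cong)
  show "small (\<lambda>x. inverse (g x) * (g x * f x))"
    by (rule small_mult_bdd[OF bdd_inverse[OF assms(2,3)] assms(1)])
  show "\<forall>\<^sub>F x in FF. inverse (g x) * (g x * f x) = f x"
    using near_nonzero[OF assms(2,3)] by eventually_elim simp
qed

lemma small_iff_norm: "small (\<lambda>x. norm (f x)) \<longleftrightarrow> small f"
  by (simp add: small_def)

text \<open>The unknown \<open>z\<close> may a priori be unbounded. Subtracting \<open>z0\<close>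
  leaves \<open>h\<close> times the constant \<open>z0\<close> on the right, which is
  \<open>small\<close>, and \<open>near_identity_bound\<close> controls the difference.\<close>

lemma near_absorb:
  fixes z :: "'x \<Rightarrow> 'i \<Rightarrow> 'a::real_normed_field"
  assumes fin: "finite S" and t: "t \<in> S"
    and eq: "\<And>t. t \<in> S \<Longrightarrow> small (\<lambda>x. z x t + (\<Sum>s\<in>S. h x t s * z x s) - z0 t)"
    and h: "\<And>t s. t \<in> S \<Longrightarrow> s \<in> S \<Longrightarrow> small (\<lambda>x. h x t s)"
  shows "small (\<lambda>x. z x t - z0 t)"
proof -
  define y where "y x t = z x t - z0 t" for x t
  define f where "f x t = y x t + (\<Sum>s\<in>S. h x t s * y x s)" for x t
  have f: "small (\<lambda>x. f x t)" if "t \<in> S" for t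
  proof -
    have "small (\<lambda>x. (z x t + (\<Sum>s\<in>S. h x t s * z x s) - z0 t) - (\<Sum>s\<in>S. h x t s * z0 s))"
      using that by (intro small_diff eq small_sum small_bdd_mult h bdd_const)
    then show ?thesis by (simp add: f_def y_def algebra_simps sum_subtractf)
  qed
  have "((\<lambda>x. \<Sum>t\<in>S. \<Sum>s\<in>S. norm (h x t s)) \<longlongrightarrow> 0) FF"
    by (intro small_tendsto small_sum) (simp add: small_iff_norm h)
  then have "\<forall>\<^sub>F x in FF. (\<Sum>t\<in>S. \<Sum>s\<in>S. norm (h x t s)) < 1/2"
    by (rule order_tendstoD) simp
  then have *: "\<forall>\<^sub>F x in FF. norm (y x t) \<le> 2 * norm (\<Sum>t\<in>S. norm (f x t))"
  proof eventually_elim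
    case (elim x)
    have "norm (y x t) \<le> (\<Sum>t\<in>S. norm (y x t))" using fin t by (intro member_le_sum) auto
    also have "\<dots> \<le> 2 * (\<Sum>t\<in>S. norm (f x t))"
      by (rule near_identity_bound[of S _ "h x"]) (use elim fin in \<open>auto simp: f_def\<close>)
    also have "(\<Sum>t\<in>S. norm (f x t)) = norm (\<Sum>t\<in>S. norm (f x t))" by (simp add: sum_nonneg)
    finally show ?case by simp
  qed
  have "small (\<lambda>x. \<Sum>t\<in>S. norm (f x t))"
    by (intro small_sum) (simp add: small_iff_norm f)
  from small_dominated[OF this *] show ?thesis by (simp add: y_def)
qed

lemma near_linear_system:
  fixes z :: "'x \<Rightarrow> 'i \<Rightarrow> 'a::real_normed_field"
  assumes fin: "finite S" and t: "t \<in> S"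
    and eq: "\<And>t. t \<in> S \<Longrightarrow> small (\<lambda>x. (\<Sum>s\<in>S. M x t s * z x s) - z0 t)"
    and M: "\<And>t s. t \<in> S \<Longrightarrow> s \<in> S \<Longrightarrow> small (\<lambda>x. M x t s - (if s = t then 1 else 0))"
  shows "small (\<lambda>x. z x t - z0 t)"
proof (rule near_absorb[OF fin t, where h = "\<lambda>x t s. M x t s - (if s = t then 1 else 0)"])
  fix t assume t: "t \<in> S"
  have "z x t + (\<Sum>s\<in>S. (M x t s - (if s = t then 1 else 0)) * z x s) = (\<Sum>s\<in>S. M x t s * z x s)" for x
    using sum_kron(3)[OF fin t, of "z x"] by (simp only: left_diff_distrib sum_subtractf) simp
  then show "small (\<lambda>x. z x t + (\<Sum>s\<in>S. (M x t s - (if s = t then 1 else 0)) * z x s) - z0 t)"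
    using eq[OF t] by (simp only:)
qed (rule M)

text \<open>The root \<open>\<tau> x\<close> brings \<open>z x\<close> closest to \<open>a\<close>.
  In the factorization of \<open>y ^ 3 - a ^ 3\<close> over the three roots, the factors other than
  \<open>y - a\<close> then stay away from 0, so the cube error bounds \<open>y - a\<close>
  linearly.\<close>

lemma near_cube_root:
  fixes z :: "'x \<Rightarrow> complex"
  assumes "small (\<lambda>x. z x ^ 3 - a ^ 3)" "a \<noteq> 0"
  obtains \<tau> where "\<And>x. \<tau> x ^ 3 = 1" "small (\<lambda>x. \<tau> x * z x - a)"
proof -
  define w :: complex where "w = Complex (-1/2) (sqrt 3 / 2)"
  have w: "w\<^sup>2 + w + 1 = 0" "w ^ 3 = 1"
    by (auto simp: w_def complex_eq_iff power2_eq_square power3_eq_cube algebra_simps)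
  define R where "R = {1, w, w\<^sup>2}"
  define \<tau> where "\<tau> x = arg_min_on (\<lambda>r. norm (r * z x - a)) R" for x
  have R: "finite R" "R \<noteq> {}" by (auto simp: R_def)
  have \<tau>R: "\<tau> x \<in> R" for x unfolding \<tau>_def by (rule arg_min_if_finite(1)[OF R])
  have least: "norm (\<tau> x * z x - a) \<le> norm (r * z x - a)" if "r \<in> R" for r x
    unfolding \<tau>_def using arg_min_least[OF R that, of "\<lambda>r. norm (r * z x - a)"] .
  have w6: "w ^ 6 = 1" using w(2) power_mult[of w 3 2] by simp
  have w4: "w ^ 4 = w" using w(2) power_add[of w 3 1] by simp
  have ww: "w * w\<^sup>2 = 1" "w\<^sup>2 * w = 1" using w(2) by (simp_all add: power2_eq_square power3_eq_cube mult.assoc)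
  have cube: "\<tau> x ^ 3 = 1" for x
    using \<tau>R[of x] w w6 by (auto simp: R_def power_mult[symmetric])
  have closed: "w * \<tau> x \<in> R" "w\<^sup>2 * \<tau> x \<in> R" for x
    using \<tau>R[of x] ww w4 by (auto simp: R_def power2_eq_square[symmetric] power_add[symmetric])
  have nw: "norm w = 1" by (simp add: w_def cmod_def power_divide)
  have n1: "norm (1 - w) = sqrt 3" "norm (1 - w\<^sup>2) = sqrt 3"
    by (auto simp: w_def cmod_def power_divide power2_eq_square)
  \<comment> \<open>By minimality \<open>\<tau> x * z x\<close> is no closer to \<open>v * a\<close>
    than to \<open>a\<close>, and these two points have distance \<open>sqrt 3 * norm a\<close>. Two
    such factors give the constant \<open>4 / (3 * (norm a)\<^sup>2)\<close> below.\<close>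
  have far: "norm (\<tau> x * z x - v * a) \<ge> norm a * (sqrt 3 / 2)" if v: "v \<in> {w, w\<^sup>2}" for x v
  proof -
    obtain v' where v': "v' \<in> {w, w\<^sup>2}" "v * v' = 1"
      using v ww by auto
    have nv: "norm v = 1" "norm (1 - v) = sqrt 3" "norm v' = 1"
      using v v' nw n1 by (auto simp: norm_power)
    have "norm (\<tau> x * z x - a) \<le> norm (v' * \<tau> x * z x - a)"
      using v' closed[of x] by (intro least) auto
    also have "\<dots> = norm (v * (v' * \<tau> x * z x - a))" by (simp add: norm_mult nv)
    also have "v * (v' * \<tau> x * z x - a) = \<tau> x * z x - v * a"
      using v'(2) by (simp add: right_diff_distrib mult.assoc[symmetric])
    finally have 1: "norm (\<tau> x * z x - a) \<le> norm (\<tau> x * z x - v * a)" .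
    have "norm ((1 - v) * a) \<le> norm (\<tau> x * z x - v * a) + norm (\<tau> x * z x - a)"
      using norm_triangle_ineq4[of "\<tau> x * z x - v * a" "\<tau> x * z x - a"] by (simp add: algebra_simps)
    then show ?thesis using 1 nv by (simp add: norm_mult mult.commute)
  qed
  have "small (\<lambda>x. \<tau> x * z x - a)"
  proof (rule small_dominated[OF assms(1)])
    show "0 \<le> 4 / (3 * (norm a)\<^sup>2)" by simp
    show "\<forall>\<^sub>F x in FF. norm (\<tau> x * z x - a) \<le> 4 / (3 * (norm a)\<^sup>2) * norm (z x ^ 3 - a ^ 3)"
    proof (rule always_eventually, rule allI)
      fix x
      let ?y = "\<tau> x * z x"
      have "(?y - w * a) * (?y - w\<^sup>2 * a) = ?y\<^sup>2 - (w\<^sup>2 + w) * (?y * a) + w ^ 3 * a\<^sup>2"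
        by (simp add: algebra_simps power2_eq_square power3_eq_cube)
      also have "w\<^sup>2 + w = - 1" using w(1) by (metis add_eq_0_iff2)
      finally have q: "(?y - w * a) * (?y - w\<^sup>2 * a) = ?y\<^sup>2 + ?y * a + a\<^sup>2" using w by simp
      have "z x ^ 3 - a ^ 3 = ?y ^ 3 - a ^ 3" by (simp add: power_mult_distrib cube)
      also have "\<dots> = (?y - a) * ((?y - w * a) * (?y - w\<^sup>2 * a))"
        unfolding q by (simp add: algebra_simps power2_eq_square power3_eq_cube)
      finally have "norm (z x ^ 3 - a ^ 3) = norm (?y - a) * (norm (?y - w * a) * norm (?y - w\<^sup>2 * a))"
        by (simp add: norm_mult)
      moreover have "norm (?y - w * a) * norm (?y - w\<^sup>2 * a) \<ge> (norm a * (sqrt 3 / 2)) * (norm a * (sqrt 3 / 2))"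
        by (intro mult_mono far) auto
      moreover have "(norm a * (sqrt 3 / 2)) * (norm a * (sqrt 3 / 2)) = 3 / 4 * (norm a)\<^sup>2"
        by (simp add: power2_eq_square)
      ultimately have "norm (z x ^ 3 - a ^ 3) \<ge> norm (?y - a) * (3 / 4 * (norm a)\<^sup>2)"
        by (metis mult_left_mono norm_ge_zero)
      then show "norm (?y - a) \<le> 4 / (3 * (norm a)\<^sup>2) * norm (z x ^ 3 - a ^ 3)"
        using assms(2) by (simp add: field_simps)
    qed
  qed
  then show ?thesis using cube by (intro that) auto
qed

lemma small_of_real_iff: "small (\<lambda>x. of_real (f x) :: complex) \<longleftrightarrow> small f"
  by (simp add: small_def)

lemma small_Re: "small f \<Longrightarrow> small (\<lambda>x. Re (f x))"
  by (rule small_dominated[where K=1]) (auto simp: abs_Re_le_cmod)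

lemma small_Im: "small f \<Longrightarrow> small (\<lambda>x. Im (f x))"
  by (rule small_dominated[where K=1]) (auto simp: abs_Im_le_cmod)

lemma small_norm_on:
  assumes "\<And>t. t \<in> S \<Longrightarrow> small (\<lambda>x. f x t)"
  shows "small (\<lambda>x. norm_on S (f x))"
proof -
  have "small (\<lambda>x. \<Sum>t\<in>S. norm (f x t))"
    by (intro small_sum) (simp add: small_iff_norm assms)
  then show ?thesis
  proof (rule small_dominated[where K=1])
    show "\<forall>\<^sub>F x in FF. norm (norm_on S (f x)) \<le> 1 * norm (\<Sum>t\<in>S. norm (f x t))"
      by (intro always_eventually allI) (simp add: norm_on_nonneg sum_nonneg norm_on_le_sum)
  qed simp
qed

lemma small_norm_on_le:
  assumes "small g" "\<forall>\<^sub>F x in FF. norm_on S (f x) \<le> g x" "finite S" "t \<in> S"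
  shows "small (\<lambda>x. f x t)"
proof (rule small_dominated[OF assms(1), where K=1])
  show "\<forall>\<^sub>F x in FF. norm (f x t) \<le> 1 * norm (g x)"
    using assms(2)
  proof eventually_elim
    case (elim x)
    have "norm (f x t) \<le> norm_on S (f x)" by (rule norm_le_norm_on[OF assms(3,4)])
    with elim show ?case by simp
  qed
qed simp

lemma near_trans: "small (\<lambda>x. f x - g x) \<Longrightarrow> small (\<lambda>x. g x - h x) \<Longrightarrow> small (\<lambda>x. f x - h x)"
  using small_add[of "\<lambda>x. f x - g x" "\<lambda>x. g x - h x"] by simp

lemma near_sym: "small (\<lambda>x. f x - g x) \<Longrightarrow> small (\<lambda>x. g x - f x)"
  using small_minus[of "\<lambda>x. f x - g x"] by simp

text \<open>Among the three cube roots of unity, only one can make a vector near a nonzero real vector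
  almost real.\<close>

lemma near_real_cube_root:
  fixes z :: "'x \<Rightarrow> nat \<Rightarrow> complex" and p :: "nat \<Rightarrow> real"
  assumes fin: "finite S" and m0: "m0 \<in> S" "p m0 \<noteq> 0"
    and \<tau>': "\<And>x. \<tau>' x ^ 3 = 1"
    and near: "\<And>m. m \<in> S \<Longrightarrow> small (\<lambda>x. \<tau>' x * z x m - of_real (p m))"
    and \<tau>: "\<forall>\<^sub>F x in FF. \<tau> x ^ 3 = 1 \<and> norm_on S (\<lambda>m. Im (\<tau> x * z x m)) \<le> norm_on S (\<lambda>m. Im (\<tau>' x * z x m))"
    and m: "m \<in> S"
  shows "small (\<lambda>x. \<tau> x * z x m - of_real (p m))"
proof -
  \<comment> \<open>The quotient of the two roots, since \<open>(\<tau>' x)\<^sup>2\<close> is the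
    inverse of \<open>\<tau>' x\<close>. The aim is that it is eventually 1.\<close>
  define \<zeta> where "\<zeta> x = \<tau> x * (\<tau>' x)\<^sup>2" for x
  have "(\<tau>' x)\<^sup>2 * \<tau>' x = 1" for x using \<tau>'[of x] by (simp add: power2_eq_square power3_eq_cube)
  then have \<zeta>: "\<tau> x * y = \<zeta> x * (\<tau>' x * y)" for x y
    by (simp add: \<zeta>_def mult.assoc)
  have \<zeta>3: "\<forall>\<^sub>F x in FF. \<zeta> x ^ 3 = 1"
    using \<tau>
  proof eventually_elim
    case (elim x)
    have "((\<tau>' x)\<^sup>2) ^ 3 = (\<tau>' x ^ 3)\<^sup>2" by (simp add: power_mult[symmetric] mult.commute)
    then show ?case using elim \<tau>'[of x] by (simp add: \<zeta>_def power_mult_distrib)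
  qed
  have bdd: "bdd \<zeta>"
  proof (rule bddI[of _ 1])
    show "\<forall>\<^sub>F x in FF. norm (\<zeta> x) \<le> 1"
      using \<zeta>3
    proof eventually_elim
      case (elim x)
      have "norm (\<zeta> x ^ 3) = 1" using elim by simp
      then have "norm (\<zeta> x) ^ 3 = 1" by (simp only: norm_power)
      then show ?case using one_less_power[of "norm (\<zeta> x)" 3] by (simp add: not_less[symmetric]) (metis less_irrefl)
    qed
  qed
  have im: "small (\<lambda>x. Im (\<tau> x * z x m0))"
  proof (rule small_norm_on_le[OF small_norm_on _ fin m0(1)])
    show "small (\<lambda>x. Im (\<tau>' x * z x m))" if "m \<in> S" for m
      using small_Im[OF near[OF that]] by simp
    show "\<forall>\<^sub>F x in FF. norm_on S (\<lambda>m. Im (\<tau> x * z x m)) \<le> norm_on S (\<lambda>m. Im (\<tau>' x * z x m))"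
      using \<tau> by eventually_elim simp
  qed
  \<comment> \<open>At \<open>m0\<close> the vector \<open>\<tau> x * z x\<close> is within
    \<open>O(e)\<close> both of being real and of \<open>\<zeta> x * p m0\<close>. As
    \<open>p m0\<close> is a nonzero real, \<open>Im (\<zeta> x)\<close> tends to 0.\<close>
  have "small (\<lambda>x. \<zeta> x * (\<tau>' x * z x m0 - of_real (p m0)))"
    by (intro small_mult_bdd bdd near m0)
  then have "small (\<lambda>x. Im (\<tau> x * z x m0) - Im (\<zeta> x * (\<tau>' x * z x m0 - of_real (p m0))))"
    by (intro small_diff im small_Im)
  then have "small (\<lambda>x. p m0 * Im (\<zeta> x))"
    unfolding \<zeta>[of _ "z _ m0"] right_diff_distrib by (simp add: mult.commute)
  then have "small (\<lambda>x. inverse (p m0) * (p m0 * Im (\<zeta> x)))" by (rule small_mult_const)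
  then have "small (\<lambda>x. Im (\<zeta> x))" by (rule small_cong) (use m0(2) in simp)
  then have "((\<lambda>x. Im (\<zeta> x)) \<longlongrightarrow> 0) FF" by (rule small_tendsto)
  from tendstoD[OF this, of "1/2"] have "\<forall>\<^sub>F x in FF. \<bar>Im (\<zeta> x)\<bar> < 1/2"
    by (simp add: dist_norm)
  with \<zeta>3 have "\<forall>\<^sub>F x in FF. \<zeta> x = 1"
    by eventually_elim (rule cube_root_unity_real)
  then have "\<forall>\<^sub>F x in FF. \<tau>' x * z x m - of_real (p m) = \<tau> x * z x m - of_real (p m)"
    by eventually_elim (simp add: \<zeta>[of _ "z _ m"])
  with near[OF m] show ?thesis by (rule small_cong)
qed

end

section \<open>Eigenvectors of perturbed diagonal matrices\<close>

text \<open>In the Leibniz expansion every product contains an entry of row \<open>a\<close>, whose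
  limit is 0.\<close>

lemma det_tendsto_zero:
  fixes M :: "'x \<Rightarrow> nat \<Rightarrow> nat \<Rightarrow> complex"
  assumes "\<And>i j. i < r \<Longrightarrow> j < r \<Longrightarrow> ((\<lambda>x. M x i j) \<longlongrightarrow> m i j) FF"
    and "a < r" "\<And>j. j < r \<Longrightarrow> m a j = 0"
  shows "((\<lambda>x. Determinant.det (Matrix.mat r r (\<lambda>(i, j). M x i j))) \<longlongrightarrow> 0) FF"
proof -
  have "((\<lambda>x. \<Sum>p | p permutes {0..<r}. signof p * (\<Prod>i=0..<r. M x i (p i))) \<longlongrightarrow>
      (\<Sum>p | p permutes {0..<r}. signof p * (\<Prod>i=0..<r. m i (p i)))) FF"
  proof (intro tendsto_sum tendsto_mult tendsto_const tendsto_prod)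
    fix p i assume "p \<in> {p. p permutes {0..<r}}" "i \<in> {0..<r}"
    then have "p i < r" "i < r" using permutes_in_image[of p "{0..<r}" i] by auto
    then show "((\<lambda>x. M x i (p i)) \<longlongrightarrow> m i (p i)) FF" by (intro assms)
  qed
  moreover have "(\<Prod>i=0..<r. m i (p i)) = 0" if "p permutes {0..<r}" for p
  proof (intro prod_zero bexI[of _ a])
    show "m a (p a) = 0" using permutes_in_image[OF that, of a] assms(2,3) by auto
  qed (use assms(2) in auto)
  moreover have "Determinant.det (Matrix.mat r r (\<lambda>(i, j). M x i j)) =
      (\<Sum>p | p permutes {0..<r}. signof p * (\<Prod>i=0..<r. M x i (p i)))" for x
  proof -
    have "(\<Prod>i=0..<r. Matrix.mat r r (\<lambda>(i, j). M x i j) $$ (i, p i)) = (\<Prod>i=0..<r. M x i (p i))"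
      if "p permutes {0..<r}" for p
    proof (intro prod.cong refl)
      fix i assume "i \<in> {0..<r}"
      with permutes_in_image[OF that, of i]
      show "Matrix.mat r r (\<lambda>(i, j). M x i j) $$ (i, p i) = M x i (p i)" by simp
    qed
    then show ?thesis by (subst det_def'[of _ r]) auto
  qed
  ultimately show ?thesis by simp
qed

text \<open>With the eigenvectors as columns of \<open>C\<close>, \<open>M * C = C * D\<close> for
  the diagonal matrix \<open>D\<close> of eigenvalues, and \<open>C\<close> has nonzero
  determinant.\<close>

lemma det_eigenbasis:
  fixes m :: "nat \<Rightarrow> nat \<Rightarrow> 'a::field"
  assumes "lin_indep_on r {1..r} c"
    and eig: "\<And>s t. s \<in> {1..r} \<Longrightarrow> t \<in> {1..r} \<Longrightarrow> (\<Sum>t'=1..r. m t t' * c s t') = k s * c s t"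
  shows "Determinant.det (Matrix.mat r r (\<lambda>(i, j). m (Suc i) (Suc j))) = (\<Prod>s=1..r. k s)"
proof -
  obtain \<rho> where \<rho>: "\<And>s t. s \<in> {1..r} \<Longrightarrow> t \<in> {1..r} \<Longrightarrow>
      (\<Sum>k=1..r. \<rho> t k * c s k) = (if s = t then 1 else 0)"
    by (rule dual_family_exists[OF assms(1)]) auto
  define M where "M = Matrix.mat r r (\<lambda>(i, j). m (Suc i) (Suc j))"
  define C where "C = Matrix.mat r r (\<lambda>(i, j). c (Suc j) (Suc i))"
  define R where "R = Matrix.mat r r (\<lambda>(i, j). \<rho> (Suc i) (Suc j))"
  define D where "D = Matrix.mat r r (\<lambda>(i, j). if i = j then k (Suc i) else 0)"
  have carr: "M \<in> carrier_mat r r" "C \<in> carrier_mat r r" "R \<in> carrier_mat r r" "D \<in> carrier_mat r r"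
    by (auto simp: M_def C_def R_def D_def)
  have "R * C = 1\<^sub>m r"
  proof (rule eq_matI)
    fix i j assume "i < dim_row (1\<^sub>m r :: 'a mat)" "j < dim_col (1\<^sub>m r :: 'a mat)"
    then have ij: "i < r" "j < r" by auto
    then have "(R * C) $$ (i, j) = (\<Sum>k<r. \<rho> (Suc i) (Suc k) * c (Suc j) (Suc k))"
      by (simp add: R_def C_def scalar_prod_def atLeast0LessThan)
    also have "\<dots> = (if j = i then 1 else 0)"
      using \<rho>[of "Suc j" "Suc i"] ij by (simp add: One_nat_def sum.atLeast1_atMost_eq)
    finally show "(R * C) $$ (i, j) = 1\<^sub>m r $$ (i, j)" using ij by auto
  qed (use carr in auto)
  then have "Determinant.det R * Determinant.det C = 1"
    using det_mult[of R r C] carr by simp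
  then have nz: "Determinant.det C \<noteq> 0" by auto
  have "M * C = C * D"
  proof (rule eq_matI)
    fix i j assume "i < dim_row (C * D)" "j < dim_col (C * D)"
    then have ij: "i < r" "j < r" using carr by auto
    then have "(M * C) $$ (i, j) = (\<Sum>t<r. m (Suc i) (Suc t) * c (Suc j) (Suc t))"
      by (simp add: M_def C_def scalar_prod_def atLeast0LessThan)
    also have "\<dots> = k (Suc j) * c (Suc j) (Suc i)"
      using eig[of "Suc j" "Suc i"] ij by (simp add: One_nat_def sum.atLeast1_atMost_eq)
    also have "\<dots> = (\<Sum>t<r. c (Suc t) (Suc i) * (if t = j then k (Suc t) else 0))"
      using ij by (simp add: mult.commute if_distrib cong: if_cong)
    also have "\<dots> = (C * D) $$ (i, j)"
      using ij by (simp add: C_def D_def scalar_prod_def atLeast0LessThan)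
    finally show "(M * C) $$ (i, j) = (C * D) $$ (i, j)" .
  qed (use carr in auto)
  then have "Determinant.det M * Determinant.det C = Determinant.det C * Determinant.det D"
    using det_mult[OF carr(1,2)] det_mult[OF carr(2,4)] by metis
  moreover have "Determinant.det D = (\<Prod>s=1..r. k s)"
  proof -
    have "Determinant.det D = (\<Prod>i=0..<r. D $$ (i, i))"
      using det_upper_triangular[of D r] carr
      by (auto simp: D_def upper_triangular_def prod_list_diag_prod)
    also have "\<dots> = (\<Prod>i<r. k (Suc i))"
      by (auto simp: D_def atLeast0LessThan intro!: prod.cong)
    finally show ?thesis by (simp add: One_nat_def prod.atLeast1_atMost_eq)
  qed
  ultimately show ?thesis using nz by (simp add: M_def mult.commute)
qed

text \<open>
  If \<open>\<lambda>\<^sub>t\<close> were the dominant coordinate of no eigenvector, all eigenvalues would stay away from it;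
  but their differences to \<open>\<lambda>\<^sub>t\<close> multiply to a determinant with a row tending to zero.
\<close>

lemma perturbed_diagonal_eigenvectors_bij:
  fixes lam :: "nat \<Rightarrow> complex" and h :: "'x \<Rightarrow> nat \<Rightarrow> nat \<Rightarrow> complex"
  assumes inj: "inj_on lam {1..r}"
    and h: "\<And>t t'. t \<in> {1..r} \<Longrightarrow> t' \<in> {1..r} \<Longrightarrow> ((\<lambda>x. h x t t') \<longlongrightarrow> 0) FF"
    and eig: "\<forall>\<^sub>F x in FF. \<forall>s\<in>{1..r}. \<forall>t\<in>{1..r}.
      lam t * c x s t + (\<Sum>t'=1..r. h x t t' * c x s t') = lam' x s * c x s t"
    and indep: "\<forall>\<^sub>F x in FF. lin_indep_on r {1..r} (c x)"
    and \<pi>: "\<And>x s. s \<in> {1..r} \<Longrightarrow> \<pi> x s \<in> {1..r}"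
      "\<And>x s t. s \<in> {1..r} \<Longrightarrow> t \<in> {1..r} \<Longrightarrow> norm (c x s t) \<le> norm (c x s (\<pi> x s))"
  shows "\<forall>\<^sub>F x in FF. bij_betw (\<pi> x) {1..r} {1..r}"
proof -
  define H where "H x = (\<Sum>t=1..r. \<Sum>t'=1..r. norm (h x t t'))" for x
  define gaps where "gaps = (\<lambda>(s, t). norm (lam s - lam t)) ` ({1..r} \<times> {1..r} - Id)"
  \<comment> \<open>The least distance between two of the limiting eigenvalues. The inserted 1 keeps
    \<open>Min\<close> meaningful if there is at most one eigenvalue.\<close>
  define \<delta> where "\<delta> = Min (insert 1 gaps)"
  have fin: "finite gaps" by (simp add: gaps_def)
  have "\<forall>g\<in>gaps. 0 < g"
  proof
    fix g assume "g \<in> gaps"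
    then obtain s t where "s \<in> {1..r}" "t \<in> {1..r}" "s \<noteq> t" and g: "g = norm (lam s - lam t)"
      unfolding gaps_def by fast
    then have "lam s \<noteq> lam t" using inj_onD[OF inj, of s t] by metis
    then show "0 < g" by (simp add: g)
  qed
  then have \<delta>: "0 < \<delta>"
    unfolding \<delta>_def using fin by simp
  have gap: "\<delta> \<le> norm (lam s - lam t)" if "s \<in> {1..r}" "t \<in> {1..r}" "s \<noteq> t" for s t
  proof -
    have "norm (lam s - lam t) \<in> gaps"
      unfolding gaps_def using that by (intro image_eqI[of _ _ "(s, t)"]) auto
    then show ?thesis unfolding \<delta>_def using fin by (intro Min_le) auto
  qed
  have "(H \<longlongrightarrow> (\<Sum>t=1..r. \<Sum>t'=1..r. 0)) FF"
    unfolding H_def by (intro tendsto_sum tendsto_norm_zero h)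
  then have H: "\<forall>\<^sub>F x in FF. H x < \<delta> / 2"
    using \<delta> by (intro order_tendstoD(2)[of H 0]) auto
  \<comment> \<open>The perturbed matrix shifted by \<open>lam t0\<close>: its eigenvalues are
    \<open>lam' x s - lam t0\<close>, and its row \<open>t0\<close> tends to 0.\<close>
  define m where "m x t0 t t' = (if t = t' then lam t - lam t0 else 0) + h x t t'" for x t0 t t'
  have det: "\<forall>\<^sub>F x in FF. norm (Determinant.det (Matrix.mat r r (\<lambda>(i, j). m x t0 (Suc i) (Suc j)))) < (\<delta> / 2) ^ r"
    if t0: "t0 \<in> {1..r}" for t0
  proof -
    have "((\<lambda>x. Determinant.det (Matrix.mat r r (\<lambda>(i, j). m x t0 (Suc i) (Suc j)))) \<longlongrightarrow> 0) FF"
    proof (rule det_tendsto_zero[where a = "t0 - 1" and M = "\<lambda>x i j. m x t0 (Suc i) (Suc j)"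
          and m = "\<lambda>i j. if i = j then lam (Suc i) - lam t0 else 0"])
      fix i j assume ij: "i < r" "j < r"
      have "((\<lambda>x. m x t0 (Suc i) (Suc j)) \<longlongrightarrow> (if Suc i = Suc j then lam (Suc i) - lam t0 else 0) + 0) FF"
        unfolding m_def using ij by (intro tendsto_add tendsto_const h) auto
      then show "((\<lambda>x. m x t0 (Suc i) (Suc j)) \<longlongrightarrow> (if i = j then lam (Suc i) - lam t0 else 0)) FF"
        by simp
    qed (use t0 in auto)
    then show ?thesis using \<delta> by (auto simp: tendsto_iff dist_norm)
  qed
  have "\<forall>\<^sub>F x in FF. \<forall>t0\<in>{1..r}. norm (Determinant.det (Matrix.mat r r (\<lambda>(i, j). m x t0 (Suc i) (Suc j)))) < (\<delta> / 2) ^ r"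
    by (intro eventually_ball_finite ballI det) auto
  then show ?thesis using H eig indep
  proof eventually_elim
    case (elim x)
    \<comment> \<open>The row of the eigenvalue equation at the dominant coordinate: all other
      coordinates are no larger, so after division the perturbation contributes at most
      \<open>H x\<close>.\<close>
    have near: "norm (lam' x s - lam (\<pi> x s)) \<le> H x" if s: "s \<in> {1..r}" for s
    proof -
      let ?p = "\<pi> x s"
      have p: "?p \<in> {1..r}" using \<pi> s by auto
      have nz: "c x s ?p \<noteq> 0"
      proof
        assume "c x s ?p = 0"
        then have "c x s t = 0" if "t \<in> {1..r}" for t using \<pi>(2)[OF s that, of x] by simp
        then show False using lin_indep_on_nonzero[OF elim(4) s] by blast
      qed
      have "(lam' x s - lam ?p) * c x s ?p = (\<Sum>t'=1..r. h x ?p t' * c x s t')"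
        using elim(3)[rule_format, OF s p] by (metis add_diff_cancel_left' left_diff_distrib)
      then have "norm (lam' x s - lam ?p) * norm (c x s ?p) = norm (\<Sum>t'=1..r. h x ?p t' * c x s t')"
        by (metis norm_mult)
      also have "\<dots> \<le> (\<Sum>t'=1..r. norm (h x ?p t') * norm (c x s t'))"
        by (rule order_trans[OF norm_sum]) (simp add: norm_mult)
      also have "\<dots> \<le> (\<Sum>t'=1..r. norm (h x ?p t') * norm (c x s ?p))"
        using \<pi> s by (intro sum_mono mult_left_mono) auto
      also have "\<dots> = (\<Sum>t'=1..r. norm (h x ?p t')) * norm (c x s ?p)"
        by (simp add: sum_distrib_right)
      also have "\<dots> \<le> H x * norm (c x s ?p)"
        unfolding H_def using p
        by (intro mult_right_mono member_le_sum[where f="\<lambda>t. \<Sum>t'=1..r. norm (h x t t')"] sum_nonneg) auto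
      finally show ?thesis using nz by simp
    qed
    \<comment> \<open>If \<open>t0\<close> is missed, every eigenvalue is
      \<open>\<delta>\<close>-far from \<open>lam t0\<close> up to an error below
      \<open>\<delta> / 2\<close>, so the determinant has modulus at least
      \<open>(\<delta> / 2) ^ r\<close>, against the bound above. A surjection of a finite set onto
      itself is a bijection.\<close>
    have "t0 \<in> \<pi> x ` {1..r}" if t0: "t0 \<in> {1..r}" for t0
    proof (rule ccontr)
      assume notin: "t0 \<notin> \<pi> x ` {1..r}"
      have far: "\<delta> / 2 \<le> norm (lam' x s - lam t0)" if s: "s \<in> {1..r}" for s
      proof -
        have "\<delta> \<le> norm (lam (\<pi> x s) - lam t0)" using notin s t0 \<pi>(1)[OF s, of x] by (intro gap) auto
        also have "\<dots> \<le> norm (lam' x s - lam t0) + norm (lam' x s - lam (\<pi> x s))"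
          using norm_triangle_ineq4[of "lam' x s - lam t0" "lam' x s - lam (\<pi> x s)"] by simp
        finally show ?thesis using near[OF s] elim(2) by simp
      qed
      have "Determinant.det (Matrix.mat r r (\<lambda>(i, j). m x t0 (Suc i) (Suc j))) = (\<Prod>s=1..r. lam' x s - lam t0)"
      proof (rule det_eigenbasis[OF elim(4)])
        fix s t assume st: "s \<in> {1..r}" "t \<in> {1..r}"
        have "(\<Sum>t'=1..r. m x t0 t t' * c x s t')
            = (\<Sum>t'=1..r. (if t' = t then (lam t - lam t0) * c x s t else 0) + h x t t' * c x s t')"
          by (intro sum.cong refl) (auto simp: m_def distrib_right)
        also have "\<dots> = (lam t - lam t0) * c x s t + (\<Sum>t'=1..r. h x t t' * c x s t')"
          using st by (simp add: sum.distrib)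
        also have "\<dots> = (lam' x s - lam t0) * c x s t"
          using elim(3) st by (simp add: algebra_simps)
        finally show "(\<Sum>t'=1..r. m x t0 t t' * c x s t') = (lam' x s - lam t0) * c x s t" .
      qed
      moreover have "(\<Prod>s=1..r. \<delta> / 2) \<le> (\<Prod>s=1..r. norm (lam' x s - lam t0))"
        using far \<delta> by (intro prod_mono) auto
      ultimately show False using bspec[OF elim(1) t0] by (simp add: prod_norm)
    qed
    then have "{1..r} \<subseteq> \<pi> x ` {1..r}" by blast
    moreover have "\<pi> x ` {1..r} \<subseteq> {1..r}" using \<pi> by blast
    ultimately show ?case
      using finite_surj_inj[of "{1..r}" "\<pi> x"] by (simp add: bij_betw_def subset_antisym)
  qed
qed

section \<open>Stability of the incomplete tensor decomposition\<close>

text \<open>The vectors \<open>P s\<close> are labelled \<open>0..n\<close> like the tensors.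
  \<open>gen\<close> is the equation of the generating matrix separated into its components, and the
  sums in \<open>distinct_eigenvalues\<close> are the eigenvalues of \<open>N(\<xi>)\<close>
  expressed by \<open>P\<close>.\<close>

locale tensor_decomposition =
  fixes r n :: nat and P :: "nat \<Rightarrow> nat \<Rightarrow> complex" and G :: gmatrix and \<xi> :: "nat \<Rightarrow> complex"
  assumes r_less: "r + 1 \<le> n"
    and P0: "\<And>s. s \<in> {1..r} \<Longrightarrow> P s 0 \<noteq> 0"
    and indep: "lin_indep_on r {1..r} P"
    and indep_tail: "\<And>j. j \<in> {r+1..n} \<Longrightarrow> lin_indep_on r ({r+1..n} - {j}) P"
    and gen: "\<And>i j s. i \<in> {1..r} \<Longrightarrow> j \<in> {r+1..n} \<Longrightarrow> s \<in> {1..r} \<Longrightarrow>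
      P s 0 * (\<Sum>k=1..r. G k (i, j) * P s k) = P s i * P s j"
    and distinct_eigenvalues: "inj_on (\<lambda>s. \<Sum>j=r+1..n. \<xi> j * (P s j / P s 0)) {1..r}"
begin

abbreviation "I \<equiv> {1..r}"
abbreviation "J \<equiv> {r+1..n}"

text \<open>The dual basis of the heads of the \<open>P s\<close>, which gives coordinates in the
  basis \<open>P\<close>. Likewise \<open>\<eta> j\<close> is dual to the tails without label
  \<open>j\<close>. Both belong to the exact decomposition and stay fixed under
  perturbation.\<close>

definition \<rho> :: "nat \<Rightarrow> nat \<Rightarrow> complex" where
  "\<rho> = (SOME \<rho>. \<forall>s\<in>I. \<forall>t\<in>I. (\<Sum>k\<in>I. \<rho> t k * P s k) = (if s = t then 1 else 0))"

definition \<eta> :: "nat \<Rightarrow> nat \<Rightarrow> nat \<Rightarrow> complex" where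
  "\<eta> j = (SOME \<eta>. \<forall>s\<in>I. \<forall>t\<in>I. (\<Sum>l\<in>J-{j}. \<eta> t l * P s l) = (if s = t then 1 else 0))"

definition "w s j = P s j / P s 0"
definition "lam s = (\<Sum>j\<in>J. \<xi> j * w s j)"
definition "T0 i j k = (\<Sum>s\<in>I. P s i * P s j * P s k)"
text \<open>An explicit left inverse of the matrix with rows \<open>l\<close> in
  \<open>J - {j}\<close> and entries \<open>T0 0 k l\<close>. That matrix is a product of tails, the
  diagonal of the \<open>P t 0\<close>, and heads; \<open>\<eta> j\<close>, the inverses and
  \<open>\<rho>\<close> undo the three factors.\<close>

definition "L j k' l = (\<Sum>t\<in>I. \<rho> t k' * \<eta> j t l * inverse (P t 0))"

lemma rho: "s \<in> I \<Longrightarrow> t \<in> I \<Longrightarrow> (\<Sum>k\<in>I. \<rho> t k * P s k) = (if s = t then 1 else 0)"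
proof -
  have "\<exists>\<rho>. \<forall>s\<in>I. \<forall>t\<in>I. (\<Sum>k\<in>I. \<rho> t k * P s k) = (if s = t then 1 else 0)"
    by (rule dual_family_exists[OF indep finite_atLeastAtMost]) blast
  from someI_ex[OF this, folded \<rho>_def] show "s \<in> I \<Longrightarrow> t \<in> I \<Longrightarrow> ?thesis" by blast
qed

lemma eta: "j \<in> J \<Longrightarrow> s \<in> I \<Longrightarrow> t \<in> I \<Longrightarrow> (\<Sum>l\<in>J-{j}. \<eta> j t l * P s l) = (if s = t then 1 else 0)"
proof -
  assume j: "j \<in> J"
  have "\<exists>\<eta>. \<forall>s\<in>I. \<forall>t\<in>I. (\<Sum>l\<in>J-{j}. \<eta> t l * P s l) = (if s = t then 1 else 0)"
    by (rule dual_family_exists[OF indep_tail[OF j]], simp) blast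
  from someI_ex[OF this, folded \<eta>_def] show "s \<in> I \<Longrightarrow> t \<in> I \<Longrightarrow> ?thesis" by blast
qed

lemma rho_transpose: "i \<in> I \<Longrightarrow> k \<in> I \<Longrightarrow> (\<Sum>t\<in>I. \<rho> t i * P t k) = (if i = k then 1 else 0)"
  by (rule dual_family_transpose[OF rho])

lemma rho_contract: "t \<in> I \<Longrightarrow> (\<Sum>k\<in>I. \<rho> t k * (\<Sum>s\<in>I. a s * P s k)) = a t"
proof -
  assume t: "t \<in> I"
  have "(\<Sum>k\<in>I. \<rho> t k * (\<Sum>s\<in>I. a s * P s k)) = (\<Sum>s\<in>I. a s * (\<Sum>k\<in>I. \<rho> t k * P s k))"
    unfolding sum_distrib_left by (subst sum.swap) (simp only: mult_ac)
  also have "\<dots> = (\<Sum>s\<in>I. a s * (if s = t then 1 else 0))"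
    using t by (intro sum.cong refl) (simp only: rho)
  finally show ?thesis using t by (simp only: sum_kron finite_atLeastAtMost)
qed

lemma eta_contract: "j \<in> J \<Longrightarrow> t \<in> I \<Longrightarrow> (\<Sum>l\<in>J-{j}. \<eta> j t l * (\<Sum>s\<in>I. a s * P s l)) = a t"
proof -
  assume j: "j \<in> J" and t: "t \<in> I"
  have "(\<Sum>l\<in>J-{j}. \<eta> j t l * (\<Sum>s\<in>I. a s * P s l)) = (\<Sum>s\<in>I. a s * (\<Sum>l\<in>J-{j}. \<eta> j t l * P s l))"
    unfolding sum_distrib_left by (subst sum.swap) (simp only: mult_ac)
  also have "\<dots> = (\<Sum>s\<in>I. a s * (if s = t then 1 else 0))"
    using t j by (intro sum.cong refl) (simp only: eta)
  finally show ?thesis using t by (simp only: sum_kron finite_atLeastAtMost)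
qed

lemma coordinates: "k \<in> I \<Longrightarrow> u k = (\<Sum>t\<in>I. (\<Sum>i\<in>I. \<rho> t i * u i) * P t k)"
proof -
  assume k: "k \<in> I"
  have "(\<Sum>t\<in>I. (\<Sum>i\<in>I. \<rho> t i * u i) * P t k) = (\<Sum>i\<in>I. u i * (\<Sum>t\<in>I. \<rho> t i * P t k))"
    unfolding sum_distrib_left sum_distrib_right by (subst sum.swap) (simp only: mult_ac)
  also have "\<dots> = (\<Sum>i\<in>I. u i * (if i = k then 1 else 0))"
    using k by (intro sum.cong refl) (simp only: rho_transpose)
  finally show ?thesis using k by (simp only: sum_kron finite_atLeastAtMost)
qed

text \<open>Dividing \<open>gen\<close> by \<open>P s 0\<close> turns it into an eigenvalue
  equation: the head of \<open>P s\<close> is an eigenvector of each \<open>N\<^sub>j\<close>, with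
  the eigenvalue \<open>w s j\<close>.\<close>

lemma eigen:
  assumes "i \<in> I" "j \<in> J" "s \<in> I"
  shows "(\<Sum>k\<in>I. G k (i, j) * P s k) = w s j * P s i"
  using gen[OF assms] P0[OF assms(3)] by (simp add: w_def field_simps)

lemma G_T0:
  assumes "i \<in> I" "j \<in> J"
  shows "(\<Sum>k\<in>I. G k (i, j) * T0 0 k l) = T0 i j l"
proof -
  have "(\<Sum>k\<in>I. G k (i, j) * T0 0 k l) = (\<Sum>s\<in>I. (P s 0 * (\<Sum>k\<in>I. G k (i, j) * P s k)) * P s l)"
    unfolding T0_def sum_distrib_left sum_distrib_right by (subst sum.swap) (simp only: mult_ac)
  also have "\<dots> = T0 i j l"
    unfolding T0_def using assms by (intro sum.cong refl) (simp only: gen)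
  finally show ?thesis .
qed

lemma L_T0:
  assumes j: "j \<in> J" and k: "k \<in> I" "k' \<in> I"
  shows "(\<Sum>l\<in>J-{j}. L j k' l * T0 0 k l) = (if k = k' then 1 else 0)"
proof -
  have "(\<Sum>l\<in>J-{j}. L j k' l * T0 0 k l)
      = (\<Sum>t\<in>I. \<rho> t k' * inverse (P t 0) * (\<Sum>l\<in>J-{j}. \<eta> j t l * T0 0 k l))"
    unfolding L_def sum_distrib_left sum_distrib_right by (subst sum.swap) (simp only: mult_ac)
  also have "\<dots> = (\<Sum>t\<in>I. \<rho> t k' * inverse (P t 0) * (P t 0 * P t k))"
    unfolding T0_def using j by (intro sum.cong refl) (simp only: eta_contract)
  also have "\<dots> = (\<Sum>t\<in>I. \<rho> t k' * P t k)"
    using P0 by (intro sum.cong refl) simp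
  finally show ?thesis using rho_transpose[OF k(2,1)] by (simp only: eq_commute[of k' k])
qed

end

section \<open>The generating matrix of a perturbed decomposition\<close>

locale tensor_perturbation = tensor_decomposition + error_filter FF e
  for FF :: "'x filter" and e :: "'x \<Rightarrow> real" +
  fixes Q :: "'x \<Rightarrow> nat \<Rightarrow> nat \<Rightarrow> complex"
  assumes close: "\<And>i j k. i \<le> n \<Longrightarrow> j \<le> n \<Longrightarrow> k \<le> n \<Longrightarrow> i \<noteq> j \<Longrightarrow> i \<noteq> k \<Longrightarrow> j \<noteq> k \<Longrightarrow>
    small (\<lambda>x. (\<Sum>s=1..r. Q x s i * Q x s j * Q x s k) - (\<Sum>s=1..r. P s i * P s j * P s k))"
begin

definition "T x i j k = (\<Sum>s\<in>I. Q x s i * Q x s j * Q x s k)"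
text \<open>The defect of \<open>L\<close> as a left inverse once the exact tensor is replaced by
  the perturbed one.\<close>

definition "H x j k' k = (\<Sum>l\<in>J-{j}. L j k' l * (T x 0 k l - T0 0 k l))"

lemma close_T: "i \<le> n \<Longrightarrow> j \<le> n \<Longrightarrow> k \<le> n \<Longrightarrow> i \<noteq> j \<Longrightarrow> i \<noteq> k \<Longrightarrow> j \<noteq> k \<Longrightarrow>
    small (\<lambda>x. T x i j k - T0 i j k)"
  unfolding T_def T0_def by (rule close)

lemma small_H: "j \<in> J \<Longrightarrow> k \<in> I \<Longrightarrow> small (\<lambda>x. H x j k' k)"
  unfolding H_def by (intro small_sum small_mult_const close_T) auto

text \<open>The matrix \<open>T x 0 k l\<close> is the product of the tails of \<open>Q\<close> with
  the rows \<open>Q x s 0 * Q x s k\<close>. Hence the identity plus \<open>H\<close>, applied to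
  \<open>g\<close>, depends only on the image of \<open>g\<close> under these rows. This gives both
  the injectivity of \<open>X\<close> and the bound on the correction.\<close>

lemma L_T:
  assumes "j \<in> J" "k' \<in> I"
  shows "g k' + (\<Sum>k\<in>I. H x j k' k * g k) =
    (\<Sum>l\<in>J-{j}. L j k' l * (\<Sum>s\<in>I. Q x s l * (\<Sum>k\<in>I. Q x s 0 * Q x s k * g k)))"
proof -
  have LT: "(\<Sum>l\<in>J-{j}. L j k' l * T x 0 k l) = (if k = k' then 1 else 0) + H x j k' k"
    if "k \<in> I" for k
    using L_T0[OF assms(1) that assms(2)] by (simp add: H_def right_diff_distrib sum_subtractf)
  have "(\<Sum>s\<in>I. Q x s l * (\<Sum>k\<in>I. Q x s 0 * Q x s k * g k)) = (\<Sum>k\<in>I. T x 0 k l * g k)" for l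
    unfolding T_def sum_distrib_left sum_distrib_right by (subst sum.swap) (simp only: mult_ac)
  then have "(\<Sum>l\<in>J-{j}. L j k' l * (\<Sum>s\<in>I. Q x s l * (\<Sum>k\<in>I. Q x s 0 * Q x s k * g k)))
      = (\<Sum>l\<in>J-{j}. L j k' l * (\<Sum>k\<in>I. T x 0 k l * g k))"
    by (simp only:)
  also have "\<dots> = (\<Sum>k\<in>I. (\<Sum>l\<in>J-{j}. L j k' l * T x 0 k l) * g k)"
    unfolding sum_distrib_left sum_distrib_right by (subst sum.swap) (simp only: mult_ac)
  also have "\<dots> = (\<Sum>k\<in>I. ((if k = k' then 1 else 0) + H x j k' k) * g k)"
    by (intro sum.cong refl) (simp only: LT)
  also have "\<dots> = (\<Sum>k\<in>I. (if k = k' then 1 else 0) * g k) + (\<Sum>k\<in>I. H x j k' k * g k)"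
    by (simp only: distrib_right sum.distrib)
  finally show ?thesis using assms(2) by (simp only: sum_kron finite_atLeastAtMost)
qed

definition "X x s k = Q x s 0 * Q x s k"

text \<open>If \<open>X\<close> kills \<open>g\<close>, then \<open>L_T\<close> gives
  \<open>g + H g = 0\<close>, and a small \<open>H\<close> forces \<open>g = 0\<close>.\<close>

lemma X_injective:
  "\<forall>\<^sub>F x in FF. \<forall>g. (\<forall>s\<in>I. (\<Sum>k\<in>I. X x s k * g k) = 0) \<longrightarrow> (\<forall>k\<in>I. g k = 0)"
proof -
  have j: "r + 1 \<in> J" using r_less by simp
  have "((\<lambda>x. \<Sum>k'\<in>I. \<Sum>k\<in>I. norm (H x (r+1) k' k)) \<longlongrightarrow> 0) FF"
    by (intro small_tendsto small_sum) (simp add: small_iff_norm small_H[OF j])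
  then have "\<forall>\<^sub>F x in FF. (\<Sum>k'\<in>I. \<Sum>k\<in>I. norm (H x (r+1) k' k)) < 1/2"
    by (rule order_tendstoD) simp
  then show ?thesis
  proof eventually_elim
    case (elim x)
    show ?case
    proof (intro allI impI ballI)
      fix g k assume g: "\<forall>s\<in>I. (\<Sum>k\<in>I. X x s k * g k) = 0" and k: "k \<in> I"
      have "(\<Sum>t\<in>I. norm (g t)) \<le> 2 * (\<Sum>t\<in>I. norm (0::complex))"
      proof (rule near_identity_bound[of I _ "H x (r+1)"])
        fix k' assume k': "k' \<in> I"
        show "g k' + (\<Sum>k\<in>I. H x (r+1) k' k * g k) = 0"
          unfolding L_T[OF j k'] using g by (simp add: X_def)
      qed (use elim in auto)
      then have "(\<Sum>t\<in>I. norm (g t)) = 0" by (simp add: sum_nonneg antisym)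
      then show "g k = 0" using k by (simp add: sum_nonneg_eq_0_iff)
    qed
  qed
qed

text \<open>The residual of \<open>G\<close> on \<open>\<Sum> q\<^sub>s\<^sup>\<otimes>\<^sup>3\<close>; the generating matrix of that tensor is \<open>G - g\<close>.\<close>

definition "E x i j s = Q x s 0 * (\<Sum>k\<in>I. G k (i, j) * Q x s k) - Q x s i * Q x s j"
definition "g x i j = (SOME g. \<forall>s\<in>I. (\<Sum>k\<in>I. X x s k * g k) = E x i j s)"

lemma g_eq: "\<forall>\<^sub>F x in FF. \<forall>i j. \<forall>s\<in>I. (\<Sum>k\<in>I. X x s k * g x i j k) = E x i j s"
  using X_injective
proof eventually_elim
  case (elim x)
  show ?case
  proof (intro allI)
    fix i j
    have "\<exists>g. \<forall>s\<in>I. (\<Sum>k\<in>I. X x s k * g k) = E x i j s"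
      by (rule square_system_solvable[OF elim])
    from someI_ex[OF this, folded g_def] show "\<forall>s\<in>I. (\<Sum>k\<in>I. X x s k * g x i j k) = E x i j s" .
  qed
qed

text \<open>The residual \<open>E\<close> itself may be large because \<open>Q\<close> is unbounded.
  Summed against \<open>Q x s l\<close>, it becomes a combination of tensor entries
  \<open>(0, k, l)\<close> and \<open>(i, j, l)\<close>. With \<open>l\<close> in
  \<open>J - {j}\<close> all these labels are distinct, and the combination vanishes for the exact
  tensor. So \<open>g + H g\<close> is \<open>small\<close>.\<close>

lemma small_g:
  assumes i: "i \<in> I" and j: "j \<in> J" and k: "k \<in> I"
  shows "small (\<lambda>x. g x i j k)"
proof -
  have "small (\<lambda>x. g x i j k - 0)"
  proof (rule near_absorb[OF _ k])
    fix k' assume k': "k' \<in> I"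
    have "small (\<lambda>x. \<Sum>l\<in>J-{j}. L j k' l * ((\<Sum>k\<in>I. G k (i, j) * (T x 0 k l - T0 0 k l)) - (T x i j l - T0 i j l)))"
      using i j by (intro small_sum small_mult_const small_diff close_T) auto
    then show "small (\<lambda>x. g x i j k' + (\<Sum>k\<in>I. H x j k' k * g x i j k) - 0)"
    proof (rule small_cong)
      show "\<forall>\<^sub>F x in FF. (\<Sum>l\<in>J-{j}. L j k' l * ((\<Sum>k\<in>I. G k (i, j) * (T x 0 k l - T0 0 k l)) - (T x i j l - T0 i j l)))
         = g x i j k' + (\<Sum>k\<in>I. H x j k' k * g x i j k) - 0"
        using g_eq
      proof eventually_elim
        case (elim x)
        have "(\<Sum>s\<in>I. Q x s l * E x i j s) = (\<Sum>k\<in>I. G k (i, j) * T x 0 k l) - T x i j l" for l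
        proof -
          have "(\<Sum>s\<in>I. Q x s l * (Q x s 0 * (\<Sum>k\<in>I. G k (i, j) * Q x s k)))
              = (\<Sum>k\<in>I. G k (i, j) * T x 0 k l)"
            unfolding T_def sum_distrib_left by (subst sum.swap) (simp only: mult_ac)
          then show ?thesis
            by (simp only: E_def right_diff_distrib sum_subtractf) (simp only: T_def mult_ac)
        qed
        then show ?case
          using elim G_T0[OF i j]
          by (simp add: L_T[OF j k'] X_def[symmetric] right_diff_distrib sum_subtractf)
      qed
    qed
  qed (use j small_H in auto)
  then show ?thesis by simp
qed

text \<open>\<open>X\<close> is the diagonal matrix of the \<open>Q x s 0\<close> times the heads of
  \<open>Q\<close>; since it is onto, both factors are invertible.\<close>

lemma Q_nondegenerate: "\<forall>\<^sub>F x in FF. (\<forall>s\<in>I. Q x s 0 \<noteq> 0) \<and> lin_indep_on r I (Q x)"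
  using X_injective
proof eventually_elim
  case (elim x)
  have sol: "\<exists>g. \<forall>s\<in>I. (\<Sum>k\<in>I. X x s k * g k) = b s" for b
    by (rule square_system_solvable[OF elim])
  have nz: "Q x s 0 \<noteq> 0" if s: "s \<in> I" for s
  proof
    assume 0: "Q x s 0 = 0"
    obtain g where "\<forall>s\<in>I. (\<Sum>k\<in>I. X x s k * g k) = 1" using sol[of "\<lambda>_. 1"] by blast
    then have "(\<Sum>k\<in>I. X x s k * g k) = 1" using s by (rule bspec)
    then show False by (simp add: X_def 0)
  qed
  have "lin_indep_on r I (Q x)"
    unfolding lin_indep_on_def
  proof (intro allI impI ballI)
    fix c s assume c: "\<forall>t\<in>I. (\<Sum>k\<in>I. c k * Q x k t) = 0" and s: "s \<in> I"
    obtain g where g: "\<forall>t\<in>I. (\<Sum>k\<in>I. X x t k * g k) = (if t = s then 1 else 0)"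
      using sol[of "\<lambda>t. if t = s then 1 else 0"] by blast
    have "(\<Sum>t\<in>I. c t / Q x t 0 * (\<Sum>k\<in>I. X x t k * g k)) = (\<Sum>t\<in>I. c t / Q x t 0 * (if t = s then 1 else 0))"
      using g by (intro sum.cong refl) simp
    also have "\<dots> = c s / Q x s 0" using s by (simp only: sum_kron finite_atLeastAtMost)
    finally have "c s / Q x s 0 = (\<Sum>t\<in>I. c t / Q x t 0 * (\<Sum>k\<in>I. X x t k * g k))" ..
    also have "\<dots> = (\<Sum>t\<in>I. \<Sum>k\<in>I. c t * Q x t k * g k)"
      unfolding sum_distrib_left by (intro sum.cong refl) (use nz in \<open>simp add: X_def\<close>)
    also have "\<dots> = (\<Sum>k\<in>I. (\<Sum>t\<in>I. c t * Q x t k) * g k)"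
      unfolding sum_distrib_right by (rule sum.swap)
    also have "\<dots> = 0" using c by simp
    finally show "c s = 0" using nz[OF s] by simp
  qed
  then show ?case using nz by blast
qed

definition "c x s t = (\<Sum>k\<in>I. \<rho> t k * Q x s k)"
text \<open>The correction \<open>-g\<close> to the matrix \<open>N\<^sub>j\<close>, written in the
  basis \<open>P\<close>.\<close>

definition "h x j t t' = - (\<Sum>i\<in>I. \<rho> t i * (\<Sum>k\<in>I. g x i j k * P t' k))"

lemma Q_coordinates: "k \<in> I \<Longrightarrow> Q x s k = (\<Sum>t\<in>I. c x s t * P t k)"
  unfolding c_def by (rule coordinates)

lemma small_h: "j \<in> J \<Longrightarrow> small (\<lambda>x. h x j t t')"
  unfolding h_def by (intro small_minus small_sum small_mult_const small_bdd_mult small_g bdd_const)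

text \<open>For \<open>G - g\<close> the heads of the \<open>Q x s\<close> are exact joint
  eigenvectors, with eigenvalues \<open>Q x s j / Q x s 0\<close>. In the basis \<open>P\<close> the
  part from \<open>G\<close> is diagonal with entries \<open>w t j\<close>, and the part from
  \<open>-g\<close> is \<open>h\<close>.\<close>

lemma eigen_Q:
  "\<forall>\<^sub>F x in FF. \<forall>j\<in>J. \<forall>s\<in>I. \<forall>t\<in>I.
    w t j * c x s t + (\<Sum>t'\<in>I. h x j t t' * c x s t') = Q x s j / Q x s 0 * c x s t"
  using g_eq Q_nondegenerate
proof eventually_elim
  case (elim x)
  show ?case
  proof (intro ballI)
    fix j s t assume jst: "j \<in> J" "s \<in> I" "t \<in> I"
    have nz: "Q x s 0 \<noteq> 0" using elim jst by blast
    have 1: "(\<Sum>k\<in>I. G k (i, j) * Q x s k) - (\<Sum>k\<in>I. g x i j k * Q x s k) = Q x s j / Q x s 0 * Q x s i" for i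
    proof -
      have "Q x s 0 * (\<Sum>k\<in>I. g x i j k * Q x s k) = E x i j s"
        using elim(1)[rule_format, OF jst(2), of i j] by (simp only: X_def sum_distrib_left mult_ac)
      then have "Q x s 0 * ((\<Sum>k\<in>I. G k (i, j) * Q x s k) - (\<Sum>k\<in>I. g x i j k * Q x s k)) = Q x s i * Q x s j"
        by (simp add: E_def right_diff_distrib)
      then have "(\<Sum>k\<in>I. G k (i, j) * Q x s k) - (\<Sum>k\<in>I. g x i j k * Q x s k) = Q x s i * Q x s j / Q x s 0"
        by (intro eq_divide_imp[OF nz]) (simp only: mult.commute)
      then show ?thesis by (simp only: times_divide_eq_left times_divide_eq_right mult.commute)
    qed
    have 2: "(\<Sum>k\<in>I. G k (i, j) * Q x s k) = (\<Sum>t\<in>I. (c x s t * w t j) * P t i)" if i: "i \<in> I" for i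
    proof -
      have "(\<Sum>k\<in>I. G k (i, j) * Q x s k) = (\<Sum>k\<in>I. G k (i, j) * (\<Sum>t\<in>I. c x s t * P t k))"
        by (intro sum.cong refl) (simp only: Q_coordinates)
      also have "\<dots> = (\<Sum>t\<in>I. c x s t * (\<Sum>k\<in>I. G k (i, j) * P t k))"
        unfolding sum_distrib_left by (subst sum.swap) (simp only: mult_ac)
      also have "\<dots> = (\<Sum>t\<in>I. (c x s t * w t j) * P t i)"
        using i jst by (intro sum.cong refl) (simp only: eigen mult.assoc)
      finally show ?thesis .
    qed
    have 3: "(\<Sum>i\<in>I. \<rho> t i * (\<Sum>k\<in>I. g x i j k * Q x s k)) = - (\<Sum>t'\<in>I. h x j t t' * c x s t')"
    proof -
      have "(\<Sum>k\<in>I. g x i j k * Q x s k) = (\<Sum>t'\<in>I. c x s t' * (\<Sum>k\<in>I. g x i j k * P t' k))" for i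
      proof -
        have "(\<Sum>k\<in>I. g x i j k * Q x s k) = (\<Sum>k\<in>I. g x i j k * (\<Sum>t'\<in>I. c x s t' * P t' k))"
          by (intro sum.cong refl) (simp only: Q_coordinates)
        also have "\<dots> = (\<Sum>t'\<in>I. c x s t' * (\<Sum>k\<in>I. g x i j k * P t' k))" by (rule sum_swap_mult)
        finally show ?thesis .
      qed
      then have "(\<Sum>i\<in>I. \<rho> t i * (\<Sum>k\<in>I. g x i j k * Q x s k))
          = (\<Sum>i\<in>I. \<rho> t i * (\<Sum>t'\<in>I. c x s t' * (\<Sum>k\<in>I. g x i j k * P t' k)))"
        by (simp only:)
      also have "\<dots> = (\<Sum>t'\<in>I. c x s t' * (\<Sum>i\<in>I. \<rho> t i * (\<Sum>k\<in>I. g x i j k * P t' k)))"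
        by (rule sum_swap_mult)
      finally show ?thesis by (simp add: h_def sum_negf mult.commute)
    qed
    have "Q x s j / Q x s 0 * c x s t = (\<Sum>i\<in>I. \<rho> t i * (Q x s j / Q x s 0 * Q x s i))"
      by (simp only: c_def sum_distrib_left mult_ac)
    also have "\<dots> = (\<Sum>i\<in>I. \<rho> t i * ((\<Sum>k\<in>I. G k (i, j) * Q x s k) - (\<Sum>k\<in>I. g x i j k * Q x s k)))"
      by (simp only: 1)
    also have "\<dots> = (\<Sum>i\<in>I. \<rho> t i * (\<Sum>t\<in>I. (c x s t * w t j) * P t i)) + (\<Sum>t'\<in>I. h x j t t' * c x s t')"
      by (simp only: right_diff_distrib sum_subtractf 3) (simp add: 2)
    also have "\<dots> = w t j * c x s t + (\<Sum>t'\<in>I. h x j t t' * c x s t')"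
      using jst by (simp only: rho_contract mult.commute[of "c x s t"])
    finally show "w t j * c x s t + (\<Sum>t'\<in>I. h x j t t' * c x s t') = Q x s j / Q x s 0 * c x s t" ..
  qed
qed

lemma c_indep: "\<forall>\<^sub>F x in FF. lin_indep_on r I (c x)"
  using Q_nondegenerate
proof eventually_elim
  case (elim x)
  show ?case
    unfolding lin_indep_on_def
  proof (intro allI impI)
    fix a assume a: "\<forall>t\<in>I. (\<Sum>s\<in>I. a s * c x s t) = 0"
    have "(\<Sum>s\<in>I. a s * Q x s k) = 0" if k: "k \<in> I" for k
    proof -
      have "(\<Sum>s\<in>I. a s * Q x s k) = (\<Sum>s\<in>I. a s * (\<Sum>t\<in>I. c x s t * P t k))"
        using k by (simp only: Q_coordinates)
      also have "\<dots> = (\<Sum>t\<in>I. (\<Sum>s\<in>I. a s * c x s t) * P t k)"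
        unfolding sum_distrib_left sum_distrib_right by (subst sum.swap) (simp only: mult_ac)
      finally show ?thesis using a by simp
    qed
    then show "\<forall>s\<in>I. a s = 0" using elim unfolding lin_indep_on_def by blast
  qed
qed

end

section \<open>Matching of the components, and recovery of their directions and scales\<close>

context tensor_perturbation
begin

text \<open>The label of the dominant coordinate of \<open>Q x s\<close> in the basis
  \<open>P\<close>; it says which true component \<open>Q x s\<close> approximates.\<close>

definition "\<pi> x s = arg_min_on (\<lambda>t. - norm (c x s t)) I"
definition "lamQ x s = (\<Sum>j\<in>J. \<xi> j * (Q x s j / Q x s 0))"
definition "h\<xi> x t t' = (\<Sum>j\<in>J. \<xi> j * h x j t t')"

lemma pi_in: "s \<in> I \<Longrightarrow> \<pi> x s \<in> I"
  unfolding \<pi>_def by (rule arg_min_if_finite(1)) auto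

lemma pi_max: "s \<in> I \<Longrightarrow> t \<in> I \<Longrightarrow> norm (c x s t) \<le> norm (c x s (\<pi> x s))"
  using arg_min_least[of I t "\<lambda>t. - norm (c x s t)"] unfolding \<pi>_def by auto

lemma small_h\<xi>: "small (\<lambda>x. h\<xi> x t t')"
  unfolding h\<xi>_def by (intro small_sum small_mult_const small_h)

lemma eigen_\<xi>:
  "\<forall>\<^sub>F x in FF. \<forall>s\<in>I. \<forall>t\<in>I. lam t * c x s t + (\<Sum>t'\<in>I. h\<xi> x t t' * c x s t') = lamQ x s * c x s t"
  using eigen_Q
proof eventually_elim
  case (elim x)
  show ?case
  proof (intro ballI)
    fix s t assume st: "s \<in> I" "t \<in> I"
    have "(\<Sum>t'\<in>I. h\<xi> x t t' * c x s t') = (\<Sum>j\<in>J. \<xi> j * (\<Sum>t'\<in>I. h x j t t' * c x s t'))"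
      unfolding h\<xi>_def sum_distrib_left sum_distrib_right by (subst sum.swap) (simp only: mult_ac)
    then have "lam t * c x s t + (\<Sum>t'\<in>I. h\<xi> x t t' * c x s t')
        = (\<Sum>j\<in>J. \<xi> j * (w t j * c x s t + (\<Sum>t'\<in>I. h x j t t' * c x s t')))"
      by (simp only: lam_def sum_distrib_right distrib_left sum.distrib mult.assoc)
    also have "\<dots> = (\<Sum>j\<in>J. \<xi> j * (Q x s j / Q x s 0 * c x s t))"
      using elim st by (intro sum.cong refl) (simp only: ball_simps)
    finally show "lam t * c x s t + (\<Sum>t'\<in>I. h\<xi> x t t' * c x s t') = lamQ x s * c x s t"
      by (simp only: lamQ_def sum_distrib_right mult.assoc)
  qed
qed

lemma lam_inj: "inj_on lam I"
  using distinct_eigenvalues unfolding lam_def[abs_def] w_def .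

lemma pi_bij: "\<forall>\<^sub>F x in FF. bij_betw (\<pi> x) I I"
  by (rule perturbed_diagonal_eigenvectors_bij[OF lam_inj small_tendsto[OF small_h\<xi>] eigen_\<xi> c_indep pi_in pi_max])

text \<open>The inverse matching, from true components to perturbed ones. It is the identity off
  \<open>I\<close>, as \<open>permutes\<close> demands.\<close>

definition "\<sigma> x t = (if t \<in> I then inv_into I (\<pi> x) t else t)"

lemma sigma: "\<forall>\<^sub>F x in FF. \<sigma> x permutes I \<and> (\<forall>t\<in>I. \<sigma> x t \<in> I \<and> \<pi> x (\<sigma> x t) = t)"
  using pi_bij
proof eventually_elim
  case (elim x)
  have "bij_betw (\<sigma> x) I I"
    using bij_betw_inv_into[OF elim] by (rule bij_betw_cong[THEN iffD1, rotated]) (simp add: \<sigma>_def)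
  then have perm: "\<sigma> x permutes I" by (rule bij_imp_permutes) (simp only: \<sigma>_def if_False)
  have "\<pi> x (\<sigma> x t) = t" if "t \<in> I" for t
    using bij_betw_inv_into_right[OF elim that] that by (simp add: \<sigma>_def)
  moreover have "\<sigma> x t \<in> I" if "t \<in> I" for t
    using permutes_in_image[OF perm] that by simp
  ultimately show ?case using perm by blast
qed

text \<open>
  In the basis \<open>P\<close>, the eigenvector \<open>R t\<close> has dominant coordinate \<open>\<gamma> t\<close> at \<open>t\<close>, and \<open>\<kappa> t\<close> are its coordinates
  scaled to have a 1 there.
\<close>

definition "R x t m = Q x (\<sigma> x t) m"
definition "\<gamma> x t = c x (\<sigma> x t) t"
definition "\<kappa> x t t' = c x (\<sigma> x t) t' / \<gamma> x t"
definition "wR x t j = R x t j / R x t 0"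

lemma R_nonzero: "\<forall>\<^sub>F x in FF. \<forall>t\<in>I. R x t 0 \<noteq> 0"
  using sigma Q_nondegenerate by eventually_elim (simp add: R_def)

lemma gamma: "\<forall>\<^sub>F x in FF. \<forall>t\<in>I. \<gamma> x t \<noteq> 0 \<and> (\<forall>t'\<in>I. norm (c x (\<sigma> x t) t') \<le> norm (\<gamma> x t))"
  using sigma c_indep
proof eventually_elim
  case (elim x)
  show ?case
  proof
    fix t assume t: "t \<in> I"
    have *: "norm (c x (\<sigma> x t) t') \<le> norm (\<gamma> x t)" if "t' \<in> I" for t'
      using pi_max[of "\<sigma> x t" t' x] elim t that by (simp add: \<gamma>_def)
    obtain t' where "t' \<in> I" "c x (\<sigma> x t) t' \<noteq> 0"
      using lin_indep_on_nonzero[OF elim(2), of "\<sigma> x t"] elim t by blast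
    with * have "\<gamma> x t \<noteq> 0" by fastforce
    with * show "\<gamma> x t \<noteq> 0 \<and> (\<forall>t'\<in>I. norm (c x (\<sigma> x t) t') \<le> norm (\<gamma> x t))" by blast
  qed
qed

lemma kappa_diag: "t \<in> I \<Longrightarrow> \<forall>\<^sub>F x in FF. \<kappa> x t t = 1"
  using gamma by eventually_elim (simp add: \<kappa>_def \<gamma>_def)

text \<open>By maximality of the dominant coordinate. This normalization makes up for the missing
  bound on \<open>Q\<close>.\<close>

lemma bdd_kappa: "t \<in> I \<Longrightarrow> t' \<in> I \<Longrightarrow> bdd (\<lambda>x. \<kappa> x t t')"
proof (rule bddI[of _ 1])
  assume "t \<in> I" "t' \<in> I"
  then show "\<forall>\<^sub>F x in FF. norm (\<kappa> x t t') \<le> 1"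
    using gamma by (auto elim!: eventually_mono simp: \<kappa>_def norm_divide divide_le_eq_1)
qed

lemma eigen_R:
  "\<forall>\<^sub>F x in FF. \<forall>j\<in>J. \<forall>t\<in>I. \<forall>t'\<in>I.
     w t' j * \<kappa> x t t' + (\<Sum>t''\<in>I. h x j t' t'' * \<kappa> x t t'') = wR x t j * \<kappa> x t t'"
  using sigma eigen_Q
proof eventually_elim
  case (elim x)
  show ?case
  proof (intro ballI)
    fix j t t' assume *: "j \<in> J" "t \<in> I" "t' \<in> I"
    then have "w t' j * c x (\<sigma> x t) t' + (\<Sum>t''\<in>I. h x j t' t'' * c x (\<sigma> x t) t'') = wR x t j * c x (\<sigma> x t) t'"
      using elim by (simp add: wR_def R_def)
    then have "(w t' j * c x (\<sigma> x t) t' + (\<Sum>t''\<in>I. h x j t' t'' * c x (\<sigma> x t) t'')) / \<gamma> x t = wR x t j * c x (\<sigma> x t) t' / \<gamma> x t"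
      by (simp only:)
    then show "w t' j * \<kappa> x t t' + (\<Sum>t''\<in>I. h x j t' t'' * \<kappa> x t t'') = wR x t j * \<kappa> x t t'"
      by (simp add: \<kappa>_def add_divide_distrib sum_divide_distrib)
  qed
qed

lemma eigen_R\<xi>:
  "\<forall>\<^sub>F x in FF. \<forall>t\<in>I. \<forall>t'\<in>I.
     lam t' * \<kappa> x t t' + (\<Sum>t''\<in>I. h\<xi> x t' t'' * \<kappa> x t t'') = lamQ x (\<sigma> x t) * \<kappa> x t t'"
  using sigma eigen_\<xi>
proof eventually_elim
  case (elim x)
  show ?case
  proof (intro ballI)
    fix t t' assume *: "t \<in> I" "t' \<in> I"
    then have "lam t' * c x (\<sigma> x t) t' + (\<Sum>t''\<in>I. h\<xi> x t' t'' * c x (\<sigma> x t) t'') = lamQ x (\<sigma> x t) * c x (\<sigma> x t) t'"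
      using elim by simp
    then have "(lam t' * c x (\<sigma> x t) t' + (\<Sum>t''\<in>I. h\<xi> x t' t'' * c x (\<sigma> x t) t'')) / \<gamma> x t = lamQ x (\<sigma> x t) * c x (\<sigma> x t) t' / \<gamma> x t"
      by (simp only:)
    then show "lam t' * \<kappa> x t t' + (\<Sum>t''\<in>I. h\<xi> x t' t'' * \<kappa> x t t'') = lamQ x (\<sigma> x t) * \<kappa> x t t'"
      by (simp add: \<kappa>_def add_divide_distrib sum_divide_distrib)
  qed
qed

text \<open>In row \<open>t\<close> of the eigenvalue equation \<open>\<kappa> x t t\<close> is 1,
  so the difference of the eigenvalues is exactly \<open>h\<close> applied to the bounded vector
  \<open>\<kappa> x t\<close>.\<close>

lemma near_wR:
  assumes t: "t \<in> I" and j: "j \<in> J"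
  shows "small (\<lambda>x. wR x t j - w t j)"
proof (rule small_cong)
  show "small (\<lambda>x. \<Sum>t''\<in>I. h x j t t'' * \<kappa> x t t'')"
    using t j by (intro small_sum small_bdd_mult small_h bdd_kappa)
  show "\<forall>\<^sub>F x in FF. (\<Sum>t''\<in>I. h x j t t'' * \<kappa> x t t'') = wR x t j - w t j"
    using eigen_R kappa_diag[OF t]
  proof eventually_elim
    case (elim x)
    have "w t j * \<kappa> x t t + (\<Sum>t''\<in>I. h x j t t'' * \<kappa> x t t'') = wR x t j * \<kappa> x t t"
      using elim t j by blast
    then have "w t j + (\<Sum>t''\<in>I. h x j t t'' * \<kappa> x t t'') = wR x t j"
      by (simp only: elim(2) mult_1_right)
    then show ?case by (simp only: eq_diff_eq add.commute)
  qed
qed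

lemma near_lam: "t \<in> I \<Longrightarrow> small (\<lambda>x. lamQ x (\<sigma> x t) - lam t)"
proof -
  assume t: "t \<in> I"
  have "small (\<lambda>x. \<Sum>j\<in>J. \<xi> j * (wR x t j - w t j))"
    using t by (intro small_sum small_mult_const near_wR)
  then show ?thesis
    by (simp add: lamQ_def lam_def wR_def R_def right_diff_distrib sum_subtractf)
qed

text \<open>In a row \<open>t'\<close> other than \<open>t\<close>, the equation expresses
  \<open>(lam t' - lam t) * \<kappa> x t t'\<close> by an eigenvalue error and a perturbation term,
  both \<open>small\<close>. The gap is nonzero because the eigenvalues are distinct; only here and
  in the matching is the combination by \<open>\<xi>\<close> essential, since single
  \<open>N\<^sub>j\<close> may have repeated eigenvalues.\<close>

lemma near_kappa:
  assumes t: "t \<in> I" and t': "t' \<in> I"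
  shows "small (\<lambda>x. \<kappa> x t t' - (if t' = t then 1 else 0))"
proof (cases "t' = t")
  case True
  have "\<forall>\<^sub>F x in FF. 0 = \<kappa> x t t - 1" using kappa_diag[OF t] by eventually_elim simp
  from small_cong[OF small_zero this] True show ?thesis by simp
next
  case False
  have "small (\<lambda>x. inverse (lam t' - lam t) *
      ((lamQ x (\<sigma> x t) - lam t) * \<kappa> x t t' - (\<Sum>t''\<in>I. h\<xi> x t' t'' * \<kappa> x t t'')))"
    using t t' by (intro small_mult_const small_diff small_sum small_bdd_mult small_h\<xi> bdd_kappa near_lam)
  then have "small (\<lambda>x. \<kappa> x t t')"
  proof (rule small_cong)
    have aux: "(l - b) * k - S = (a - b) * k" if "a * k + S = l * k" for a b k l S :: complex
      unfolding left_diff_distrib that[symmetric] by simp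
    have ne: "lam t' - lam t \<noteq> 0" using False inj_onD[OF lam_inj _ t' t] by auto
    show "\<forall>\<^sub>F x in FF. inverse (lam t' - lam t) *
      ((lamQ x (\<sigma> x t) - lam t) * \<kappa> x t t' - (\<Sum>t''\<in>I. h\<xi> x t' t'' * \<kappa> x t t'')) = \<kappa> x t t'"
      using eigen_R\<xi>
    proof eventually_elim
      case (elim x)
      have "lam t' * \<kappa> x t t' + (\<Sum>t''\<in>I. h\<xi> x t' t'' * \<kappa> x t t'') = lamQ x (\<sigma> x t) * \<kappa> x t t'"
        using elim t t' by blast
      then have "(lamQ x (\<sigma> x t) - lam t) * \<kappa> x t t' - (\<Sum>t''\<in>I. h\<xi> x t' t'' * \<kappa> x t t'') = (lam t' - lam t) * \<kappa> x t t'"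
        by (rule aux)
      then show ?case using ne by (simp only:) simp
    qed
  qed
  with False show ?thesis by simp
qed

lemma R_coordinates:
  "\<forall>\<^sub>F x in FF. \<forall>t\<in>I. \<forall>k\<in>I. R x t k = \<gamma> x t * (\<Sum>t'\<in>I. \<kappa> x t t' * P t' k)"
  using gamma
proof eventually_elim
  case (elim x)
  show ?case
  proof (intro ballI)
    fix t k assume tk: "t \<in> I" "k \<in> I"
    then have "\<gamma> x t \<noteq> 0" using elim by blast
    then show "R x t k = \<gamma> x t * (\<Sum>t'\<in>I. \<kappa> x t t' * P t' k)"
      unfolding R_def Q_coordinates[OF tk(2)] sum_distrib_left by (intro sum.cong refl) (simp add: \<kappa>_def)
  qed
qed

lemma T_R: "\<forall>\<^sub>F x in FF. \<forall>i j k. T x i j k = (\<Sum>t\<in>I. R x t i * R x t j * R x t k)"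
  using sigma
proof eventually_elim
  case (elim x)
  then have perm: "\<sigma> x permutes I" by blast
  show ?case
  proof (intro allI)
    fix i j k
    show "T x i j k = (\<Sum>t\<in>I. R x t i * R x t j * R x t k)"
      using sum.permute[OF perm, of "\<lambda>s. Q x s i * Q x s j * Q x s k"] by (simp add: T_def R_def o_def)
  qed
qed

text \<open>The functional \<open>\<eta> j t\<close> on the tail of \<open>R x s\<close> scaled by
  \<open>R x s 0\<close>. Its limit is 0 for \<open>s\<close> other than \<open>t\<close> and
  \<open>inverse (P t 0)\<close> for \<open>s = t\<close>.\<close>

definition "K x j t s = (\<Sum>l\<in>J-{j}. \<eta> j t l * wR x s l)"

lemma near_K:
  assumes "j \<in> J" "t \<in> I" "s \<in> I"
  shows "small (\<lambda>x. K x j t s - (if s = t then 1 else 0) * inverse (P t 0))"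
proof -
  have "small (\<lambda>x. \<Sum>l\<in>J-{j}. \<eta> j t l * (wR x s l - w s l))"
    using assms by (intro small_sum small_mult_const near_wR) auto
  moreover have "(\<Sum>l\<in>J-{j}. \<eta> j t l * w s l) = (\<Sum>l\<in>J-{j}. \<eta> j t l * P s l) * inverse (P s 0)"
    by (simp only: w_def divide_inverse sum_distrib_right mult.assoc)
  then have "(\<Sum>l\<in>J-{j}. \<eta> j t l * w s l) = (if s = t then 1 else 0) * inverse (P t 0)"
    using eta[OF assms(1,3,2)] by simp
  ultimately show ?thesis
    by (simp only: K_def right_diff_distrib sum_subtractf)
qed

text \<open>
  Contracting the tensor entries \<open>(0, k, l)\<close> with both dual families leaves a linear system for the
  numbers \<open>R\<^sub>t\<^sub>0\<^sup>2 \<gamma>\<^sub>t\<close> whose matrix is close to the identity. For \<open>R\<^sub>t\<^sub>0\<^sup>3\<close> the entries \<open>(0, j, l)\<close> with \<open>j \<noteq> l\<close>, both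
  above \<open>r\<close>, play this role.
\<close>

lemma near_R0_sq:
  assumes t: "t \<in> I"
  shows "small (\<lambda>x. (R x t 0)\<^sup>2 * \<gamma> x t - (P t 0)\<^sup>2)"
proof -
  let ?j = "r + 1"
  have j: "?j \<in> J" using r_less by simp
  show ?thesis
  proof (rule near_linear_system[OF _ t, where z = "\<lambda>x t. (R x t 0)\<^sup>2 * \<gamma> x t"
        and M = "\<lambda>x t s. P t 0 * (\<kappa> x s t * K x ?j t s)"])
    fix t s assume ts: "t \<in> I" "s \<in> I"
    \<comment> \<open>Both factors have Kronecker limits; the leading \<open>P t 0\<close> cancels
      the limit of \<open>K\<close> on the diagonal.\<close>
    have "small (\<lambda>x. P t 0 * (\<kappa> x s t * K x ?j t s - (if t = s then 1 else 0) * ((if s = t then 1 else 0) * inverse (P t 0))))"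
      by (intro small_mult_const near_mult near_kappa near_K ts j)
    then show "small (\<lambda>x. P t 0 * (\<kappa> x s t * K x ?j t s) - (if s = t then 1 else 0))"
      using P0[OF ts(1)] by (cases "s = t") (simp_all add: right_diff_distrib)
  next
    fix t assume t: "t \<in> I"
    have "small (\<lambda>x. P t 0 * (\<Sum>l\<in>J-{?j}. \<eta> ?j t l * (\<Sum>k\<in>I. \<rho> t k * (T x 0 k l - T0 0 k l))))"
      by (intro small_mult_const small_sum close_T) auto
    then show "small (\<lambda>x. (\<Sum>s\<in>I. P t 0 * (\<kappa> x s t * K x ?j t s) * ((R x s 0)\<^sup>2 * \<gamma> x s)) - (P t 0)\<^sup>2)"
    proof (rule small_cong)
      show "\<forall>\<^sub>F x in FF. P t 0 * (\<Sum>l\<in>J-{?j}. \<eta> ?j t l * (\<Sum>k\<in>I. \<rho> t k * (T x 0 k l - T0 0 k l))) =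
          (\<Sum>s\<in>I. P t 0 * (\<kappa> x s t * K x ?j t s) * ((R x s 0)\<^sup>2 * \<gamma> x s)) - (P t 0)\<^sup>2"
        using T_R R_coordinates R_nonzero
      proof eventually_elim
        case (elim x)
        have 1: "(\<Sum>k\<in>I. \<rho> t k * T0 0 k l) = P t 0 * P t l" for l
        proof -
          have "T0 0 k l = (\<Sum>s\<in>I. (P s 0 * P s l) * P s k)" for k
            by (simp only: T0_def mult_ac)
          then show ?thesis using t by (simp only: rho_contract)
        qed
        have 2: "(\<Sum>l\<in>J-{?j}. \<eta> ?j t l * (P t 0 * P t l)) = P t 0"
        proof -
          have "(\<Sum>l\<in>J-{?j}. \<eta> ?j t l * (P t 0 * P t l)) = P t 0 * (\<Sum>l\<in>J-{?j}. \<eta> ?j t l * P t l)"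
            by (simp only: sum_distrib_left mult_ac)
          then show ?thesis using eta[OF j t t] by simp
        qed
        have 3: "(\<Sum>k\<in>I. \<rho> t k * T x 0 k l) = (\<Sum>s\<in>I. (\<kappa> x s t * ((R x s 0)\<^sup>2 * \<gamma> x s)) * wR x s l)" for l
        proof -
          have "T x 0 k l = (\<Sum>s\<in>I. ((R x s 0)\<^sup>2 * \<gamma> x s * wR x s l) * (\<Sum>t'\<in>I. \<kappa> x s t' * P t' k))" if "k \<in> I" for k
          proof -
            have "T x 0 k l = (\<Sum>t\<in>I. R x t 0 * R x t k * R x t l)" using elim(1) by blast
            also have "\<dots> = (\<Sum>s\<in>I. ((R x s 0)\<^sup>2 * \<gamma> x s * wR x s l) * (\<Sum>t'\<in>I. \<kappa> x s t' * P t' k))"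
            proof (intro sum.cong refl)
              fix s assume s: "s \<in> I"
              have "R x s k = \<gamma> x s * (\<Sum>t'\<in>I. \<kappa> x s t' * P t' k)" using elim(2) s that by blast
              moreover have "R x s l = R x s 0 * wR x s l" using elim(3) s by (simp add: wR_def)
              ultimately show "R x s 0 * R x s k * R x s l
                  = ((R x s 0)\<^sup>2 * \<gamma> x s * wR x s l) * (\<Sum>t'\<in>I. \<kappa> x s t' * P t' k)"
                by (simp only: power2_eq_square mult_ac)
            qed
            finally show ?thesis .
          qed
          then have "(\<Sum>k\<in>I. \<rho> t k * T x 0 k l)
              = (\<Sum>k\<in>I. \<rho> t k * (\<Sum>s\<in>I. ((R x s 0)\<^sup>2 * \<gamma> x s * wR x s l) * (\<Sum>t'\<in>I. \<kappa> x s t' * P t' k)))"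
            by (intro sum.cong refl) (simp only:)
          also have "\<dots> = (\<Sum>s\<in>I. ((R x s 0)\<^sup>2 * \<gamma> x s * wR x s l) * (\<Sum>k\<in>I. \<rho> t k * (\<Sum>t'\<in>I. \<kappa> x s t' * P t' k)))"
            by (rule sum_swap_mult)
          also have "\<dots> = (\<Sum>s\<in>I. ((R x s 0)\<^sup>2 * \<gamma> x s * wR x s l) * \<kappa> x s t)"
            using t by (simp only: rho_contract)
          finally show ?thesis by (simp only: mult_ac)
        qed
        have 4: "(\<Sum>l\<in>J-{?j}. \<eta> ?j t l * (\<Sum>s\<in>I. (\<kappa> x s t * ((R x s 0)\<^sup>2 * \<gamma> x s)) * wR x s l))
            = (\<Sum>s\<in>I. (\<kappa> x s t * ((R x s 0)\<^sup>2 * \<gamma> x s)) * K x ?j t s)"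
          unfolding K_def by (rule sum_swap_mult)
        have "P t 0 * (\<Sum>l\<in>J-{?j}. \<eta> ?j t l * (\<Sum>k\<in>I. \<rho> t k * (T x 0 k l - T0 0 k l)))
            = P t 0 * (\<Sum>s\<in>I. (\<kappa> x s t * ((R x s 0)\<^sup>2 * \<gamma> x s)) * K x ?j t s) - P t 0 * P t 0"
          by (simp only: right_diff_distrib sum_subtractf 1 2 3 4)
        then show ?case by (simp only: sum_distrib_left power2_eq_square mult_ac)
      qed
    qed
  qed simp
qed

text \<open>Entries with two tail labels are free of \<open>\<gamma>\<close>, since the tail is
  \<open>R x s 0\<close> times a known ratio. Contracting one tail label with \<open>\<eta>\<close>
  already separates the components.\<close>

lemma near_R0_cube:
  assumes t: "t \<in> I"
  shows "small (\<lambda>x. R x t 0 ^ 3 - P t 0 ^ 3)"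
proof -
  \<comment> \<open>A tail label at which component \<open>t\<close> does not vanish. It must depend
    on \<open>t\<close>, so each row of the linear system comes from its own slice of the
    tensor.\<close>
  define J' where "J' t = (SOME j. j \<in> J \<and> P t j \<noteq> 0)" for t
  have J': "J' t \<in> J \<and> P t (J' t) \<noteq> 0" if "t \<in> I" for t
  proof -
    have j: "r + 1 \<in> J" using r_less by simp
    have "\<exists>j\<in>J-{r+1}. P t j \<noteq> 0" by (rule lin_indep_on_nonzero[OF indep_tail[OF j] that])
    then have "\<exists>j. j \<in> J \<and> P t j \<noteq> 0" by blast
    then show ?thesis unfolding J'_def by (rule someI_ex)
  qed
  \<comment> \<open>The normalization that makes the diagonal tend to 1: the factors have the limits
    \<open>P t (J' t) / P t 0\<close> and \<open>inverse (P t 0)\<close>.\<close>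
  let ?f = "\<lambda>t. (P t 0)\<^sup>2 * inverse (P t (J' t))"
  show ?thesis
  proof (rule near_linear_system[OF _ t, where z = "\<lambda>x t. R x t 0 ^ 3"
        and M = "\<lambda>x t s. ?f t * (wR x s (J' t) * K x (J' t) t s)"])
    fix t s assume ts: "t \<in> I" "s \<in> I"
    have "small (\<lambda>x. ?f t * (wR x s (J' t) * K x (J' t) t s - w s (J' t) * ((if s = t then 1 else 0) * inverse (P t 0))))"
      using ts J'[OF ts(1)] by (intro small_mult_const near_mult near_wR near_K) auto
    moreover have "?f t * (w s (J' t) * ((if s = t then 1 else 0) * inverse (P t 0))) = (if s = t then 1 else 0)"
      using P0[OF ts(1)] J'[OF ts(1)] by (simp add: w_def power2_eq_square field_simps)
    ultimately show "small (\<lambda>x. ?f t * (wR x s (J' t) * K x (J' t) t s) - (if s = t then 1 else 0))"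
      by (simp only: right_diff_distrib)
  next
    fix t assume t: "t \<in> I"
    let ?j = "J' t"
    have j: "?j \<in> J" and nz: "P t ?j \<noteq> 0" using J'[OF t] by auto
    have "small (\<lambda>x. ?f t * (\<Sum>l\<in>J-{?j}. \<eta> ?j t l * (T x 0 ?j l - T0 0 ?j l)))"
      using j by (intro small_mult_const small_sum close_T) auto
    then show "small (\<lambda>x. (\<Sum>s\<in>I. ?f t * (wR x s ?j * K x ?j t s) * R x s 0 ^ 3) - P t 0 ^ 3)"
    proof (rule small_cong)
      show "\<forall>\<^sub>F x in FF. ?f t * (\<Sum>l\<in>J-{?j}. \<eta> ?j t l * (T x 0 ?j l - T0 0 ?j l)) =
          (\<Sum>s\<in>I. ?f t * (wR x s ?j * K x ?j t s) * R x s 0 ^ 3) - P t 0 ^ 3"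
        using T_R R_nonzero
      proof eventually_elim
        case (elim x)
        have 1: "(\<Sum>l\<in>J-{?j}. \<eta> ?j t l * T0 0 ?j l) = P t 0 * P t ?j"
          using j t unfolding T0_def by (simp only: eta_contract)
        have 2: "T x 0 ?j l = (\<Sum>s\<in>I. (R x s 0 ^ 3 * wR x s ?j) * wR x s l)" for l
        proof -
          have "T x 0 ?j l = (\<Sum>t\<in>I. R x t 0 * R x t ?j * R x t l)" using elim(1) by blast
          also have "\<dots> = (\<Sum>s\<in>I. (R x s 0 ^ 3 * wR x s ?j) * wR x s l)"
          proof (intro sum.cong refl)
            fix s assume "s \<in> I"
            then have "R x s 0 \<noteq> 0" using elim(2) by blast
            then have *: "R x s m = R x s 0 * wR x s m" for m by (simp add: wR_def)
            show "R x s 0 * R x s ?j * R x s l = (R x s 0 ^ 3 * wR x s ?j) * wR x s l"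
              unfolding *[of ?j] *[of l] by (simp only: power3_eq_cube mult_ac)
          qed
          finally show ?thesis .
        qed
        have 3: "(\<Sum>l\<in>J-{?j}. \<eta> ?j t l * T x 0 ?j l) = (\<Sum>s\<in>I. (R x s 0 ^ 3 * wR x s ?j) * K x ?j t s)"
          unfolding K_def 2 by (rule sum_swap_mult)
        have 4: "?f t * (P t 0 * P t ?j) = P t 0 ^ 3"
          using nz by (simp add: power2_eq_square power3_eq_cube)
        have "?f t * (\<Sum>l\<in>J-{?j}. \<eta> ?j t l * (T x 0 ?j l - T0 0 ?j l))
            = ?f t * (\<Sum>s\<in>I. (R x s 0 ^ 3 * wR x s ?j) * K x ?j t s) - P t 0 ^ 3"
          by (simp only: right_diff_distrib sum_subtractf 1 3 4)
        then show ?case by (simp only: sum_distrib_left mult_ac)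
      qed
    qed
  qed simp
qed

text \<open>The cube of \<open>R x t 0\<close> fixes it up to a cube root of unity
  \<open>\<tau>\<close>. The same root serves the whole vector: comparison with
  \<open>(R x t 0)\<^sup>2 * \<gamma> x t\<close> gives \<open>\<tau> x * \<gamma> x t\<close> near
  1, which settles the head, and the ratios \<open>wR\<close> settle the tail.\<close>

theorem recovery:
  obtains \<sigma> \<tau> where "\<forall>\<^sub>F x in FF. \<sigma> x permutes {1..r}"
    and "\<And>x t. t \<in> {1..r} \<Longrightarrow> \<tau> x t ^ 3 = (1::complex)"
    and "\<And>t m. t \<in> {1..r} \<Longrightarrow> m \<le> n \<Longrightarrow> small (\<lambda>x. \<tau> x t * Q x (\<sigma> x t) m - P t m)"
proof -
  have "\<exists>\<tau>. (\<forall>x. \<tau> x ^ 3 = 1) \<and> (\<forall>m\<le>n. small (\<lambda>x. \<tau> x * R x t m - P t m))" if t: "t \<in> I" for t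
  proof -
    obtain \<tau> where \<tau>: "\<And>x. \<tau> x ^ 3 = 1" and y: "small (\<lambda>x. \<tau> x * R x t 0 - P t 0)"
      by (rule near_cube_root[OF near_R0_cube[OF t] P0[OF t]]) blast
    let ?y = "\<lambda>x. \<tau> x * R x t 0"
    have y2: "small (\<lambda>x. ?y x * ?y x - P t 0 * P t 0)" by (rule near_mult[OF y y])
    \<comment> \<open>As \<open>\<tau> x ^ 3 = 1\<close>, the known quantity
      \<open>(R x t 0)\<^sup>2 * \<gamma> x t\<close> equals the square of
      \<open>\<tau> x * R x t 0\<close> times \<open>\<tau> x * \<gamma> x t\<close>.\<close>
    have "small (\<lambda>x. ((R x t 0)\<^sup>2 * \<gamma> x t - (P t 0)\<^sup>2) - (?y x * ?y x - P t 0 * P t 0))"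
      by (intro small_diff near_R0_sq t y2)
    moreover have "((R x t 0)\<^sup>2 * \<gamma> x t - (P t 0)\<^sup>2) - (?y x * ?y x - P t 0 * P t 0)
        = (?y x * ?y x) * (\<tau> x * \<gamma> x t - 1)" for x
    proof -
      have "(?y x * ?y x) * (\<tau> x * \<gamma> x t) = \<tau> x ^ 3 * ((R x t 0)\<^sup>2 * \<gamma> x t)"
        by (simp only: power2_eq_square power3_eq_cube mult_ac)
      then show ?thesis by (simp add: \<tau> right_diff_distrib power2_eq_square)
    qed
    ultimately have "small (\<lambda>x. (?y x * ?y x) * (\<tau> x * \<gamma> x t - 1))" by (simp only:)
    then have \<gamma>1: "small (\<lambda>x. \<tau> x * \<gamma> x t - 1)"
      by (rule near_divide_cancel[OF _ y2]) (use P0[OF t] in simp)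
    have "small (\<lambda>x. \<tau> x * R x t m - P t m)" if m: "m \<le> n" for m
    proof -
      consider "m = 0" | "m \<in> I" | "m \<in> J" using m by fastforce
      then show ?thesis
      proof cases
        case 1 then show ?thesis using y by simp
      next
        case 2
        have "small (\<lambda>x. (\<tau> x * \<gamma> x t) * (\<Sum>t'\<in>I. \<kappa> x t t' * P t' m)
            - 1 * (\<Sum>t'\<in>I. (if t' = t then 1 else 0) * P t' m))"
          using t by (intro near_mult[OF \<gamma>1] near_sum near_mult near_kappa near_const)
        then have "small (\<lambda>x. (\<tau> x * \<gamma> x t) * (\<Sum>t'\<in>I. \<kappa> x t t' * P t' m) - P t m)"
          using t by (simp only: sum_kron finite_atLeastAtMost mult_1_left)
        then show ?thesis
        proof (rule small_cong)
          show "\<forall>\<^sub>F x in FF. (\<tau> x * \<gamma> x t) * (\<Sum>t'\<in>I. \<kappa> x t t' * P t' m) - P t m = \<tau> x * R x t m - P t m"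
            using R_coordinates by eventually_elim (use t 2 in \<open>simp add: mult.assoc\<close>)
        qed
      next
        case 3
        have "small (\<lambda>x. ?y x * wR x t m - P t 0 * w t m)"
          by (intro near_mult[OF y] near_wR t 3)
        then show ?thesis
        proof (rule small_cong)
          show "\<forall>\<^sub>F x in FF. ?y x * wR x t m - P t 0 * w t m = \<tau> x * R x t m - P t m"
            using R_nonzero by eventually_elim (use t P0[OF t] in \<open>simp add: wR_def w_def\<close>)
        qed
      qed
    qed
    with \<tau> show ?thesis by blast
  qed
  then obtain \<tau> where \<tau>: "\<And>t. t \<in> I \<Longrightarrow> (\<forall>x. \<tau> t x ^ 3 = 1) \<and> (\<forall>m\<le>n. small (\<lambda>x. \<tau> t x * R x t m - P t m))"
    by metis
  show ?thesis
  proof (rule that[of \<sigma> "\<lambda>x t. \<tau> t x"])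
    show "\<forall>\<^sub>F x in FF. \<sigma> x permutes {1..r}"
      using sigma by eventually_elim blast
    show "\<tau> t x ^ 3 = 1" if "t \<in> I" for x t
      using \<tau>[OF that] by blast
    show "small (\<lambda>x. \<tau> t x * Q x (\<sigma> x t) m - P t m)" if "t \<in> I" "m \<le> n" for t m
      using \<tau>[OF that(1)] that(2) unfolding R_def by blast
  qed
qed

end

section \<open>Moments of diagonal Gaussian mixtures\<close>

lemma measurable_affine_std_normal:
  "(\<lambda>z. m + s * z) \<in> density lborel (\<lambda>x. ennreal (std_normal_density x)) \<rightarrow>\<^sub>M borel"
  by simp

lemma prob_space_normal_law: "prob_space (normal_law m s)"
  unfolding normal_law_def
  by (rule prob_space.prob_space_distr[OF prob_space_normal_density measurable_affine_std_normal]) simp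

lemma sets_normal_law: "sets (normal_law m s) = sets borel"
  by (simp add: normal_law_def)

definition normal_moment :: "real \<Rightarrow> real \<Rightarrow> nat \<Rightarrow> real" where
  "normal_moment m s k = [1, m, m\<^sup>2 + s\<^sup>2, m ^ 3 + 3 * m * s\<^sup>2] ! k"

lemma std_normal_power:
  assumes "k \<le> 3"
  shows "has_bochner_integral (density lborel (\<lambda>x. ennreal (std_normal_density x))) (\<lambda>x. x ^ k) ([1, 0, 1, 0] ! k :: real)"
proof -
  have "has_bochner_integral lborel (\<lambda>x. std_normal_density x * x ^ k) ([1, 0, 1, 0] ! k :: real)"
  proof -
    consider "k = 2 * 0" | "k = 2 * 0 + 1" | "k = 2 * 1" | "k = 2 * 1 + 1" using assms by linarith
    then show ?thesis
    proof cases
      case 1 show ?thesis unfolding 1 using std_normal_moment_even[of 0] by simp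
    next
      case 2 show ?thesis unfolding 2 using std_normal_moment_odd[of 0] by simp
    next
      case 3 show ?thesis unfolding 3 using std_normal_moment_even[of 1] by simp
    next
      case 4 show ?thesis unfolding 4 using std_normal_moment_odd[of 1] by simp
    qed
  qed
  then show ?thesis
    by (simp add: has_bochner_integral_iff integrable_density integral_density)
qed

lemma normal_law_power:
  assumes "k \<le> 3"
  shows "has_bochner_integral (normal_law m s) (\<lambda>x. x ^ k) (normal_moment m s k)"
proof -
  let ?N = "density lborel (\<lambda>x. ennreal (std_normal_density x))"
  have p: "has_bochner_integral ?N (\<lambda>x. c * x ^ k) (c * ([1, 0, 1, 0] ! k))" if "k \<le> 3" for c k
    by (intro has_bochner_integral_mult_right std_normal_power that)
  have "has_bochner_integral ?N (\<lambda>x. (m + s * x) ^ k) (normal_moment m s k)"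
  proof -
    consider "k = 0" | "k = 1" | "k = 2" | "k = 3" using assms by linarith
    then show ?thesis
    proof cases
      case 1
      have "has_bochner_integral ?N (\<lambda>x. 1 * x ^ 0) (1 * ([1, 0, 1, 0] ! 0))" by (rule p) simp
      then show ?thesis by (simp add: 1 normal_moment_def)
    next
      case 2
      have "has_bochner_integral ?N (\<lambda>x. m * x ^ 0 + s * x ^ 1) (m * ([1, 0, 1, 0] ! 0) + s * ([1, 0, 1, 0] ! 1))"
        by (intro has_bochner_integral_add p) simp_all
      then show ?thesis by (simp add: 2 normal_moment_def)
    next
      case 3
      have "has_bochner_integral ?N (\<lambda>x. m\<^sup>2 * x ^ 0 + (2 * m * s) * x ^ 1 + s\<^sup>2 * x ^ 2)
          (m\<^sup>2 * ([1, 0, 1, 0] ! 0) + (2 * m * s) * ([1, 0, 1, 0] ! 1) + s\<^sup>2 * ([1, 0, 1, 0] ! 2))"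
        by (intro has_bochner_integral_add p) simp_all
      moreover have "(m + s * x)\<^sup>2 = m\<^sup>2 * x ^ 0 + (2 * m * s) * x ^ 1 + s\<^sup>2 * x ^ 2" for x
        by (simp add: power2_eq_square algebra_simps)
      ultimately show ?thesis by (simp add: 3 normal_moment_def)
    next
      case 4
      have "has_bochner_integral ?N (\<lambda>x. m ^ 3 * x ^ 0 + (3 * m\<^sup>2 * s) * x ^ 1 + (3 * m * s\<^sup>2) * x ^ 2 + s ^ 3 * x ^ 3)
          (m ^ 3 * ([1, 0, 1, 0] ! 0) + (3 * m\<^sup>2 * s) * ([1, 0, 1, 0] ! 1) + (3 * m * s\<^sup>2) * ([1, 0, 1, 0] ! 2)
            + s ^ 3 * ([1, 0, 1, 0] ! 3))"
        by (intro has_bochner_integral_add p) simp_all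
      moreover have "(m + s * x) ^ 3 = m ^ 3 * x ^ 0 + (3 * m\<^sup>2 * s) * x ^ 1 + (3 * m * s\<^sup>2) * x ^ 2 + s ^ 3 * x ^ 3" for x
        by (simp add: power2_eq_square power3_eq_cube algebra_simps)
      ultimately show ?thesis by (simp add: 4 normal_moment_def)
    qed
  qed
  then show ?thesis
    unfolding normal_law_def has_bochner_integral_iff
    by (simp add: integrable_distr_eq[OF measurable_affine_std_normal] integral_distr[OF measurable_affine_std_normal])
qed

lemma diag_gaussian_monomial:
  assumes k: "\<And>j. j \<in> {1..d} \<Longrightarrow> k j \<le> 3"
  shows "has_bochner_integral (diag_gaussian d m s) (\<lambda>y. \<Prod>j=1..d. y j ^ k j) (\<Prod>j=1..d. normal_moment (m j) (s j) (k j))"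
proof -
  interpret product_prob_space "\<lambda>j. normal_law (m j) (s j)"
    by (intro product_prob_spaceI prob_space_normal_law)
  have "integrable (normal_law (m j) (s j)) (\<lambda>x. x ^ k j)" if "j \<in> {1..d}" for j
    using normal_law_power[OF k[OF that]] by (simp add: has_bochner_integral_iff)
  moreover have "(\<Prod>j=1..d. \<integral>x. x ^ k j \<partial>normal_law (m j) (s j)) = (\<Prod>j=1..d. normal_moment (m j) (s j) (k j))"
    using normal_law_power[OF k] by (intro prod.cong refl) (simp add: has_bochner_integral_iff)
  ultimately show ?thesis
    unfolding diag_gaussian_def has_bochner_integral_iff
    using product_integrable_prod[of "{1..d}" "\<lambda>j x. x ^ k j"] product_integral_prod[of "{1..d}" "\<lambda>j x. x ^ k j"]
    by simp
qed

text \<open>The mixture is a monadic bind, whose integral formula is applied to nonnegative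
  integrals; positive and negative parts are therefore treated apart and subtracted at the
  end.\<close>

lemma gaussian_mixture_integral:
  assumes \<omega>: "\<And>i. i \<in> {1..r} \<Longrightarrow> 0 \<le> \<omega> i" and r: "r \<ge> 1"
    and f: "\<And>i. i \<in> {1..r} \<Longrightarrow> has_bochner_integral (diag_gaussian d (\<mu> i) (\<sigma> i)) f (v i)"
  shows "(\<integral>y. f y \<partial>gaussian_mixture d r \<omega> \<mu> \<sigma>) = (\<Sum>i=1..r. \<omega> i * (v i :: real))"
proof -
  define B where "B = (\<Pi>\<^sub>M j\<in>{1..d}. borel :: real measure)"
  let ?M = "point_measure {1..r} (\<lambda>i. ennreal (\<omega> i))"
  let ?N = "\<lambda>i. diag_gaussian d (\<mu> i) (\<sigma> i)"
  have sets_N: "sets (?N i) = sets B" for i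
    unfolding diag_gaussian_def B_def by (intro sets_PiM_cong refl sets_normal_law)
  have prob_N: "prob_space (?N i)" for i
    unfolding diag_gaussian_def by (intro prob_space_PiM prob_space_normal_law)
  have N: "?N \<in> ?M \<rightarrow>\<^sub>M subprob_algebra B"
    using sets_N prob_space_imp_subprob_space[OF prob_N] by (auto simp: space_subprob_algebra)
  have "f \<in> borel_measurable (?N 1)" using f[of 1] r by (auto simp: has_bochner_integral_iff)
  then have fB: "f \<in> borel_measurable B"
    by (simp add: measurable_cong_sets[OF sets_N refl])
  have int: "integrable (?N i) f" "integral\<^sup>L (?N i) f = v i" if "i \<in> {1..r}" for i
    using f[OF that] by (auto simp: has_bochner_integral_iff)
  \<comment> \<open>\<open>ennreal\<close> sends negative reals to 0, so \<open>p\<close> and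
    \<open>q\<close> are the integrals of the positive and the negative part.\<close>
  have "\<exists>p q. 0 \<le> p \<and> 0 \<le> q \<and> (\<integral>\<^sup>+x. ennreal (f x) \<partial>?N i) = ennreal p \<and>
      (\<integral>\<^sup>+x. ennreal (- f x) \<partial>?N i) = ennreal q \<and> v i = p - q" if "i \<in> {1..r}" for i
  proof (rule integrableE[OF int(1)[OF that]])
    fix p q assume "0 \<le> p" "0 \<le> q" "(\<integral>\<^sup>+x. ennreal (f x) \<partial>?N i) = ennreal p"
      "(\<integral>\<^sup>+x. ennreal (- f x) \<partial>?N i) = ennreal q" "integral\<^sup>L (?N i) f = p - q"
    with int(2)[OF that] show ?thesis by (intro exI[of _ p] exI[of _ q]) simp
  qed
  then obtain p q where pq: "\<And>i. i \<in> {1..r} \<Longrightarrow> 0 \<le> p i \<and> 0 \<le> q i \<and> (\<integral>\<^sup>+x. ennreal (f x) \<partial>?N i) = ennreal (p i) \<and>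
      (\<integral>\<^sup>+x. ennreal (- f x) \<partial>?N i) = ennreal (q i) \<and> v i = p i - q i"
    by metis
  have nn: "(\<integral>\<^sup>+x. ennreal (g x) \<partial>gaussian_mixture d r \<omega> \<mu> \<sigma>) = ennreal (\<Sum>i=1..r. \<omega> i * u i)"
    if g: "g \<in> borel_measurable B" and u: "\<And>i. i \<in> {1..r} \<Longrightarrow> 0 \<le> u i \<and> (\<integral>\<^sup>+x. ennreal (g x) \<partial>?N i) = ennreal (u i)"
    for g u
  proof -
    have "(\<integral>\<^sup>+x. ennreal (g x) \<partial>gaussian_mixture d r \<omega> \<mu> \<sigma>) = (\<integral>\<^sup>+i. (\<integral>\<^sup>+x. ennreal (g x) \<partial>?N i) \<partial>?M)"
      unfolding gaussian_mixture_def using g by (intro nn_integral_bind[OF _ N]) simp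
    also have "\<dots> = (\<Sum>i=1..r. ennreal (\<omega> i) * (\<integral>\<^sup>+x. ennreal (g x) \<partial>?N i))"
      by (rule nn_integral_point_measure_finite) simp
    also have "\<dots> = (\<Sum>i=1..r. ennreal (\<omega> i * u i))"
      using u \<omega> by (intro sum.cong refl) (simp add: ennreal_mult)
    also have "\<dots> = ennreal (\<Sum>i=1..r. \<omega> i * u i)"
      using u \<omega> by (intro sum_ennreal) simp
    finally show ?thesis .
  qed
  have sets_mix: "sets (gaussian_mixture d r \<omega> \<mu> \<sigma>) = sets B"
    unfolding gaussian_mixture_def using r by (intro sets_bind sets_N) (simp add: space_point_measure)
  have P: "(\<integral>\<^sup>+x. ennreal (f x) \<partial>gaussian_mixture d r \<omega> \<mu> \<sigma>) = ennreal (\<Sum>i=1..r. \<omega> i * p i)"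
    by (rule nn[OF fB]) (use pq in blast)
  have Q: "(\<integral>\<^sup>+x. ennreal (- f x) \<partial>gaussian_mixture d r \<omega> \<mu> \<sigma>) = ennreal (\<Sum>i=1..r. \<omega> i * q i)"
    by (rule nn) (use fB pq in \<open>auto\<close>)
  have "f \<in> borel_measurable (gaussian_mixture d r \<omega> \<mu> \<sigma>)"
    using fB by (simp add: measurable_cong_sets[OF sets_mix refl])
  then have int_mix: "integrable (gaussian_mixture d r \<omega> \<mu> \<sigma>) f"
    unfolding real_integrable_def P Q by simp
  have nn_p: "0 \<le> (\<Sum>i=1..r. \<omega> i * p i)" and nn_q: "0 \<le> (\<Sum>i=1..r. \<omega> i * q i)"
    using pq \<omega> by (auto intro!: sum_nonneg mult_nonneg_nonneg)
  from real_lebesgue_integral_def[OF int_mix]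
  have "(\<integral>y. f y \<partial>gaussian_mixture d r \<omega> \<mu> \<sigma>) = (\<Sum>i=1..r. \<omega> i * p i) - (\<Sum>i=1..r. \<omega> i * q i)"
    unfolding P Q by (simp only: enn2real_ennreal nn_p nn_q)
  also have "\<dots> = (\<Sum>i=1..r. \<omega> i * (p i - q i))"
    by (simp add: right_diff_distrib sum_subtractf)
  also have "\<dots> = (\<Sum>i=1..r. \<omega> i * v i)"
    using pq by (intro sum.cong refl) simp
  finally show ?thesis .
qed

lemma prod_of_bool_power:
  fixes y :: "nat \<Rightarrow> 'a::comm_monoid_mult"
  assumes "a \<in> {1..d}"
  shows "(\<Prod>j=1..d. y j ^ of_bool (j = a)) = y a"
proof -
  have "(\<Prod>j=1..d. y j ^ of_bool (j = a)) = (\<Prod>j=1..d. if j = a then y j else 1)"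
    by (intro prod.cong) auto
  with assms show ?thesis by simp
qed

lemma moment1_gaussian_mixture:
  assumes "\<And>i. i \<in> {1..r} \<Longrightarrow> 0 \<le> \<omega> i" "r \<ge> 1" "a \<in> {1..d}"
  shows "moment1 (gaussian_mixture d r \<omega> \<mu> \<sigma>) a = (\<Sum>i=1..r. \<omega> i * \<mu> i a)"
  unfolding moment1_def
proof (rule gaussian_mixture_integral[OF assms(1,2)])
  fix i
  have "has_bochner_integral (diag_gaussian d (\<mu> i) (\<sigma> i)) (\<lambda>y. \<Prod>j=1..d. y j ^ of_bool (j = a))
      (\<Prod>j=1..d. normal_moment (\<mu> i j) (\<sigma> i j) (of_bool (j = a)))"
    by (rule diag_gaussian_monomial) simp
  moreover have "(\<Prod>j=1..d. normal_moment (\<mu> i j) (\<sigma> i j) (of_bool (j = a))) = (\<Prod>j=1..d. \<mu> i j ^ of_bool (j = a))"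
    by (intro prod.cong refl) (simp add: normal_moment_def)
  ultimately show "has_bochner_integral (diag_gaussian d (\<mu> i) (\<sigma> i)) (\<lambda>y. y a) (\<mu> i a)"
    using assms(3) by (simp add: prod_of_bool_power)
qed simp_all

text \<open>The exponent \<open>k j\<close> counts how often the label \<open>j\<close> occurs among
  \<open>a\<close>, \<open>b\<close>, \<open>c\<close>, so coinciding labels need no case
  distinction here.\<close>

lemma moment3_gaussian_mixture:
  fixes a b c :: nat
  defines "k \<equiv> \<lambda>j. of_bool (j = a) + of_bool (j = b) + of_bool (j = c) :: nat"
  assumes "\<And>i. i \<in> {1..r} \<Longrightarrow> 0 \<le> \<omega> i" "r \<ge> 1" "a \<in> {1..d}" "b \<in> {1..d}" "c \<in> {1..d}"
  shows "moment3 (gaussian_mixture d r \<omega> \<mu> \<sigma>) (a - 1, b - 1, c - 1) =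
    (\<Sum>i=1..r. \<omega> i * (\<Prod>j=1..d. normal_moment (\<mu> i j) (\<sigma> i j) (k j)))"
  unfolding moment3_def
proof (rule gaussian_mixture_integral[OF assms(2,3)])
  fix i
  have "(\<Prod>j=1..d. y j ^ k j) = cube y (a - 1, b - 1, c - 1)" for y :: "nat \<Rightarrow> real"
    unfolding k_def power_add prod.distrib using assms(4-6) by (simp add: prod_of_bool_power cube_def)
  moreover have "has_bochner_integral (diag_gaussian d (\<mu> i) (\<sigma> i)) (\<lambda>y. \<Prod>j=1..d. y j ^ k j)
      (\<Prod>j=1..d. normal_moment (\<mu> i j) (\<sigma> i j) (k j))"
    by (rule diag_gaussian_monomial) (simp add: k_def)
  ultimately show "has_bochner_integral (diag_gaussian d (\<mu> i) (\<sigma> i)) (\<lambda>y. cube y (a - 1, b - 1, c - 1))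
      (\<Prod>j=1..d. normal_moment (\<mu> i j) (\<sigma> i j) (k j))"
    by (simp only:)
qed simp_all

text \<open>With distinct labels every coordinate has exponent at most 1, and moments of order 0 and
  1 do not see the variance.\<close>

lemma moment3_gaussian_mixture_Omega:
  assumes "\<And>i. i \<in> {1..r} \<Longrightarrow> 0 \<le> \<omega> i" "r \<ge> 1" "t \<in> Omega d"
  shows "moment3 (gaussian_mixture d r \<omega> \<mu> \<sigma>) t = (\<Sum>i=1..r. \<omega> i * cube (\<mu> i) t)"
proof -
  obtain a b c where t: "t = (a, b, c)" by (cases t)
  have abc: "a \<le> d - 1" "b \<le> d - 1" "c \<le> d - 1" "a \<noteq> b" "a \<noteq> c" "b \<noteq> c"
    using assms(3) by (auto simp: t Omega_def all_labels_def)
  then have abc': "a + 1 \<in> {1..d}" "b + 1 \<in> {1..d}" "c + 1 \<in> {1..d}" by auto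
  have "(\<Prod>j=1..d. normal_moment (\<mu> i j) (\<sigma> i j) (of_bool (j = a + 1) + of_bool (j = b + 1) + of_bool (j = c + 1)))
      = (\<Prod>j=1..d. \<mu> i j ^ of_bool (j = a + 1) * \<mu> i j ^ of_bool (j = b + 1) * \<mu> i j ^ of_bool (j = c + 1))" for i
    using abc by (intro prod.cong refl) (auto simp: normal_moment_def)
  then show ?thesis
    using moment3_gaussian_mixture[where a = "a + 1" and b = "b + 1" and c = "c + 1" and \<mu> = \<mu> and \<sigma> = \<sigma>, OF assms(1,2) abc'] abc'
    by (simp add: t prod.distrib prod_of_bool_power cube_def)
qed

text \<open>The variances appear when labels repeat: \<open>(j, l, j)\<close> contributes
  \<open>\<mu> i l * (\<sigma> i j)\<^sup>2\<close>, and \<open>(j, j, j)\<close> three times the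
  corresponding term, which explains the division by 3 in \<open>a_hat\<close>.\<close>

lemma moment3_gaussian_mixture_diag:
  assumes "\<And>i. i \<in> {1..r} \<Longrightarrow> 0 \<le> \<omega> i" "r \<ge> 1" "j \<in> {1..d}" "l \<in> {1..d}"
  shows "a_hat (\<lambda>t. moment3 (gaussian_mixture d r \<omega> \<mu> \<sigma>) t - (\<Sum>i=1..r. \<omega> i * cube (\<mu> i) t)) j l =
    (\<Sum>i=1..r. \<omega> i * \<mu> i l * (\<sigma> i j)\<^sup>2)"
proof (cases "l = j")
  case True
  have "(\<Prod>m=1..d. normal_moment (\<mu> i m) (\<sigma> i m) (of_bool (m = j) + of_bool (m = j) + of_bool (m = j)))
      = (\<Prod>m=1..d. if m = j then \<mu> i m ^ 3 + 3 * \<mu> i m * (\<sigma> i m)\<^sup>2 else 1)" for i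
    by (intro prod.cong refl) (auto simp: normal_moment_def)
  then have "moment3 (gaussian_mixture d r \<omega> \<mu> \<sigma>) (j - 1, j - 1, j - 1)
      = (\<Sum>i=1..r. \<omega> i * (\<mu> i j ^ 3 + 3 * \<mu> i j * (\<sigma> i j)\<^sup>2))"
    using moment3_gaussian_mixture[where a = j and b = j and c = j and \<mu> = \<mu> and \<sigma> = \<sigma>, OF assms(1-3) assms(3,3)] assms(3)
    by simp
  then show ?thesis
    using True assms(3) unfolding a_hat_def
    by (simp add: cube_def sum_subtractf[symmetric] sum_divide_distrib power3_eq_cube algebra_simps)
next
  case False
  have "(\<Prod>m=1..d. normal_moment (\<mu> i m) (\<sigma> i m) (of_bool (m = j) + of_bool (m = l) + of_bool (m = j)))
      = (\<Prod>m=1..d. (if m = j then (\<mu> i m)\<^sup>2 + (\<sigma> i m)\<^sup>2 else 1) * (if m = l then \<mu> i m else 1))" for i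
    using False by (intro prod.cong refl) (auto simp: normal_moment_def)
  then have "moment3 (gaussian_mixture d r \<omega> \<mu> \<sigma>) (j - 1, l - 1, j - 1)
      = (\<Sum>i=1..r. \<omega> i * (((\<mu> i j)\<^sup>2 + (\<sigma> i j)\<^sup>2) * \<mu> i l))"
    using moment3_gaussian_mixture[where a = j and b = l and c = j and \<mu> = \<mu> and \<sigma> = \<sigma>, OF assms(1-3) assms(4,3)] assms(3,4)
    by (simp add: prod.distrib)
  then show ?thesis
    using False assms(3,4) unfolding a_hat_def
    by (simp add: cube_def sum_subtractf[symmetric] power2_eq_square algebra_simps)
qed

section \<open>The steps of the learning algorithm\<close>

lemma cube_root_scaled: "cube (\<lambda>m. root 3 w * u m) t = w * cube u t"
proof -
  obtain a b c where t: "t = (a, b, c)" by (cases t)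
  have "root 3 w ^ 3 = w" by (rule odd_real_root_pow) simp
  then show ?thesis by (simp add: t cube_def power3_eq_cube mult_ac)
qed

text \<open>The Gaussian laws enter only through the last three assumptions, identities for the
  moments; \<open>s\<close> holds the standard deviations.\<close>

locale mixture =
  fixes d r :: nat and \<omega> :: "nat \<Rightarrow> real" and \<mu> s :: "nat \<Rightarrow> nat \<Rightarrow> real"
    and G :: gmatrix and \<xi> :: "nat \<Rightarrow> complex"
    and p :: "nat \<Rightarrow> nat \<Rightarrow> real" and M1 :: "nat \<Rightarrow> real" and M3 :: "real tensor3"
  assumes d_pos: "0 < d"
    and p_def: "p = (\<lambda>i m. root 3 (\<omega> i) * \<mu> i m)"
    and decomposition: "tensor_decomposition r (d - 1) (\<lambda>i m. complex_of_real (p i (m + 1))) G \<xi>"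
    and p1: "\<And>i. i \<in> {1..r} \<Longrightarrow> p i 1 \<noteq> 0"
    and p_indep: "lin_indep_on r {2..r+1} p"
    and r_le: "r + 1 \<le> d"
    and \<omega>_pos: "\<And>i. i \<in> {1..r} \<Longrightarrow> 0 < \<omega> i" and \<omega>_sum: "(\<Sum>i=1..r. \<omega> i) = 1"
    and M1: "\<And>m. m \<in> {1..d} \<Longrightarrow> M1 m = (\<Sum>i=1..r. \<omega> i * \<mu> i m)"
    and M3: "\<And>t. t \<in> Omega d \<Longrightarrow> M3 t = (\<Sum>i=1..r. cube (p i) t)"
    and a_hat_M3: "\<And>j l. j \<in> {1..d} \<Longrightarrow> l \<in> {1..d} \<Longrightarrow>
      a_hat (\<lambda>t. M3 t - (\<Sum>i=1..r. cube (p i) t)) j l = (\<Sum>i=1..r. \<omega> i * \<mu> i l * (s i j)\<^sup>2)"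
begin

lemma finite_Omega: "finite (Omega d)"
  by (rule finite_subset[of _ "all_labels d"]) (auto simp: Omega_def all_labels_def)

lemma Omega_subset: "Omega d \<subseteq> all_labels d"
  by (auto simp: Omega_def)

lemma cube_p: "cube (p i) t = \<omega> i * cube (\<mu> i) t"
  by (simp only: p_def cube_root_scaled)

text \<open>The tensor determines only the products \<open>z0 i * \<mu> i m\<close>, that is
  \<open>p\<close>. The mean is linear in \<open>p\<close> with coefficients
  \<open>(z0 i)\<^sup>2\<close>, and this separates weights from means.\<close>

definition "z0 i = root 3 (\<omega> i)"

lemma z0_pos: "i \<in> {1..r} \<Longrightarrow> 0 < z0 i"
  using \<omega>_pos by (simp add: z0_def)

lemma z0_cube: "z0 i ^ 3 = \<omega> i"
  unfolding z0_def by (rule odd_real_root_pow) simp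

lemma p_z0: "p i m = z0 i * \<mu> i m"
  by (simp add: p_def z0_def)

lemma \<omega>\<mu>: "\<omega> i * \<mu> i m = (z0 i)\<^sup>2 * p i m"
  by (simp add: z0_cube[symmetric] p_z0 power2_eq_square power3_eq_cube mult.assoc)

definition \<beta> :: "nat \<Rightarrow> nat \<Rightarrow> real" where
  "\<beta> = (SOME \<beta>. \<forall>i\<in>{1..r}. \<forall>t\<in>{1..r}. (\<Sum>k\<in>{2..r+1}. \<beta> t k * p i k) = (if i = t then 1 else 0))"

lemma dual: "i \<in> {1..r} \<Longrightarrow> t \<in> {1..r} \<Longrightarrow> (\<Sum>k\<in>{2..r+1}. \<beta> t k * p i k) = (if i = t then 1 else 0)"
proof -
  have "\<exists>\<beta>. \<forall>i\<in>{1..r}. \<forall>t\<in>{1..r}. (\<Sum>k\<in>{2..r+1}. \<beta> t k * p i k) = (if i = t then 1 else 0)"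
    by (rule dual_family_exists[OF p_indep finite_atLeastAtMost]) blast
  from someI_ex[OF this, folded \<beta>_def] show "i \<in> {1..r} \<Longrightarrow> t \<in> {1..r} \<Longrightarrow> ?thesis" by blast
qed

end

locale mixture_estimate = mixture d r \<omega> \<mu> s G \<xi> p M1 M3 + error_filter FF e
  for d r \<omega> \<mu> s G \<xi> p M1 M3 and FF :: "'x filter" and e :: "'x \<Rightarrow> real" +
  fixes M1h :: "'x \<Rightarrow> nat \<Rightarrow> real" and M3h :: "'x \<Rightarrow> real tensor3"
  assumes near_M1: "\<And>m. m \<in> {1..d} \<Longrightarrow> small (\<lambda>x. M1h x m - M1 m)"
    and near_M3: "\<And>t. t \<in> all_labels d \<Longrightarrow> small (\<lambda>x. M3h x t - M3 t)"
begin

lemma near_M3_Omega: "t \<in> Omega d \<Longrightarrow> small (\<lambda>x. M3h x t - M3 t)"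
  using near_M3 Omega_subset by blast

lemma components_near:
  fixes Q :: "'x \<Rightarrow> nat \<Rightarrow> nat \<Rightarrow> complex"
  assumes "\<And>t. t \<in> Omega d \<Longrightarrow> small (\<lambda>x. (\<Sum>k=1..r. cube (Q x k) t) - of_real (M3 t))"
  shows "\<exists>\<sigma> \<tau>. (\<forall>\<^sub>F x in FF. \<sigma> x permutes {1..r}) \<and>
    (\<forall>t\<in>{1..r}. (\<forall>x. \<tau> x t ^ 3 = (1::complex)) \<and>
      (\<forall>m\<in>{1..d}. small (\<lambda>x. \<tau> x t * Q x (\<sigma> x t) m - of_real (p t m))))"
proof -
  interpret tp: tensor_perturbation r "d - 1" "\<lambda>i m. complex_of_real (p i (m + 1))" G \<xi> FF e "\<lambda>x k m. Q x k (m + 1)"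
  proof (intro tensor_perturbation.intro tensor_perturbation_axioms.intro decomposition error_filter_axioms)
    fix i j k assume "i \<le> d - 1" "j \<le> d - 1" "k \<le> d - 1" "i \<noteq> j" "i \<noteq> k" "j \<noteq> k"
    then have \<Omega>: "(i, j, k) \<in> Omega d" by (simp add: Omega_def all_labels_def)
    show "small (\<lambda>x. (\<Sum>s=1..r. Q x s (i + 1) * Q x s (j + 1) * Q x s (k + 1)) -
        (\<Sum>s=1..r. complex_of_real (p s (i + 1)) * complex_of_real (p s (j + 1)) * complex_of_real (p s (k + 1))))"
      using assms[OF \<Omega>] by (simp add: M3[OF \<Omega>] cube_def)
  qed
  obtain \<sigma> \<tau> where *: "\<forall>\<^sub>F x in FF. \<sigma> x permutes {1..r}"
    "\<And>x t. t \<in> {1..r} \<Longrightarrow> \<tau> x t ^ 3 = (1::complex)"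
    "\<And>t m. t \<in> {1..r} \<Longrightarrow> m \<le> d - 1 \<Longrightarrow> small (\<lambda>x. \<tau> x t * Q x (\<sigma> x t) (m + 1) - of_real (p t (m + 1)))"
    using tp.recovery by blast
  show ?thesis
  proof (intro exI[of _ \<sigma>] exI[of _ \<tau>] conjI ballI allI *(1,2))
    fix t m assume "t \<in> {1..r}" "m \<in> {1..d}"
    then show "small (\<lambda>x. \<tau> x t * Q x (\<sigma> x t) m - of_real (p t m))"
      using *(3)[of t "m - 1"] by (simp add: diff_le_mono)
  qed
qed

text \<open>The vectors \<open>p\<close> compete in the minimization with a residual equal to the
  sampling error, so \<open>components_near\<close> applies to the minimizer. The root of unity
  found there is complex and need not be the one chosen by the algorithm;
  \<open>near_real_cube_root\<close> identifies the two up to \<open>O(e)\<close>.\<close>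

lemma step2_near:
  assumes opt: "\<And>x. x \<in> X \<Longrightarrow> is_arg_min (\<lambda>q. (norm_on (Omega d) (\<lambda>t. (\<Sum>k=1..r. cube (q k) t) - complex_of_real (M3h x t)))\<^sup>2)
      (\<lambda>_. True) (pst x)"
    and tau: "\<And>x i. x \<in> X \<Longrightarrow> i \<in> {1..r} \<Longrightarrow>
      is_arg_min (\<lambda>z. norm_on {1..d} (\<lambda>m. Im (z * pst x i m))) (\<lambda>z. z ^ 3 = 1) (tau x i)"
    and qh: "\<And>x i m. x \<in> X \<Longrightarrow> i \<in> {1..r} \<Longrightarrow> m \<in> {1..d} \<Longrightarrow> qh x i m = Re (tau x i * pst x i m)"
    and X: "\<forall>\<^sub>F x in FF. x \<in> X"
  obtains \<sigma> where "\<forall>\<^sub>F x in FF. \<sigma> x permutes {1..r}"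
    and "\<And>t m. t \<in> {1..r} \<Longrightarrow> m \<in> {1..d} \<Longrightarrow> small (\<lambda>x. qh x (\<sigma> x t) m - p t m)"
proof -
  have "small (\<lambda>x. (\<Sum>k=1..r. cube (pst x k) t) - of_real (M3 t))" if t: "t \<in> Omega d" for t
  proof -
    have "small (\<lambda>x. (\<Sum>k=1..r. cube (pst x k) t) - complex_of_real (M3h x t))"
    proof (rule small_norm_on_le[OF small_norm_on _ finite_Omega t])
      show "small (\<lambda>x. complex_of_real (M3 t - M3h x t))" if "t \<in> Omega d" for t
        unfolding small_of_real_iff by (rule near_sym[OF near_M3_Omega[OF that]])
      show "\<forall>\<^sub>F x in FF. norm_on (Omega d) (\<lambda>t. (\<Sum>k=1..r. cube (pst x k) t) - complex_of_real (M3h x t))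
          \<le> norm_on (Omega d) (\<lambda>t. complex_of_real (M3 t - M3h x t))"
        using X
      proof eventually_elim
        case (elim x)
        have "norm_on (Omega d) (\<lambda>t. (\<Sum>k=1..r. cube (pst x k) t) - complex_of_real (M3h x t))
            \<le> norm_on (Omega d) (\<lambda>t. (\<Sum>k=1..r. cube (\<lambda>m. complex_of_real (p k m)) t) - complex_of_real (M3h x t))"
          by (rule is_arg_min_norm_on[OF opt[OF elim]]) simp
        also have "\<dots> = norm_on (Omega d) (\<lambda>t. complex_of_real (M3 t - M3h x t))"
          unfolding norm_on_def by (intro L2_set_cong refl) (auto simp: M3 cube_def)
        finally show ?case .
      qed
    qed
    moreover have "small (\<lambda>x. complex_of_real (M3h x t) - of_real (M3 t))"
      using near_M3_Omega[OF t] unfolding of_real_diff[symmetric] small_of_real_iff .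
    ultimately show ?thesis by (rule near_trans)
  qed
  from components_near[OF this] obtain \<sigma> \<tau> where \<sigma>: "\<forall>\<^sub>F x in FF. \<sigma> x permutes {1..r}"
    and \<tau>: "\<And>x t. t \<in> {1..r} \<Longrightarrow> \<tau> x t ^ 3 = (1::complex)"
    and near: "\<And>t m. t \<in> {1..r} \<Longrightarrow> m \<in> {1..d} \<Longrightarrow> small (\<lambda>x. \<tau> x t * pst x (\<sigma> x t) m - of_real (p t m))"
    by blast
  show ?thesis
  proof (rule that[OF \<sigma>])
    fix t m assume t: "t \<in> {1..r}" and m: "m \<in> {1..d}"
    have 1: "1 \<in> {1..d}" using d_pos by simp
    have "\<forall>\<^sub>F x in FF. tau x (\<sigma> x t) ^ 3 = 1 \<and>
        norm_on {1..d} (\<lambda>m. Im (tau x (\<sigma> x t) * pst x (\<sigma> x t) m)) \<le> norm_on {1..d} (\<lambda>m. Im (\<tau> x t * pst x (\<sigma> x t) m))"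
      using \<sigma> X
    proof eventually_elim
      case (elim x)
      have "\<sigma> x t \<in> {1..r}" using permutes_in_image[OF elim(1)] t by simp
      from tau[OF elim(2) this] \<tau>[OF t, of x] show ?case
        by (auto simp: is_arg_min_def not_less)
    qed
    from near_real_cube_root[OF finite_atLeastAtMost 1 p1[OF t] \<tau>[OF t] near[OF t] this m]
    have "small (\<lambda>x. tau x (\<sigma> x t) * pst x (\<sigma> x t) m - of_real (p t m))" by blast
    from small_Re[OF this] show "small (\<lambda>x. qh x (\<sigma> x t) m - p t m)"
    proof (rule small_cong)
      show "\<forall>\<^sub>F x in FF. Re (tau x (\<sigma> x t) * pst x (\<sigma> x t) m - of_real (p t m)) = qh x (\<sigma> x t) m - p t m"
        using \<sigma> X
      proof eventually_elim
        case (elim x)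
        have "\<sigma> x t \<in> {1..r}" using permutes_in_image[OF elim(1)] t by simp
        then show ?case using qh[OF elim(2) _ m] by simp
      qed
    qed
  qed
qed

text \<open>The tensor part of the objective recovers the products of means with cube roots of
  weights; the mean part then recovers the weights, as a linear system for the squares of those cube
  roots.\<close>

lemma step4_near:
  assumes opt: "\<And>x. x \<in> X \<Longrightarrow> step_4 d r (M1h x) (M3h x) (ws x) (ms x)"
    and X: "\<forall>\<^sub>F x in FF. x \<in> X"
  obtains \<sigma> where "\<forall>\<^sub>F x in FF. \<sigma> x permutes {1..r}"
    and "\<And>t. t \<in> {1..r} \<Longrightarrow> small (\<lambda>x. ws x (\<sigma> x t) - \<omega> t)"
    and "\<And>t m. t \<in> {1..r} \<Longrightarrow> m \<in> {1..d} \<Longrightarrow> small (\<lambda>x. ms x (\<sigma> x t) m - \<mu> t m)"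
proof -
  define res1 where "res1 x w u = norm_on {1..d} (\<lambda>m. (\<Sum>i=1..r. w i * u i m) - M1h x m)" for x w u
  define res3 where "res3 x w u = norm_on (Omega d) (\<lambda>t. (\<Sum>i=1..r. w i * cube (u i) t) - M3h x t)" for x w u
  have sm1: "small (\<lambda>x. res1 x \<omega> \<mu>)"
    unfolding res1_def
  proof (rule small_norm_on)
    fix m assume m: "m \<in> {1..d}"
    show "small (\<lambda>x. (\<Sum>i=1..r. \<omega> i * \<mu> i m) - M1h x m)"
      using near_sym[OF near_M1[OF m]] by (simp only: M1[OF m])
  qed
  have sm3: "small (\<lambda>x. res3 x \<omega> \<mu>)"
    unfolding res3_def
  proof (rule small_norm_on)
    fix t assume t: "t \<in> Omega d"
    show "small (\<lambda>x. (\<Sum>i=1..r. \<omega> i * cube (\<mu> i) t) - M3h x t)"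
      using near_sym[OF near_M3_Omega[OF t]] by (simp only: M3[OF t] cube_p)
  qed
  have feas: "(\<Sum>i=1..r. ws x i) = 1 \<and> (\<forall>i\<in>{1..r}. 0 \<le> ws x i)" if "x \<in> X" for x
    using opt[OF that] by (simp add: step_4_def is_arg_min_def)
  have le: "res1 x (ws x) (ms x) \<le> res1 x \<omega> \<mu> + res3 x \<omega> \<mu> \<and> res3 x (ws x) (ms x) \<le> res1 x \<omega> \<mu> + res3 x \<omega> \<mu>"
    if "x \<in> X" for x
  proof -
    have "(\<Sum>i=1..r. \<omega> i) = 1 \<and> (\<forall>i\<in>{1..r}. 0 \<le> \<omega> i)" using \<omega>_sum \<omega>_pos by (auto intro: less_imp_le)
    then have "(res1 x (ws x) (ms x))\<^sup>2 + (res3 x (ws x) (ms x))\<^sup>2 \<le> (res1 x \<omega> \<mu>)\<^sup>2 + (res3 x \<omega> \<mu>)\<^sup>2"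
      using is_arg_min_le[OF opt[OF that, unfolded step_4_def], of "(\<omega>, \<mu>)"] by (simp add: res1_def res3_def)
    moreover have "0 \<le> res1 x \<omega> \<mu>" "0 \<le> res3 x \<omega> \<mu>" "0 \<le> res1 x (ws x) (ms x)" "0 \<le> res3 x (ws x) (ms x)"
      by (simp_all add: res1_def res3_def norm_on_nonneg)
    \<comment> \<open>Passes from the sum of squares to each residual:
      \<open>a0\<^sup>2 + b0\<^sup>2\<close> is at most \<open>(a0 + b0)\<^sup>2\<close>.\<close>
    moreover have "a \<le> a0 + b0 \<and> b \<le> a0 + b0" if "a\<^sup>2 + b\<^sup>2 \<le> a0\<^sup>2 + b0\<^sup>2" "0 \<le> a0" "0 \<le> b0" "0 \<le> a" "0 \<le> b" for a b a0 b0 :: real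
    proof -
      have "0 \<le> a0 * b0" using that by simp
      then have "a\<^sup>2 \<le> (a0 + b0)\<^sup>2" "b\<^sup>2 \<le> (a0 + b0)\<^sup>2"
        using that(1) zero_le_power2[of a] zero_le_power2[of b] unfolding power2_sum by linarith+
      then show ?thesis using that by (auto intro: power2_le_imp_le)
    qed
    ultimately show ?thesis by blast
  qed
  have eq1: "small (\<lambda>x. (\<Sum>i=1..r. ws x i * ms x i m) - M1 m)" if m: "m \<in> {1..d}" for m
  proof (rule near_trans[OF _ near_M1[OF m]])
    show "small (\<lambda>x. (\<Sum>i=1..r. ws x i * ms x i m) - M1h x m)"
      by (rule small_norm_on_le[OF small_add[OF sm1 sm3] _ finite_atLeastAtMost m])
        (use X in \<open>eventually_elim; use le in \<open>auto simp: res1_def\<close>\<close>)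
  qed
  have eq3: "small (\<lambda>x. (\<Sum>i=1..r. ws x i * cube (ms x i) t) - M3 t)" if t: "t \<in> Omega d" for t
  proof (rule near_trans[OF _ near_M3_Omega[OF t]])
    show "small (\<lambda>x. (\<Sum>i=1..r. ws x i * cube (ms x i) t) - M3h x t)"
      by (rule small_norm_on_le[OF small_add[OF sm1 sm3] _ finite_Omega t])
        (use X in \<open>eventually_elim; use le in \<open>auto simp: res3_def\<close>\<close>)
  qed
  define z where "z x i = root 3 (ws x i)" for x i
  define q where "q x i m = z x i * ms x i m" for x i m
  have z3: "z x i ^ 3 = ws x i" for x i
    unfolding z_def by (rule odd_real_root_pow) simp
  have cube_q: "cube (\<lambda>m. complex_of_real (q x i m)) t = complex_of_real (ws x i * cube (ms x i) t)" for x i t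
  proof -
    obtain a b c where t: "t = (a, b, c)" by (cases t)
    show ?thesis
      by (simp add: t cube_def q_def z3[symmetric] power3_eq_cube mult_ac)
  qed
  have "small (\<lambda>x. (\<Sum>k=1..r. cube (\<lambda>m. complex_of_real (q x k m)) t) - of_real (M3 t))" if t: "t \<in> Omega d" for t
    using eq3[OF t] unfolding cube_q of_real_sum[symmetric] of_real_diff[symmetric] small_of_real_iff .
  from components_near[OF this] obtain \<sigma> \<tau> where \<sigma>: "\<forall>\<^sub>F x in FF. \<sigma> x permutes {1..r}"
    and \<tau>: "\<And>x t. t \<in> {1..r} \<Longrightarrow> \<tau> x t ^ 3 = (1::complex)"
    and near: "\<And>t m. t \<in> {1..r} \<Longrightarrow> m \<in> {1..d} \<Longrightarrow> small (\<lambda>x. \<tau> x t * complex_of_real (q x (\<sigma> x t) m) - of_real (p t m))"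
    by blast
  have near_q: "small (\<lambda>x. q x (\<sigma> x t) m - p t m)" if t: "t \<in> {1..r}" and m: "m \<in> {1..d}" for t m
  proof -
    have 1: "1 \<in> {1..d}" using d_pos by simp
    \<comment> \<open>\<open>q\<close> is already real, so the root 1 makes the imaginary part
      vanish and is an admissible minimal choice; hence no root of unity remains.\<close>
    have "norm_on {1..d} (\<lambda>m. Im (1 * complex_of_real (q x (\<sigma> x t) m))) = 0" for x
      by (simp add: norm_on_def L2_set_def)
    then have "\<forall>\<^sub>F x in FF. (1::complex) ^ 3 = 1 \<and> norm_on {1..d} (\<lambda>m. Im (1 * complex_of_real (q x (\<sigma> x t) m)))
        \<le> norm_on {1..d} (\<lambda>m. Im (\<tau> x t * complex_of_real (q x (\<sigma> x t) m)))"
      by (simp only: norm_on_nonneg) simp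
    from near_real_cube_root[OF finite_atLeastAtMost 1 p1[OF t] \<tau>[OF t] near[OF t] this m]
    have "small (\<lambda>x. complex_of_real (q x (\<sigma> x t) m) - of_real (p t m))" by simp
    then show ?thesis unfolding of_real_diff[symmetric] small_of_real_iff .
  qed
  have in_r: "\<sigma> x t \<in> {1..r}" if "\<sigma> x permutes {1..r}" "t \<in> {1..r}" for x t
    using permutes_in_image[OF that(1)] that(2) by simp
  \<comment> \<open>Feasible weights lie in \<open>[0, 1]\<close>. The upper bound is needed to
    multiply the error of \<open>q\<close> by squares of \<open>z\<close>, the lower one to pass
    from squares back to \<open>z\<close>.\<close>
  have z_bounds: "\<forall>\<^sub>F x in FF. \<forall>t\<in>{1..r}. 0 \<le> z x (\<sigma> x t) \<and> z x (\<sigma> x t) \<le> 1"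
    using \<sigma> X
  proof eventually_elim
    case (elim x)
    show ?case
    proof
      fix t assume "t \<in> {1..r}"
      then have i: "\<sigma> x t \<in> {1..r}" using in_r elim(1) by blast
      have "0 \<le> ws x (\<sigma> x t)" using feas[OF elim(2)] i by blast
      moreover have "ws x (\<sigma> x t) \<le> (\<Sum>i=1..r. ws x i)"
        using feas[OF elim(2)] i by (intro member_le_sum) auto
      ultimately show "0 \<le> z x (\<sigma> x t) \<and> z x (\<sigma> x t) \<le> 1"
        using feas[OF elim(2)] by (simp add: z_def)
    qed
  qed
  have bdd_z: "bdd (\<lambda>x. z x (\<sigma> x t))" if "t \<in> {1..r}" for t
    by (rule bddI[of _ 1]) (use z_bounds that in \<open>auto elim!: eventually_mono\<close>)
  have near_z: "small (\<lambda>x. z x (\<sigma> x t) - z0 t)" if t: "t \<in> {1..r}" for t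
  proof -
    have sum: "small (\<lambda>x. \<Sum>i=1..r. ((z x (\<sigma> x i))\<^sup>2 - (z0 i)\<^sup>2) * p i m)" if m: "m \<in> {1..d}" for m
    proof -
      \<comment> \<open>Relabelled by \<open>\<sigma> x\<close>, the computed mean is a sum of
        squares of \<open>z\<close> times \<open>q\<close>; replacing \<open>q\<close> by
        \<open>p\<close> leaves a linear relation for the errors of the squares.\<close>
      have "small (\<lambda>x. ((\<Sum>i=1..r. ws x i * ms x i m) - M1 m) - (\<Sum>i=1..r. (z x (\<sigma> x i) * z x (\<sigma> x i)) * (q x (\<sigma> x i) m - p i m)))"
        by (intro small_diff eq1 m small_sum small_mult_bdd bdd_mult bdd_z near_q)
      then show ?thesis
      proof (rule small_cong)
        show "\<forall>\<^sub>F x in FF. ((\<Sum>i=1..r. ws x i * ms x i m) - M1 m) - (\<Sum>i=1..r. (z x (\<sigma> x i) * z x (\<sigma> x i)) * (q x (\<sigma> x i) m - p i m))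
            = (\<Sum>i=1..r. ((z x (\<sigma> x i))\<^sup>2 - (z0 i)\<^sup>2) * p i m)"
          using \<sigma>
        proof eventually_elim
          case (elim x)
          have "(\<Sum>i=1..r. ws x i * ms x i m) = (\<Sum>i=1..r. ws x (\<sigma> x i) * ms x (\<sigma> x i) m)"
            using sum.permute[OF elim, of "\<lambda>i. ws x i * ms x i m"] by (simp add: o_def)
          also have "\<dots> = (\<Sum>i=1..r. (z x (\<sigma> x i) * z x (\<sigma> x i)) * q x (\<sigma> x i) m)"
            by (intro sum.cong refl) (simp add: q_def z3[symmetric] power3_eq_cube)
          finally show ?case
            using m by (simp add: M1 \<omega>\<mu> sum_subtractf[symmetric] algebra_simps power2_eq_square)
        qed
      qed
    qed
    have "small (\<lambda>x. \<Sum>k\<in>{2..r+1}. \<beta> t k * (\<Sum>i=1..r. ((z x (\<sigma> x i))\<^sup>2 - (z0 i)\<^sup>2) * p i k))"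
      using r_le by (intro small_sum[of "{2..r+1}"] small_mult_const sum) auto
    moreover have "(\<Sum>k\<in>{2..r+1}. \<beta> t k * (\<Sum>i=1..r. ((z x (\<sigma> x i))\<^sup>2 - (z0 i)\<^sup>2) * p i k))
        = (z x (\<sigma> x t))\<^sup>2 - (z0 t)\<^sup>2" for x
    proof -
      have "(\<Sum>k\<in>{2..r+1}. \<beta> t k * (\<Sum>i=1..r. ((z x (\<sigma> x i))\<^sup>2 - (z0 i)\<^sup>2) * p i k))
          = (\<Sum>i=1..r. ((z x (\<sigma> x i))\<^sup>2 - (z0 i)\<^sup>2) * (\<Sum>k\<in>{2..r+1}. \<beta> t k * p i k))"
        by (rule sum_swap_mult)
      also have "\<dots> = (\<Sum>i=1..r. ((z x (\<sigma> x i))\<^sup>2 - (z0 i)\<^sup>2) * (if i = t then 1 else 0))"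
        using t by (intro sum.cong refl) (simp only: dual)
      finally show ?thesis using t by (simp only: sum_kron finite_atLeastAtMost)
    qed
    ultimately have "small (\<lambda>x. (z x (\<sigma> x t))\<^sup>2 - (z0 t)\<^sup>2)" by (simp only:)
    \<comment> \<open>Since \<open>z\<close> is nonnegative, \<open>z + z0 t\<close> is at least
      \<open>z0 t\<close>, so a small difference of squares gives a small difference.\<close>
    then show ?thesis
    proof (rule small_dominated[where K = "inverse (z0 t)"])
      show "\<forall>\<^sub>F x in FF. norm (z x (\<sigma> x t) - z0 t) \<le> inverse (z0 t) * norm ((z x (\<sigma> x t))\<^sup>2 - (z0 t)\<^sup>2)"
        using z_bounds
      proof eventually_elim
        case (elim x)
        let ?z = "z x (\<sigma> x t)"
        have "?z\<^sup>2 - (z0 t)\<^sup>2 = (?z - z0 t) * (?z + z0 t)" by (simp add: power2_eq_square algebra_simps)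
        then have "\<bar>?z\<^sup>2 - (z0 t)\<^sup>2\<bar> = \<bar>?z - z0 t\<bar> * (?z + z0 t)"
          using elim t z0_pos[OF t] by (simp add: abs_mult)
        moreover have "\<bar>?z - z0 t\<bar> * (?z + z0 t) \<ge> \<bar>?z - z0 t\<bar> * z0 t"
          using elim t by (intro mult_left_mono) auto
        ultimately show ?case using z0_pos[OF t] by (simp add: field_simps)
      qed
    qed (use z0_pos[OF t] in simp)
  qed
  show ?thesis
  proof (rule that[OF \<sigma>])
    fix t assume t: "t \<in> {1..r}"
    have "small (\<lambda>x. z x (\<sigma> x t) * (z x (\<sigma> x t) * z x (\<sigma> x t)) - z0 t * (z0 t * z0 t))"
      by (intro near_mult near_z t)
    moreover have "y * (y * y) = y ^ 3" for y :: real by (simp add: power3_eq_cube)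
    ultimately show "small (\<lambda>x. ws x (\<sigma> x t) - \<omega> t)" by (simp only: z3 z0_cube)
    fix m assume m: "m \<in> {1..d}"
    have "small (\<lambda>x. (q x (\<sigma> x t) m - p t m) - (z x (\<sigma> x t) - z0 t) * \<mu> t m)"
      by (intro small_diff small_bdd_mult near_q near_z bdd_const t m)
    moreover have "(q x (\<sigma> x t) m - p t m) - (z x (\<sigma> x t) - z0 t) * \<mu> t m
        = z x (\<sigma> x t) * (ms x (\<sigma> x t) m - \<mu> t m)" for x
      by (simp add: q_def p_z0 algebra_simps)
    ultimately have "small (\<lambda>x. z x (\<sigma> x t) * (ms x (\<sigma> x t) m - \<mu> t m))" by (simp only:)
    then show "small (\<lambda>x. ms x (\<sigma> x t) m - \<mu> t m)"
      by (rule near_divide_cancel[OF _ near_z[OF t]]) (use z0_pos[OF t] in simp)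
  qed
qed

text \<open>The true variances compete in the minimization with an \<open>O(e)\<close> residual, so
  the minimizer solves the linear equations up to \<open>O(e)\<close>. The permutations from Steps 2
  and 4 may differ, which is harmless because Step 5 uses \<open>qh\<close> only through a symmetric
  sum.\<close>

lemma step5_near:
  assumes \<sigma>2: "\<forall>\<^sub>F x in FF. \<sigma>2 x permutes {1..r}"
    and near_q: "\<And>t m. t \<in> {1..r} \<Longrightarrow> m \<in> {1..d} \<Longrightarrow> small (\<lambda>x. qh x (\<sigma>2 x t) m - p t m)"
    and \<sigma>: "\<forall>\<^sub>F x in FF. \<sigma> x permutes {1..r}"
    and near_ws: "\<And>t. t \<in> {1..r} \<Longrightarrow> small (\<lambda>x. ws x (\<sigma> x t) - \<omega> t)"
    and near_ms: "\<And>t m. t \<in> {1..r} \<Longrightarrow> m \<in> {1..d} \<Longrightarrow> small (\<lambda>x. ms x (\<sigma> x t) m - \<mu> t m)"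
    and opt: "\<And>x. x \<in> X \<Longrightarrow> is_arg_min
        (\<lambda>b. (norm_on {1..d} (\<lambda>m. a_hat (\<lambda>t. M3h x t - (\<Sum>i=1..r. cube (qh x i) t)) j m -
           (\<Sum>i=1..r. ws x i * ms x i m * b i)))\<^sup>2)
        (\<lambda>b. \<forall>i\<in>{1..r}. 0 \<le> b i) (\<lambda>i. B x i j)"
    and X: "\<forall>\<^sub>F x in FF. x \<in> X"
    and j: "j \<in> {1..d}" and t: "t \<in> {1..r}"
  shows "small (\<lambda>x. B x (\<sigma> x t) j - (s t j)\<^sup>2)"
proof -
  define ah where "ah x m = a_hat (\<lambda>t. M3h x t - (\<Sum>i=1..r. cube (qh x i) t)) j m" for x m
  define W where "W x i m = ws x (\<sigma> x i) * ms x (\<sigma> x i) m" for x i m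
  have near_A: "small (\<lambda>x. (M3h x t - (\<Sum>i=1..r. cube (qh x i) t)) - (M3 t - (\<Sum>i=1..r. cube (p i) t)))"
    if t: "t \<in> all_labels d" for t
  proof -
    obtain a b c where abc: "t = (a, b, c)" by (cases t)
    have l: "a + 1 \<in> {1..d}" "b + 1 \<in> {1..d}" "c + 1 \<in> {1..d}"
      using t d_pos by (auto simp: abc all_labels_def)
    have "small (\<lambda>x. (\<Sum>i=1..r. qh x (\<sigma>2 x i) (a + 1) * qh x (\<sigma>2 x i) (b + 1) * qh x (\<sigma>2 x i) (c + 1))
        - (\<Sum>i=1..r. p i (a + 1) * p i (b + 1) * p i (c + 1)))"
      by (intro near_sum near_mult near_q l)
    from small_diff[OF near_M3[OF t] this]
    show ?thesis
    proof (rule small_cong)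
      show "\<forall>\<^sub>F x in FF. (M3h x t - M3 t) - ((\<Sum>i=1..r. qh x (\<sigma>2 x i) (a + 1) * qh x (\<sigma>2 x i) (b + 1) * qh x (\<sigma>2 x i) (c + 1))
        - (\<Sum>i=1..r. p i (a + 1) * p i (b + 1) * p i (c + 1)))
        = (M3h x t - (\<Sum>i=1..r. cube (qh x i) t)) - (M3 t - (\<Sum>i=1..r. cube (p i) t))"
        using \<sigma>2
      proof eventually_elim
        case (elim x)
        show ?case using sum.permute[OF elim, of "\<lambda>i. cube (qh x i) t"] by (simp add: o_def abc cube_def)
      qed
    qed
  qed
  have near_ah: "small (\<lambda>x. ah x m - (\<Sum>i=1..r. \<omega> i * \<mu> i m * (s i j)\<^sup>2))" if m: "m \<in> {1..d}" for m
  proof -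
    have l: "(j - 1, m - 1, j - 1) \<in> all_labels d" "(j - 1, j - 1, j - 1) \<in> all_labels d"
      using j m by (auto simp: all_labels_def)
    show ?thesis
      unfolding a_hat_M3[OF j m, symmetric] ah_def a_hat_def
      using near_A[OF l(1)] small_mult_const[OF near_A[OF l(2)], of "1/3"]
      by (simp add: diff_divide_distrib right_diff_distrib)
  qed
  have near_W: "small (\<lambda>x. W x i m - \<omega> i * \<mu> i m)" if "i \<in> {1..r}" "m \<in> {1..d}" for i m
    unfolding W_def by (intro near_mult near_ws near_ms that)
  have res: "small (\<lambda>x. ah x m - (\<Sum>i=1..r. W x i m * B x (\<sigma> x i) j))" if m: "m \<in> {1..d}" for m
  proof (rule small_norm_on_le[OF small_norm_on _ finite_atLeastAtMost m])
    fix m assume m: "m \<in> {1..d}"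
    have "small (\<lambda>x. (\<Sum>i=1..r. W x i m * (s i j)\<^sup>2) - (\<Sum>i=1..r. \<omega> i * \<mu> i m * (s i j)\<^sup>2))"
      by (intro near_sum near_mult near_W near_const m)
    from near_trans[OF near_ah[OF m] near_sym[OF this]]
    show "small (\<lambda>x. ah x m - (\<Sum>i=1..r. W x i m * (s i j)\<^sup>2))" .
  next
    show "\<forall>\<^sub>F x in FF. norm_on {1..d} (\<lambda>m. ah x m - (\<Sum>i=1..r. W x i m * B x (\<sigma> x i) j))
        \<le> norm_on {1..d} (\<lambda>m. ah x m - (\<Sum>i=1..r. W x i m * (s i j)\<^sup>2))"
      using \<sigma> X
    proof eventually_elim
      case (elim x)
      have perm: "(\<Sum>i=1..r. ws x i * ms x i m * b i) = (\<Sum>i=1..r. W x i m * b (\<sigma> x i))" for b m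
        using sum.permute[OF elim(1), of "\<lambda>i. ws x i * ms x i m * b i"] by (simp add: o_def W_def)
      \<comment> \<open>The competitor is the true variances in the numbering of the computed
        components; squares make it feasible.\<close>
      have "norm_on {1..d} (\<lambda>m. ah x m - (\<Sum>i=1..r. ws x i * ms x i m * B x i j))
          \<le> norm_on {1..d} (\<lambda>m. ah x m - (\<Sum>i=1..r. ws x i * ms x i m * (s (inv_into UNIV (\<sigma> x) i) j)\<^sup>2))"
        unfolding ah_def by (rule is_arg_min_norm_on[OF opt[OF elim(2)]]) simp
      then show ?case
        unfolding perm by (simp add: permutes_inverses(2)[OF elim(1)])
    qed
  qed
  \<comment> \<open>The dual family of the vectors \<open>\<omega> i * \<mu> i\<close>, which are
    \<open>(z0 i)\<^sup>2\<close> times \<open>p i\<close>. Applied to the computed products it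
    gives a matrix close to the identity.\<close>
  define D where "D t k = \<beta> t k * inverse ((z0 t)\<^sup>2)" for t k
  have D: "(\<Sum>k\<in>{2..r+1}. D t k * (\<omega> i * \<mu> i k)) = (if i = t then 1 else 0)" if "i \<in> {1..r}" "t \<in> {1..r}" for i t
  proof -
    have "(\<Sum>k\<in>{2..r+1}. D t k * (\<omega> i * \<mu> i k)) = inverse ((z0 t)\<^sup>2) * (z0 i)\<^sup>2 * (\<Sum>k\<in>{2..r+1}. \<beta> t k * p i k)"
      unfolding sum_distrib_left D_def \<omega>\<mu> by (intro sum.cong refl) (simp only: mult_ac)
    then show ?thesis using z0_pos[OF that(2)] dual[OF that] by simp
  qed
  have sub: "k \<in> {1..d}" if "k \<in> {2..r+1}" for k using that r_le by auto
  show ?thesis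
  proof (rule near_linear_system[OF _ t, where z = "\<lambda>x t. B x (\<sigma> x t) j"
        and M = "\<lambda>x t i. \<Sum>k\<in>{2..r+1}. D t k * W x i k" and ?z0.0 = "\<lambda>t. (s t j)\<^sup>2"])
    fix t i assume ti: "t \<in> {1..r}" "i \<in> {1..r}"
    have "small (\<lambda>x. \<Sum>k\<in>{2..r+1}. D t k * (W x i k - \<omega> i * \<mu> i k))"
      by (intro small_sum small_mult_const near_W ti sub)
    then show "small (\<lambda>x. (\<Sum>k\<in>{2..r+1}. D t k * W x i k) - (if i = t then 1 else 0))"
      by (simp only: right_diff_distrib sum_subtractf D[OF ti(2,1)])
  next
    fix t assume t: "t \<in> {1..r}"
    have "small (\<lambda>x. \<Sum>k\<in>{2..r+1}. D t k * ((\<Sum>i=1..r. B x (\<sigma> x i) j * W x i k) - (\<Sum>i=1..r. (s i j)\<^sup>2 * (\<omega> i * \<mu> i k))))"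
    proof (intro small_sum small_mult_const)
      fix k assume "k \<in> {2..r+1}"
      then have "k \<in> {1..d}" by (rule sub)
      from near_trans[OF near_sym[OF res[OF this]] near_ah[OF this]]
      show "small (\<lambda>x. (\<Sum>i=1..r. B x (\<sigma> x i) j * W x i k) - (\<Sum>i=1..r. (s i j)\<^sup>2 * (\<omega> i * \<mu> i k)))"
        by (simp only: mult.commute)
    qed
    moreover have "(\<Sum>k\<in>{2..r+1}. D t k * ((\<Sum>i=1..r. B x (\<sigma> x i) j * W x i k) - (\<Sum>i=1..r. (s i j)\<^sup>2 * (\<omega> i * \<mu> i k))))
        = (\<Sum>i=1..r. (\<Sum>k\<in>{2..r+1}. D t k * W x i k) * B x (\<sigma> x i) j) - (s t j)\<^sup>2" for x
    proof -
      have "(\<Sum>k\<in>{2..r+1}. D t k * (\<Sum>i=1..r. (s i j)\<^sup>2 * (\<omega> i * \<mu> i k)))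
          = (\<Sum>i=1..r. (s i j)\<^sup>2 * (\<Sum>k\<in>{2..r+1}. D t k * (\<omega> i * \<mu> i k)))"
        by (rule sum_swap_mult)
      also have "\<dots> = (\<Sum>i=1..r. (s i j)\<^sup>2 * (if i = t then 1 else 0))"
        using t by (intro sum.cong refl) (simp only: D)
      also have "\<dots> = (s t j)\<^sup>2" using t by (simp only: sum_kron finite_atLeastAtMost)
      finally have 1: "(\<Sum>k\<in>{2..r+1}. D t k * (\<Sum>i=1..r. (s i j)\<^sup>2 * (\<omega> i * \<mu> i k))) = (s t j)\<^sup>2" .
      have 2: "(\<Sum>k\<in>{2..r+1}. D t k * (\<Sum>i=1..r. B x (\<sigma> x i) j * W x i k))
          = (\<Sum>i=1..r. B x (\<sigma> x i) j * (\<Sum>k\<in>{2..r+1}. D t k * W x i k))"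
        by (rule sum_swap_mult)
      show ?thesis
        by (simp only: right_diff_distrib sum_subtractf 1 2) (simp only: mult.commute)
    qed
    ultimately show "small (\<lambda>x. (\<Sum>i=1..r. (\<Sum>k\<in>{2..r+1}. D t k * W x i k) * B x (\<sigma> x i) j) - (s t j)\<^sup>2)"
      by (simp only:)
  qed simp
qed

end

section \<open>From the hypotheses of the theorem to the final estimates\<close>

text \<open>All eigenvalues of \<open>N(\<xi>)\<close> occur among the \<open>r\<close> displayed
  sums. As the spectrum has \<open>r\<close> elements, no two sums coincide.\<close>

lemma eigenvalues_distinct:
  assumes indep: "lin_indep_on r {1..r} P"
    and eig: "\<And>i j s. i \<in> {1..r} \<Longrightarrow> j \<in> {r+1..d-1} \<Longrightarrow> s \<in> {1..r} \<Longrightarrow>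
      (\<Sum>k=1..r. G k (i, j) * P s k) = w s j * P s i"
    and spec: "card (spectrum (N_xi d r \<xi> G)) = r"
  shows "inj_on (\<lambda>s. \<Sum>j=r+1..d-1. \<xi> j * w s j) {1..r}"
proof -
  let ?lam = "\<lambda>s. \<Sum>j=r+1..d-1. \<xi> j * w s j"
  obtain \<rho> where \<rho>: "\<And>s t. s \<in> {1..r} \<Longrightarrow> t \<in> {1..r} \<Longrightarrow>
      (\<Sum>k=1..r. \<rho> t k * P s k) = (if s = t then 1 else 0)"
    by (rule dual_family_exists[OF indep finite_atLeastAtMost]) blast
  note \<rho>T = dual_family_transpose[OF \<rho>]
  \<comment> \<open>In coordinates \<open>c\<close> with respect to \<open>P\<close>, an eigenvector
    for \<open>a\<close> satisfies \<open>c t * (?lam t - a) = 0\<close> for all \<open>t\<close>;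
    if \<open>a\<close> were none of the sums, it would vanish.\<close>
  have sub: "spectrum (N_xi d r \<xi> G) \<subseteq> ?lam ` {1..r}"
  proof
    fix a assume "a \<in> spectrum (N_xi d r \<xi> G)"
    then obtain v where v: "v \<in> carrier_vec r" "v \<noteq> 0\<^sub>v r" and Nv: "N_xi d r \<xi> G *\<^sub>v v = a \<cdot>\<^sub>v v"
      unfolding spectrum_def eigenvalue_def eigenvector_def by (auto simp: N_xi_def)
    define u where "u i = v $ (i - 1)" for i
    define c where "c t = (\<Sum>i=1..r. \<rho> t i * u i)" for t
    have uc: "u k = (\<Sum>t=1..r. c t * P t k)" if k: "k \<in> {1..r}" for k
    proof -
      have "(\<Sum>t=1..r. c t * P t k) = (\<Sum>i=1..r. u i * (\<Sum>t=1..r. \<rho> t i * P t k))"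
        unfolding c_def sum_distrib_left sum_distrib_right by (subst sum.swap) (simp only: mult_ac)
      also have "\<dots> = (\<Sum>i=1..r. u i * (if i = k then 1 else 0))"
        using k by (intro sum.cong refl) (simp only: \<rho>T)
      finally show ?thesis using k by (simp only: sum_kron finite_atLeastAtMost)
    qed
    have Nu: "(\<Sum>k=1..r. (\<Sum>l=r+1..d-1. \<xi> l * G k (i, l)) * u k) = a * u i" if i: "i \<in> {1..r}" for i
    proof -
      have i': "i - 1 < r" "i - 1 + 1 = i" using i by auto
      have "(N_xi d r \<xi> G *\<^sub>v v) $ (i - 1) = (\<Sum>k<r. (\<Sum>l=r+1..d-1. \<xi> l * G (k + 1) (i, l)) * v $ k)"
        using i' v(1) by (simp add: N_xi_def N_mat_def scalar_prod_def atLeast0LessThan)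
      also have "\<dots> = (\<Sum>k=1..r. (\<Sum>l=r+1..d-1. \<xi> l * G k (i, l)) * u k)"
        by (simp add: One_nat_def sum.atLeast1_atMost_eq u_def)
      finally show ?thesis using i' v(1) by (simp add: Nv u_def)
    qed
    have "(\<Sum>t=1..r. (c t * (?lam t - a)) * P t i) = 0" if i: "i \<in> {1..r}" for i
    proof -
      have "(\<Sum>k=1..r. (\<Sum>l=r+1..d-1. \<xi> l * G k (i, l)) * u k)
          = (\<Sum>l=r+1..d-1. \<xi> l * (\<Sum>k=1..r. G k (i, l) * u k))"
        unfolding sum_distrib_left sum_distrib_right by (subst sum.swap) (simp only: mult_ac)
      also have "\<dots> = (\<Sum>l=r+1..d-1. \<xi> l * (\<Sum>t=1..r. c t * (w t l * P t i)))"
      proof (intro sum.cong refl)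
        fix l assume l: "l \<in> {r+1..d-1}"
        have "(\<Sum>k=1..r. G k (i, l) * u k) = (\<Sum>k=1..r. G k (i, l) * (\<Sum>t=1..r. c t * P t k))"
          by (intro sum.cong refl) (simp only: uc)
        also have "\<dots> = (\<Sum>t=1..r. c t * (\<Sum>k=1..r. G k (i, l) * P t k))" by (rule sum_swap_mult)
        also have "\<dots> = (\<Sum>t=1..r. c t * (w t l * P t i))"
          using i l by (intro sum.cong refl) (simp only: eig)
        finally show "\<xi> l * (\<Sum>k=1..r. G k (i, l) * u k) = \<xi> l * (\<Sum>t=1..r. c t * (w t l * P t i))"
          by (simp only:)
      qed
      also have "\<dots> = (\<Sum>t=1..r. (c t * P t i) * ?lam t)"
        unfolding sum_distrib_left by (subst sum.swap) (simp only: mult_ac)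
      finally have "(\<Sum>t=1..r. (c t * P t i) * ?lam t) = a * u i" using Nu[OF i] by (simp only:)
      also have "\<dots> = (\<Sum>t=1..r. (c t * P t i) * a)"
        unfolding uc[OF i] sum_distrib_left by (simp only: mult_ac)
      finally have "(\<Sum>t=1..r. (c t * P t i) * ?lam t) - (\<Sum>t=1..r. (c t * P t i) * a) = 0" by (simp only: diff_self)
      then show ?thesis
        unfolding sum_subtractf[symmetric] right_diff_distrib[symmetric] by (simp only: mult_ac)
    qed
    then have c0: "c t * (?lam t - a) = 0" if "t \<in> {1..r}" for t
      using lin_indep_onD[OF indep, of "\<lambda>t. c t * (?lam t - a)"] that by blast
    show "a \<in> ?lam ` {1..r}"
    proof (rule ccontr)
      assume "a \<notin> ?lam ` {1..r}"
      then have "?lam t - a \<noteq> 0" if "t \<in> {1..r}" for t using that by (auto simp only: right_minus_eq)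
      then have "c t = 0" if "t \<in> {1..r}" for t using c0[OF that] that by (simp only: mult_eq_0_iff) blast
      then have u0: "u k = 0" if "k \<in> {1..r}" for k using uc[OF that] by simp
      have "v $ i = 0" if "i < r" for i using u0[of "i + 1"] that by (simp add: u_def)
      then have "v = 0\<^sub>v r" using v(1) by (intro eq_vecI) auto
      then show False using v(2) by simp
    qed
  qed
  have "r \<le> card (?lam ` {1..r})" using card_mono[OF _ sub] spec by simp
  moreover have "card (?lam ` {1..r}) \<le> r" using card_image_le[of "{1..r}" ?lam] by simp
  ultimately show ?thesis by (intro eq_card_imp_inj_on) auto
qed

text \<open>Label shifts and complexification translate the independence conditions. The generating
  equation is a relation between the tails of the components, so their independence splits it into
  one equation per component.\<close>

lemma tensor_decomposition_of_mixture:
  fixes p :: "nat \<Rightarrow> nat \<Rightarrow> real"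
  assumes r: "1 \<le> r" "r + 2 \<le> d"
    and F: "\<And>i j k. F (i, j, k) = (\<Sum>s=1..r. complex_of_real (p s (i + 1)) * of_real (p s (j + 1)) * of_real (p s (k + 1)))"
    and cond_i: "\<And>i. i \<in> {1..r} \<Longrightarrow> p i 1 \<noteq> 0"
    and cond_ii: "lin_indep_on r {2..r+1} p"
    and cond_iii: "\<And>j. j \<in> {r+1..d-1} \<Longrightarrow> lin_indep_on r ({r+2..j} \<union> {j+2..d}) p"
    and gen: "generating_matrix d r F G"
    and cond_iv: "card (spectrum (N_xi d r \<xi> G)) = r"
  shows "tensor_decomposition r (d - 1) (\<lambda>i m. complex_of_real (p i (m + 1))) G \<xi>"
proof -
  let ?P = "\<lambda>i m. complex_of_real (p i (m + 1))"
  have P0: "?P s 0 \<noteq> 0" if "s \<in> {1..r}" for s using cond_i[OF that] by simp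
  have indep: "lin_indep_on r {1..r} ?P"
  proof -
    have img: "(\<lambda>m. m + 1) ` {1..r} = {2..r+1}" by (simp add: image_add_atLeastAtMost')
    show ?thesis
      unfolding lin_indep_on_shift[of r "{1..r}" "\<lambda>i m. complex_of_real (p i m)"] img
      by (rule lin_indep_on_of_real[OF cond_ii])
  qed
  have indep_tail: "lin_indep_on r ({r+1..d-1} - {j}) ?P" if j: "j \<in> {r+1..d-1}" for j
  proof -
    have img: "(\<lambda>m. m + 1) ` ({r+1..d-1} - {j}) = {r+2..j} \<union> {j+2..d}"
    proof (intro equalityI subsetI)
      fix m assume "m \<in> {r+2..j} \<union> {j+2..d}"
      then have "m - 1 \<in> {r+1..d-1} - {j}" "m = m - 1 + 1" using j by auto
      then show "m \<in> (\<lambda>m. m + 1) ` ({r+1..d-1} - {j})" by blast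
    qed (use j in auto)
    show ?thesis
      unfolding lin_indep_on_shift[of r "{r+1..d-1} - {j}" "\<lambda>i m. complex_of_real (p i m)"] img
      by (rule lin_indep_on_of_real[OF cond_iii[OF j]])
  qed
  have G: "?P s 0 * (\<Sum>k=1..r. G k (i, j) * ?P s k) = ?P s i * ?P s j"
    if ij: "i \<in> {1..r}" "j \<in> {r+1..d-1}" and s: "s \<in> {1..r}" for i j s
  proof -
    \<comment> \<open>The residual of the separated equation. The generating equation says that the
      \<open>P s\<close>, weighted by \<open>a s\<close>, sum to 0; the tail without label
      \<open>r + 1\<close> is already independent.\<close>
    define a where "a s = ?P s 0 * (\<Sum>k=1..r. G k (i, j) * ?P s k) - ?P s i * ?P s j" for s
    have "(\<Sum>s=1..r. a s * ?P s t) = 0" if t: "t \<in> {r+1..d-1} - {r+1}" for t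
    proof -
      have "t \<in> {0..d-1}" using t by auto
      then have "(\<Sum>k=1..r. G k (i, j) * F (0, k, t)) = F (i, j, t)"
        using gen ij unfolding generating_matrix_def by blast
      moreover have "(\<Sum>k=1..r. G k (i, j) * F (0, k, t)) = (\<Sum>s=1..r. (?P s 0 * (\<Sum>k=1..r. G k (i, j) * ?P s k)) * ?P s t)"
        unfolding F sum_distrib_left sum_distrib_right by (subst sum.swap) (simp only: mult_ac)
      ultimately show ?thesis by (simp only: a_def left_diff_distrib sum_subtractf F diff_self)
    qed
    moreover have "lin_indep_on r ({r+1..d-1} - {r+1}) ?P" using r by (intro indep_tail) simp
    ultimately have "a s = 0" using lin_indep_onD[of r _ ?P a s] s by blast
    then show ?thesis by (simp add: a_def)
  qed
  have "inj_on (\<lambda>s. \<Sum>j=r+1..d-1. \<xi> j * (?P s j / ?P s 0)) {1..r}"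
  proof (rule eigenvalues_distinct[OF indep _ cond_iv])
    fix i j s assume *: "i \<in> {1..r}" "j \<in> {r+1..d-1}" "s \<in> {1..r}"
    show "(\<Sum>k=1..r. G k (i, j) * ?P s k) = ?P s j / ?P s 0 * ?P s i"
      using G[OF *] P0[OF *(3)] by (simp add: field_simps)
  qed
  with P0 indep indep_tail G show ?thesis using r by unfold_locales auto
qed

text \<open>Summing all errors over the components before extracting the bound yields a single
  constant. The permutation from Step 4 serves weights, means and variances alike.\<close>

lemma (in mixture_estimate) estimates_error:
  assumes step2: "\<And>x. x \<in> X \<Longrightarrow> is_arg_min (\<lambda>q. (norm_on (Omega d) (\<lambda>t. (\<Sum>k=1..r. cube (q k) t) - complex_of_real (M3h x t)))\<^sup>2)
      (\<lambda>_. True) (pst x)"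
    "\<And>x i. x \<in> X \<Longrightarrow> i \<in> {1..r} \<Longrightarrow>
      is_arg_min (\<lambda>z. norm_on {1..d} (\<lambda>m. Im (z * pst x i m))) (\<lambda>z. z ^ 3 = 1) (tau x i)"
    "\<And>x i m. x \<in> X \<Longrightarrow> i \<in> {1..r} \<Longrightarrow> m \<in> {1..d} \<Longrightarrow> qh x i m = Re (tau x i * pst x i m)"
    and step4: "\<And>x. x \<in> X \<Longrightarrow> step_4 d r (M1h x) (M3h x) (ws x) (ms x)"
    and step5: "\<And>x j. x \<in> X \<Longrightarrow> j \<in> {1..d} \<Longrightarrow> is_arg_min
        (\<lambda>b. (norm_on {1..d} (\<lambda>m. a_hat (\<lambda>t. M3h x t - (\<Sum>i=1..r. cube (qh x i) t)) j m -
           (\<Sum>i=1..r. ws x i * ms x i m * b i)))\<^sup>2)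
        (\<lambda>b. \<forall>i\<in>{1..r}. 0 \<le> b i) (\<lambda>i. B x i j)"
    and X: "\<forall>\<^sub>F x in FF. x \<in> X"
  shows "\<exists>\<sigma> C. 0 < C \<and> (\<forall>\<^sub>F x in FF. \<sigma> x permutes {1..r} \<and> (\<forall>t\<in>{1..r}.
      norm_on {1..d} (\<lambda>m. \<mu> t m - ms x (\<sigma> x t) m) \<le> C * e x \<and>
      \<bar>\<omega> t - ws x (\<sigma> x t)\<bar> \<le> C * e x \<and>
      norm_on ({1..d} \<times> {1..d}) (\<lambda>jl. diag_matrix (\<lambda>j. (s t j)\<^sup>2) jl - diag_matrix (B x (\<sigma> x t)) jl) \<le> C * e x))"
proof -
  obtain \<sigma>2 where \<sigma>2: "\<forall>\<^sub>F x in FF. \<sigma>2 x permutes {1..r}"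
    "\<And>t m. t \<in> {1..r} \<Longrightarrow> m \<in> {1..d} \<Longrightarrow> small (\<lambda>x. qh x (\<sigma>2 x t) m - p t m)"
    using step2_near[OF step2 X] by blast
  obtain \<sigma> where \<sigma>: "\<forall>\<^sub>F x in FF. \<sigma> x permutes {1..r}"
    and ws: "\<And>t. t \<in> {1..r} \<Longrightarrow> small (\<lambda>x. ws x (\<sigma> x t) - \<omega> t)"
    and ms: "\<And>t m. t \<in> {1..r} \<Longrightarrow> m \<in> {1..d} \<Longrightarrow> small (\<lambda>x. ms x (\<sigma> x t) m - \<mu> t m)"
    using step4_near[OF step4 X] by blast
  have B: "small (\<lambda>x. B x (\<sigma> x t) j - (s t j)\<^sup>2)" if "j \<in> {1..d}" "t \<in> {1..r}" for j t
    by (rule step5_near[where ?\<sigma>2.0 = \<sigma>2 and qh = qh and \<sigma> = \<sigma> and ws = ws and ms = ms and X = X and B = B,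
          OF \<sigma>2 \<sigma> ws ms step5[OF _ that(1)] X that])
  define Z1 where "Z1 x t = norm_on {1..d} (\<lambda>m. \<mu> t m - ms x (\<sigma> x t) m)" for x t
  define Z2 where "Z2 x t = \<bar>\<omega> t - ws x (\<sigma> x t)\<bar>" for x t
  define Z3 where "Z3 x t = norm_on ({1..d} \<times> {1..d}) (\<lambda>jl. diag_matrix (\<lambda>j. (s t j)\<^sup>2) jl - diag_matrix (B x (\<sigma> x t)) jl)" for x t
  have "small (\<lambda>x. \<Sum>t=1..r. Z1 x t + Z2 x t + Z3 x t)"
  proof (intro small_sum small_add)
    fix t assume t: "t \<in> {1..r}"
    show "small (\<lambda>x. Z1 x t)"
      unfolding Z1_def by (intro small_norm_on near_sym[OF ms[OF t]])
    show "small (\<lambda>x. Z2 x t)"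
      using near_sym[OF ws[OF t]] unfolding Z2_def real_norm_def[symmetric] small_iff_norm .
    show "small (\<lambda>x. Z3 x t)"
      unfolding Z3_def
    proof (rule small_norm_on)
      fix jl assume "jl \<in> {1..d} \<times> {1..d}"
      then obtain j l where jl: "jl = (j, l)" "j \<in> {1..d}" by auto
      show "small (\<lambda>x. diag_matrix (\<lambda>j. (s t j)\<^sup>2) jl - diag_matrix (B x (\<sigma> x t)) jl)"
        using near_sym[OF B[OF jl(2) t]] by (cases "j = l") (auto simp: jl(1) diag_matrix_def small_zero)
    qed
  qed
  then obtain C where C: "0 < C" "\<forall>\<^sub>F x in FF. norm (\<Sum>t=1..r. Z1 x t + Z2 x t + Z3 x t) \<le> C * e x"
    by (rule smallE)
  have nn: "0 \<le> Z1 x t" "0 \<le> Z2 x t" "0 \<le> Z3 x t" for x t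
    by (simp_all add: Z1_def Z2_def Z3_def norm_on_nonneg)
  have "\<forall>\<^sub>F x in FF. \<sigma> x permutes {1..r} \<and> (\<forall>t\<in>{1..r}. Z1 x t \<le> C * e x \<and> Z2 x t \<le> C * e x \<and> Z3 x t \<le> C * e x)"
    using \<sigma> C(2)
  proof eventually_elim
    case (elim x)
    have "Z1 x t \<le> C * e x \<and> Z2 x t \<le> C * e x \<and> Z3 x t \<le> C * e x" if t: "t \<in> {1..r}" for t
    proof -
      have "Z1 x t + Z2 x t + Z3 x t \<le> (\<Sum>t=1..r. Z1 x t + Z2 x t + Z3 x t)"
        using t nn by (intro member_le_sum[where f = "\<lambda>t. Z1 x t + Z2 x t + Z3 x t"]) (auto intro: add_nonneg_nonneg)
      also have "\<dots> \<le> C * e x" using elim(2) by simp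
      finally show ?thesis using nn[of x t] by linarith
    qed
    with elim(1) show ?case by blast
  qed
  with C(1) show ?thesis unfolding Z1_def Z2_def Z3_def by blast
qed

text \<open>The outcome of a run together with the witnesses of its intermediate choices.\<close>

datatype run = Run (run_size: nat) (run_samples: "nat \<Rightarrow> nat \<Rightarrow> real")
  (run_pstar: "nat \<Rightarrow> nat \<Rightarrow> complex") (run_tau: "nat \<Rightarrow> complex") (run_qhat: "nat \<Rightarrow> nat \<Rightarrow> real")
  (run_weights: "nat \<Rightarrow> real") (run_means: "nat \<Rightarrow> nat \<Rightarrow> real") (run_variances: "nat \<Rightarrow> nat \<Rightarrow> real")

theorem theorem5p2:
  fixes d r n :: nat
    and \<omega> :: "nat \<Rightarrow> real" and \<mu> \<sigma> :: "nat \<Rightarrow> nat \<Rightarrow> real"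
    and \<Sigma> :: "nat \<Rightarrow> nat \<times> nat \<Rightarrow> real"
    and p :: "nat \<Rightarrow> nat \<Rightarrow> real"
    and M1 :: "nat \<Rightarrow> real" and M3 :: "real tensor3"
    and F :: "complex tensor3" and G :: gmatrix and \<xi> :: "nat \<Rightarrow> complex"
  assumes r_le: "real r \<le> real d / 2 - 1"
    and n_def: "n = d - 1"
    and weights_pos: "\<And>i. i \<in> {1..r} \<Longrightarrow> 0 < \<omega> i"
    and weights_sum: "(\<Sum>i=1..r. \<omega> i) = 1"
    and Sigma_def: "\<Sigma> = (\<lambda>i. diag_matrix (\<lambda>j. (\<sigma> i j)\<^sup>2))"
    and M1_def: "M1 = moment1 (gaussian_mixture d r \<omega> \<mu> \<sigma>)"
    and M3_def: "M3 = moment3 (gaussian_mixture d r \<omega> \<mu> \<sigma>)"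
    and p_def: "p = (\<lambda>i m. root 3 (\<omega> i) * \<mu> i m)"
    and F_def: "F = (\<lambda>t. of_real (\<Sum>i=1..r. \<omega> i * cube (\<mu> i) t))"
    and cond_i: "\<And>i. i \<in> {1..r} \<Longrightarrow> p i 1 \<noteq> 0"
    and cond_ii: "lin_indep_on r {2..r+1} p"
    and cond_iii: "\<And>j. j \<in> {r+1..n} \<Longrightarrow> lin_indep_on r ({r+2..j} \<union> {j+2..d}) p"
    and gen: "generating_matrix d r F G"
    and cond_iv: "card (spectrum (N_xi d r \<xi> G)) = r"
  shows "\<exists>\<epsilon>0>0. \<exists>C>0. \<forall>N y \<omega>s \<mu>s \<Sigma>s \<epsilon>.
           N \<ge> 1 \<longrightarrow>
           learning_output d r \<xi> N y \<omega>s \<mu>s \<Sigma>s \<longrightarrow>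
           \<epsilon> = max (norm_on (all_labels d) (\<lambda>t. M3 t - sample_moment3 N y t))
                   (norm_on {1..d} (\<lambda>m. M1 m - sample_moment1 N y m)) \<longrightarrow>
           \<epsilon> \<le> \<epsilon>0 \<longrightarrow>
           (\<exists>\<pi>. \<pi> permutes {1..r} \<and>
              (\<forall>i\<in>{1..r}.
                 norm_on {1..d} (\<lambda>m. \<mu> (\<pi> i) m - \<mu>s i m) \<le> C * \<epsilon> \<and>
                 \<bar>\<omega> (\<pi> i) - \<omega>s i\<bar> \<le> C * \<epsilon> \<and>
                 norm_on ({1..d} \<times> {1..d}) (\<lambda>t. \<Sigma> (\<pi> i) t - \<Sigma>s i t) \<le> C * \<epsilon>))"
proof -
  have r1: "1 \<le> r" using weights_sum by (cases r) auto
  have rd: "2 * r + 2 \<le> d" using r_le by linarith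
  have \<omega>0: "0 \<le> \<omega> i" if "i \<in> {1..r}" for i using weights_pos[OF that] by simp
  have cube_p: "cube (p i) t = \<omega> i * cube (\<mu> i) t" for i t
    by (simp only: p_def cube_root_scaled)
  have "mixture d r \<omega> \<mu> \<sigma> G \<xi> p M1 M3"
  proof (rule mixture.intro)
    show "tensor_decomposition r (d - 1) (\<lambda>i m. complex_of_real (p i (m + 1))) G \<xi>"
    proof (rule tensor_decomposition_of_mixture[OF r1 _ _ cond_i cond_ii cond_iii gen cond_iv])
      show "F (i, j, k) = (\<Sum>s=1..r. complex_of_real (p s (i + 1)) * of_real (p s (j + 1)) * of_real (p s (k + 1)))" for i j k
        unfolding F_def cube_p[symmetric] by (simp add: cube_def)
    qed (use rd n_def in auto)
    show "M1 m = (\<Sum>i=1..r. \<omega> i * \<mu> i m)" if "m \<in> {1..d}" for m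
      unfolding M1_def by (rule moment1_gaussian_mixture[OF \<omega>0 r1 that])
    show "M3 t = (\<Sum>i=1..r. cube (p i) t)" if "t \<in> Omega d" for t
      unfolding M3_def cube_p by (rule moment3_gaussian_mixture_Omega[OF \<omega>0 r1 that])
    show "a_hat (\<lambda>t. M3 t - (\<Sum>i=1..r. cube (p i) t)) j l = (\<Sum>i=1..r. \<omega> i * \<mu> i l * (\<sigma> i j)\<^sup>2)"
      if "j \<in> {1..d}" "l \<in> {1..d}" for j l
      unfolding M3_def cube_p by (rule moment3_gaussian_mixture_diag[OF \<omega>0 r1 that])
    show "0 < d" "r + 1 \<le> d" using rd by simp_all
  qed (fact p_def cond_i cond_ii weights_pos weights_sum)+
  then interpret mixture d r \<omega> \<mu> \<sigma> G \<xi> p M1 M3 .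
  define M1h where "M1h x = sample_moment1 (run_size x) (run_samples x)" for x
  define M3h where "M3h x = sample_moment3 (run_size x) (run_samples x)" for x
  define X where "X = {x.
    is_arg_min (\<lambda>q. (norm_on (Omega d) (\<lambda>t. (\<Sum>k=1..r. cube (q k) t) - complex_of_real (M3h x t)))\<^sup>2)
      (\<lambda>_. True) (run_pstar x) \<and>
    (\<forall>i\<in>{1..r}. is_arg_min (\<lambda>z. norm_on {1..d} (\<lambda>m. Im (z * run_pstar x i m))) (\<lambda>z. z ^ 3 = 1) (run_tau x i) \<and>
      (\<forall>m\<in>{1..d}. run_qhat x i m = Re (run_tau x i * run_pstar x i m))) \<and>
    step_4 d r (M1h x) (M3h x) (run_weights x) (run_means x) \<and>
    (\<forall>j\<in>{1..d}. is_arg_min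
        (\<lambda>b. (norm_on {1..d} (\<lambda>m. a_hat (\<lambda>t. M3h x t - (\<Sum>i=1..r. cube (run_qhat x i) t)) j m -
           (\<Sum>i=1..r. run_weights x i * run_means x i m * b i)))\<^sup>2)
        (\<lambda>b. \<forall>i\<in>{1..r}. 0 \<le> b i) (\<lambda>i. run_variances x i j))}"
  define e where "e x = max (norm_on (all_labels d) (\<lambda>t. M3 t - M3h x t)) (norm_on {1..d} (\<lambda>m. M1 m - M1h x m))" for x
  \<comment> \<open>Runs with error tending to 0, over all sample sizes, samples and choices of
    optimizers. Unfolded, \<open>eventually\<close> is a threshold valid for all such runs at once,
    so the constants depend on the parameters and \<open>\<xi>\<close> only.\<close>
  define FF where "FF = inf (filtercomap e (nhds 0)) (principal X)"
  have FF: "eventually Q FF \<longleftrightarrow> (\<exists>\<epsilon>>0. \<forall>x\<in>X. \<bar>e x\<bar> < \<epsilon> \<longrightarrow> Q x)" for Q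
  proof
    assume "eventually Q FF"
    then obtain Q' \<epsilon> where "\<epsilon> > 0" "\<And>z. dist z 0 < \<epsilon> \<Longrightarrow> Q' z" "\<And>x. Q' (e x) \<Longrightarrow> x \<in> X \<Longrightarrow> Q x"
      unfolding FF_def eventually_inf_principal eventually_filtercomap eventually_nhds_metric by blast
    then show "\<exists>\<epsilon>>0. \<forall>x\<in>X. \<bar>e x\<bar> < \<epsilon> \<longrightarrow> Q x" by (intro exI[of _ \<epsilon>]) (simp add: dist_norm)
  next
    assume "\<exists>\<epsilon>>0. \<forall>x\<in>X. \<bar>e x\<bar> < \<epsilon> \<longrightarrow> Q x"
    then obtain \<epsilon> where "\<epsilon> > 0" "\<forall>x\<in>X. \<bar>e x\<bar> < \<epsilon> \<longrightarrow> Q x" by blast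
    then show "eventually Q FF"
      unfolding FF_def eventually_inf_principal eventually_filtercomap eventually_nhds_metric
      by (intro exI[of _ "\<lambda>z. \<bar>z\<bar> < \<epsilon>"] conjI exI[of _ \<epsilon>]) (simp_all add: dist_norm)
  qed
  have e0: "0 \<le> e x" for x by (simp add: e_def norm_on_nonneg le_max_iff_disj)
  interpret error_filter FF e
  proof
    show "(e \<longlongrightarrow> 0) FF"
      unfolding FF_def by (rule tendsto_mono[OF inf_le1 filterlim_filtercomap])
  qed (simp add: e0)
  interpret mixture_estimate d r \<omega> \<mu> \<sigma> G \<xi> p M1 M3 FF e M1h M3h
  proof
    have fin: "finite (all_labels d)" by (simp add: all_labels_def)
    show "small (\<lambda>x. M1h x m - M1 m)" if "m \<in> {1..d}" for m
      using norm_le_norm_on[OF finite_atLeastAtMost that, of "\<lambda>m. M1 m - M1h _ m"]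
      by (intro smallI[of _ 1] always_eventually allI)
        (simp add: e_def le_max_iff_disj abs_minus_commute)
    show "small (\<lambda>x. M3h x t - M3 t)" if "t \<in> all_labels d" for t
      using norm_le_norm_on[OF fin that, of "\<lambda>t. M3 t - M3h _ t"]
      by (intro smallI[of _ 1] always_eventually allI)
        (simp add: e_def le_max_iff_disj abs_minus_commute)
  qed
  have "\<forall>\<^sub>F x in FF. x \<in> X" unfolding FF by (intro exI[of _ 1]) simp
  from estimates_error[of X run_pstar run_tau run_qhat run_weights run_means run_variances, OF _ _ _ _ _ this]
  obtain \<sigma>' C where C: "0 < C" and ev: "\<forall>\<^sub>F x in FF. \<sigma>' x permutes {1..r} \<and> (\<forall>t\<in>{1..r}.
      norm_on {1..d} (\<lambda>m. \<mu> t m - run_means x (\<sigma>' x t) m) \<le> C * e x \<and>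
      \<bar>\<omega> t - run_weights x (\<sigma>' x t)\<bar> \<le> C * e x \<and>
      norm_on ({1..d} \<times> {1..d}) (\<lambda>jl. diag_matrix (\<lambda>j. (\<sigma> t j)\<^sup>2) jl - diag_matrix (run_variances x (\<sigma>' x t)) jl) \<le> C * e x)"
    unfolding X_def by blast
  from ev obtain \<epsilon>1 where \<epsilon>1: "\<epsilon>1 > 0" and bound: "\<And>x. x \<in> X \<Longrightarrow> \<bar>e x\<bar> < \<epsilon>1 \<Longrightarrow> \<sigma>' x permutes {1..r} \<and> (\<forall>t\<in>{1..r}.
      norm_on {1..d} (\<lambda>m. \<mu> t m - run_means x (\<sigma>' x t) m) \<le> C * e x \<and>
      \<bar>\<omega> t - run_weights x (\<sigma>' x t)\<bar> \<le> C * e x \<and>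
      norm_on ({1..d} \<times> {1..d}) (\<lambda>jl. diag_matrix (\<lambda>j. (\<sigma> t j)\<^sup>2) jl - diag_matrix (run_variances x (\<sigma>' x t)) jl) \<le> C * e x)"
    unfolding FF by blast
  \<comment> \<open>Halving \<open>\<epsilon>1\<close> turns the strict inequality from the filter
    into the required \<open>\<le>\<close>.\<close>
  show ?thesis
  proof (rule exI[of _ "\<epsilon>1 / 2"], intro conjI exI[of _ C] allI impI C)
    show "0 < \<epsilon>1 / 2" using \<epsilon>1 by simp
    fix N y \<omega>s \<mu>s \<Sigma>s \<epsilon>
    assume out: "learning_output d r \<xi> N y \<omega>s \<mu>s \<Sigma>s"
      and \<epsilon>: "\<epsilon> = max (norm_on (all_labels d) (\<lambda>t. M3 t - sample_moment3 N y t))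
                   (norm_on {1..d} (\<lambda>m. M1 m - sample_moment1 N y m))" "\<epsilon> \<le> \<epsilon>1 / 2"
    obtain qhat where step2: "step_2 d r \<xi> (sample_moment3 N y) qhat"
      and step4: "step_4 d r (sample_moment1 N y) (sample_moment3 N y) \<omega>s \<mu>s"
      and step5: "step_5 d r (sample_moment3 N y) qhat \<omega>s \<mu>s \<Sigma>s"
      using out unfolding learning_output_def Let_def by blast
    obtain pstar \<tau> where approx: "tensor_approx d r \<xi> (\<lambda>t. of_real (sample_moment3 N y t)) pstar"
      and \<tau>: "\<forall>i\<in>{1..r}. is_arg_min (\<lambda>z. norm_on {1..d} (\<lambda>m. Im (z * pstar i m))) (\<lambda>z. z ^ 3 = 1) (\<tau> i) \<and>
           (\<forall>m\<in>{1..d}. qhat i m = Re (\<tau> i * pstar i m))"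
      using step2 unfolding step_2_def by blast
    obtain B where B: "\<forall>j\<in>{1..d}. is_arg_min
              (\<lambda>b. (norm_on {1..d} (\<lambda>m. a_hat (\<lambda>t. sample_moment3 N y t - (\<Sum>i=1..r. cube (qhat i) t)) j m -
                                         (\<Sum>i=1..r. \<omega>s i * \<mu>s i m * b i)))\<^sup>2)
              (\<lambda>b. \<forall>i\<in>{1..r}. 0 \<le> b i) (\<lambda>i. B i j)"
      and \<Sigma>s: "\<And>i. i \<in> {1..r} \<Longrightarrow> \<Sigma>s i = diag_matrix (B i)"
      using step5 unfolding step_5_def by blast
    define x where "x = Run N y pstar \<tau> qhat \<omega>s \<mu>s B"
    have "x \<in> X"
      using approx \<tau> step4 B unfolding X_def x_def M1h_def M3h_def tensor_approx_def by simp
    moreover have e: "e x = \<epsilon>" by (simp add: e_def x_def M1h_def M3h_def \<epsilon>(1))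
    moreover have "\<bar>e x\<bar> < \<epsilon>1" using e0[of x] e \<epsilon>(2) \<epsilon>1 by simp
    ultimately have perm: "\<sigma>' x permutes {1..r}" and
      est: "\<And>t. t \<in> {1..r} \<Longrightarrow> norm_on {1..d} (\<lambda>m. \<mu> t m - \<mu>s (\<sigma>' x t) m) \<le> C * \<epsilon> \<and>
        \<bar>\<omega> t - \<omega>s (\<sigma>' x t)\<bar> \<le> C * \<epsilon> \<and>
        norm_on ({1..d} \<times> {1..d}) (\<lambda>jl. diag_matrix (\<lambda>j. (\<sigma> t j)\<^sup>2) jl - diag_matrix (B (\<sigma>' x t)) jl) \<le> C * \<epsilon>"
      using bound[of x] by (simp_all add: x_def)
    \<comment> \<open>\<open>\<sigma>'\<close> sends true components to computed ones, whereas the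
      claim relabels the true ones; hence the inverse.\<close>
    let ?\<pi> = "inv_into UNIV (\<sigma>' x)"
    have \<pi>: "?\<pi> permutes {1..r}" by (rule permutes_inv[OF perm])
    show "\<exists>\<pi>. \<pi> permutes {1..r} \<and>
              (\<forall>i\<in>{1..r}.
                 norm_on {1..d} (\<lambda>m. \<mu> (\<pi> i) m - \<mu>s i m) \<le> C * \<epsilon> \<and>
                 \<bar>\<omega> (\<pi> i) - \<omega>s i\<bar> \<le> C * \<epsilon> \<and>
                 norm_on ({1..d} \<times> {1..d}) (\<lambda>t. \<Sigma> (\<pi> i) t - \<Sigma>s i t) \<le> C * \<epsilon>)"
    proof (intro exI[of _ ?\<pi>] conjI[OF \<pi>] ballI)
      fix i assume i: "i \<in> {1..r}"
      have "?\<pi> i \<in> {1..r}" using permutes_in_image[OF \<pi>] i by simp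
      from est[OF this] show "norm_on {1..d} (\<lambda>m. \<mu> (?\<pi> i) m - \<mu>s i m) \<le> C * \<epsilon> \<and>
                 \<bar>\<omega> (?\<pi> i) - \<omega>s i\<bar> \<le> C * \<epsilon> \<and>
                 norm_on ({1..d} \<times> {1..d}) (\<lambda>t. \<Sigma> (?\<pi> i) t - \<Sigma>s i t) \<le> C * \<epsilon>"
        by (simp only: permutes_inverses(1)[OF perm] \<Sigma>s[OF i] Sigma_def)
    qed
  qed
qed

end
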